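(* Let $\mathbf p=(p_k)_{k\ge0}$ be a probability mass function on $\{0,1,2,\dots\}$ and $Z\sim\mathbf p$. Assume $\mathbb E[Z]<\infty$, $p_0\in(0,1)$, $p_0+p_1<1$ and $\gcd\{j:p_j>0\}=1$. Fix a vertex $v_k$ and a damping factor $c\in(0,1)$, let $R_{v_k,c}(n)$ denote the graph normalized PageRank score of $v_k$ in $\mathcal T_n(\mathbf p)$, and let $f,R,s_0,q_*$ be as in the context. (a) Suppose $\mathbb E[Z]>1$. (i) For $k=0$ (root PageRank), $R_{v_0,c}(n)/n$ is bounded away from zero in probability: for any $\delta>0$ there exists $\varepsilon>0$ such that $$\liminf_{n\to\infty}\mathbb P\Big(\frac{R_{v_0,c}(n)}n\ge c(1-c)(1-q_* )-\varepsilon\Big)\ge1-\delta.$$ (ii) For any $k\ge1$ and any $\delta>0$, as $n\to\infty$, $$\frac{R_{v_k,c}(n)}{n^{\frac1R-\delta}}\xrightarrow{a.s.}\infty\qquad\text{and}\qquad\frac{R_{v_k,c}(n)}{n^{\frac1R}(\log n)^{1+\delta}}\xrightarrow{a.s.}0.$$ (b) Suppose $\mathbb E[Z]\le1$. (i) If $c\in(0,s_0^{-1}]$ with $c<1$, then for any $\delta>0$ and any vertex $v_k$, $k\ge0$, as $n\to\infty$, $$\frac{R_{v_k,c}(n)}{n^{\frac1R-\delta}}\xrightarrow{a.s.}\infty\qquad\text{and}\qquad\frac{R_{v_k,c}(n)}{n^{\frac1R}(\log n)^{1+\delta}}\xrightarrow{a.s.}0.$$ (ii) Suppose $s_0>1$,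 $c\in(s_0^{-1},1)$ and $k\ge0$. Then there exists a non-negative random variable $W_{k,c}$ with $\mathbb P(W_{k,c}>0)>0$ such that $$\frac{R_{v_k,c}(n)}{n^{cf(1/c)}}\xrightarrow{a.s.}W_{k,c}\qquad(n\to\infty).$$
   Context: Discrete model. Let $Z_1,Z_2,\dots$ be i.i.d. with law $\mathbf p$. The random trees $\mathcal T_n=\mathcal T_n(\mathbf p)$, $n\ge1$, are rooted at $v_0$, with edges directed from children to parents. $\mathcal T_1$ has vertices $v_0,v_1$ and a directed edge from $v_1$ to $v_0$. Given $\mathcal T_n$ with vertex set $\{v_0,\dots,v_n\}$, a new vertex $v_{n+1}$ selects a vertex $V_n$ uniformly at random from $\{v_0,\dots,v_n\}$ and attaches (by a directed edge from $v_{n+1}$) to the vertex at distance $\min(Z_{n+1},\mathrm{dist}(v_0,V_n))$ from $V_n$ on the path from $V_n$ to $v_0$. Here $V_n$ and $Z_{n+1}$ are independent of each other and $Z_{n+1}$ is independent of the past. PageRank. For $v\in\mathcal T_n$ let $P_l(v,n)$ be the number of directed paths of length $l$ in $\mathcal T_n$ that end at $v$ (i.e. the number of descendants of $v$ at distance $l$). The graph normalized PageRank score with damping factor $c\in(0,1)$ is $$R_{v,c}(n)=(1-c)\Big(1+\sum_{l=1}^\infty c^lP_l(v,n)\Big).$$ Constants. $f(s)=\sum_{k\ge0}p_ks^k$, $s\ge0$. $s_0$ is the unique positive root of $sf'(s)=f(s)$ if it exists, and otherwise the radius of convergence of $f$. $R:=\lim_{s\uparrow s_0}s/f(s)$. $q_*$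 is the smallest positive solution of $f(q)=q$ (the extinction probability of a Galton–Watson process with offspring law $\mathbf p$). *)

theory Defs
  imports
    "HOL-Probability.Probability"
    "Graph_Theory.Pair_Digraph"
begin

section \<open>The attachment tree\<close>

text \<open>
  The vertex $v_i$ is the natural number $i$, so the root is 0; an arc \<open>(u, w)\<close> is directed from the
  child \<open>u\<close> to its parent \<open>w\<close>. In a tree all of whose arcs point towards the root, the path from \<open>v\<close>
  to the root is the unique directed one, and its number of arcs is the distance from \<open>v\<close> to the root.
\<close>

definition root_path :: "nat pair_pre_digraph \<Rightarrow> nat \<Rightarrow> (nat \<times> nat) awalk" where
  "root_path G v = (THE p. pre_digraph.apath (with_proj G) v p 0)"

definition root_dist :: "nat pair_pre_digraph \<Rightarrow> nat \<Rightarrow> nat" where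
  "root_dist G v = length (root_path G v)"

text \<open>The vertex at distance \<open>min z (root_dist G v)\<close> from \<open>v\<close> on the path from \<open>v\<close> to the root.\<close>

definition attach_point :: "nat pair_pre_digraph \<Rightarrow> nat \<Rightarrow> nat \<Rightarrow> nat" where
  "attach_point G v z =
     pre_digraph.awalk_verts (with_proj G) v (root_path G v) ! min z (root_dist G v)"

text \<open>
  The tree $\mathcal T_n$ built from realisations \<open>z i\<close> of $Z_i$ and \<open>u i\<close> of $V_i$. The model
  starts at $n = 1$; the value at 0 is only a filler.
\<close>

fun attach_tree :: "(nat \<Rightarrow> nat) \<Rightarrow> (nat \<Rightarrow> nat) \<Rightarrow> nat \<Rightarrow> nat pair_pre_digraph" where
  "attach_tree z u 0 = \<lparr> pverts = {0}, parcs = {} \<rparr>"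
| "attach_tree z u (Suc 0) = \<lparr> pverts = {0, 1}, parcs = {(1, 0)} \<rparr>"
| "attach_tree z u (Suc (Suc n)) =
     (let G = attach_tree z u (Suc n)
      in \<lparr> pverts = insert (Suc (Suc n)) (pverts G),
           parcs = insert (Suc (Suc n), attach_point G (u (Suc n)) (z (Suc (Suc n)))) (parcs G) \<rparr>)"

text \<open>
  The variables $Z_1, Z_2, \dots$ and $V_1, V_2, \dots$ are mutually independent, the tags \<open>Inl\<close> and
  \<open>Inr\<close> separating the two families. This is the same as asking that, for every \<open>n\<close>, $V_n$ and
  $Z_{n+1}$ are independent of each other and, jointly, of everything sampled before.
\<close>

locale attachment_model = prob_space M for M :: "'a measure" +
  fixes p :: "nat pmf" and Z V :: "nat \<Rightarrow> 'a \<Rightarrow> nat"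
  assumes indep: "indep_vars (\<lambda>_. count_space UNIV) (case_sum Z V) (Inl ` {1..} \<union> Inr ` {1..})"
    and law_Z: "\<And>n. n \<ge> 1 \<Longrightarrow> distr M (count_space UNIV) (Z n) = measure_pmf p"
    and law_V: "\<And>n. n \<ge> 1 \<Longrightarrow> distr M (count_space UNIV) (V n) = measure_pmf (pmf_of_set {0..n})"

definition random_tree ::
    "(nat \<Rightarrow> 'a \<Rightarrow> nat) \<Rightarrow> (nat \<Rightarrow> 'a \<Rightarrow> nat) \<Rightarrow> nat \<Rightarrow> 'a \<Rightarrow> nat pair_pre_digraph" where
  "random_tree Z V n \<omega> = attach_tree (\<lambda>i. Z i \<omega>) (\<lambda>i. V i \<omega>) n"

section \<open>PageRank\<close>

definition num_paths_to :: "'v pair_pre_digraph \<Rightarrow> nat \<Rightarrow> 'v \<Rightarrow> nat" where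
  "num_paths_to G l v = card {p. length p = l \<and> (\<exists>u. pre_digraph.apath (with_proj G) u p v)}"

definition pagerank :: "real \<Rightarrow> 'v pair_pre_digraph \<Rightarrow> 'v \<Rightarrow> real" where
  "pagerank c G v = (1 - c) * (1 + (\<Sum>l. c ^ Suc l * real (num_paths_to G (Suc l) v)))"

section \<open>Constants attached to the law\<close>

text \<open>
  The real-valued series below are meaningful only at points of convergence, so summability is part
  of the defining conditions. The derivative is the termwise one; it agrees with the analytic
  derivative inside the disc of convergence and is the one-sided derivative at its boundary.
\<close>

definition gen_fun :: "nat pmf \<Rightarrow> real \<Rightarrow> real" where
  "gen_fun p s = (\<Sum>k. pmf p k * s ^ k)"

definition gen_fun_deriv :: "nat pmf \<Rightarrow> real \<Rightarrow> real" where
  "gen_fun_deriv p s = (\<Sum>k. diffs (pmf p) k * s ^ k)"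

definition critical_root :: "nat pmf \<Rightarrow> real \<Rightarrow> bool" where
  "critical_root p s \<longleftrightarrow> s > 0 \<and>
     summable (\<lambda>k. pmf p k * s ^ k) \<and> summable (\<lambda>k. diffs (pmf p) k * s ^ k) \<and>
     s * gen_fun_deriv p s = gen_fun p s"

definition s0 :: "nat pmf \<Rightarrow> real" where
  "s0 p = (if \<exists>s. critical_root p s then THE s. critical_root p s
           else real_of_ereal (conv_radius (pmf p)))"

definition R_const :: "nat pmf \<Rightarrow> real" where
  "R_const p = Lim (at_left (s0 p)) (\<lambda>s. s / gen_fun p s)"

definition q_star :: "nat pmf \<Rightarrow> real" where
  "q_star p = (LEAST q. q > 0 \<and> summable (\<lambda>k. pmf p k * q ^ k) \<and> gen_fun p q = q)"

end

theory Submission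
  imports Defs "HOL-Library.Discrete_Functions"
begin

text \<open>
  Fix a vertex \<open>k\<close>. A weight \<open>G\<close> on distances gives the weighted population \<open>wpop G\<close>, the sum of
  \<open>G(dist)\<close> over all descendants of \<open>k\<close> including \<open>k\<close>; for \<open>G m = c ^ m\<close> this is the PageRank score up to
  the factor \<open>1 - c\<close>. A new vertex attaches \<open>z\<close> steps above a uniform vertex, so the conditional mean
  increment of \<open>wpop G\<close> at time \<open>n\<close> is \<open>wpop (drift G) / (n + 1)\<close>, where \<open>drift\<close> is the transition operator
  of the walk \<open>m \<mapsto> m + 1 - z\<close> at the boundary 0 (lemma \<open>expected_increment\<close>). Everything then
  depends on weights with \<open>drift G\<close> close to a multiple of \<open>G\<close>: such a multiple \<open>a\<close> is a growth exponent.

  The weights \<open>(1/s) ^ m\<close> satisfy \<open>drift G \<le> (f(s)/s) G\<close>, and \<open>s0\<close> minimises \<open>f(s)/s\<close>, with value \<open>1/R\<close>. For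
  \<open>c \<le> 1/s0\<close> the score is dominated by the population of weight \<open>(1/s0) ^ m\<close>, whose mean is \<open>O(n powr (1/R))\<close>;
  Borel-Cantelli along powers of two and monotonicity give the upper bound. At the root, walks are
  stopped instead of lost, which respects the inequality term by term for \<open>s \<ge> 1\<close> but not for \<open>s < 1\<close>;
  this is why the root behaves differently when the mean of \<open>Z\<close> exceeds 1, where \<open>s0 < 1\<close>.

  For the lower bound, the law is truncated and tilted at the critical point of the truncated
  generating function; a parabola on a long interval times \<open>(1/\<sigma>) ^ m\<close> is a compactly supported weight
  with \<open>drift G \<ge> lam G\<close> and \<open>lam\<close> as close to \<open>1/R\<close> as desired (\<open>ex_compact_lower_weights\<close>). Boundedness of
  the jumps makes the reciprocal of the population decay in mean like \<open>n powr (- lam)\<close>, up to an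
  arbitrarily small loss in the exponent.

  For \<open>c > 1/s0\<close> the point \<open>s = 1/c\<close> lies below \<open>s0\<close>, and the error in \<open>drift G \<le> (f(s)/s) G\<close> is controlled by
  the weight for some \<open>t\<close> between \<open>s\<close> and \<open>s0\<close>, which has a strictly smaller exponent. The normalised
  population is therefore Cauchy in mean square at a polynomial rate, which yields almost sure
  convergence along \<open>i ^ r\<close>, and monotonicity fills the gaps. The weight \<open>(1/s) ^ m - (1/t) ^ m\<close> satisfies
  \<open>drift G \<ge> (f(s)/s) G\<close>, so the limit has positive mean.

  Finally, when the mean of \<open>Z\<close> exceeds 1, there is \<open>u < 1\<close> with \<open>f(u) < u\<close>. For the growing weight
  \<open>(1/u) ^ m\<close> the drift at the root is a contraction up to a constant, so the depth of a uniform vertex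
  is tight and the score of the root is of linear order with high probability.
\<close>

section \<open>Power series with nonnegative coefficients\<close>

lemma continuous_on_power_series_Icc:
  fixes a :: "nat \<Rightarrow> real"
  assumes b: "0 \<le> b" and sm: "summable (\<lambda>k. \<bar>a k\<bar> * b ^ k)"
  shows "continuous_on {0..b} (\<lambda>s. \<Sum>k. a k * s ^ k)"
proof (rule uniform_limit_theorem)
  show "uniform_limit {0..b} (\<lambda>n s. \<Sum>k<n. a k * s ^ k) (\<lambda>s. \<Sum>k. a k * s ^ k) sequentially"
  proof (rule Weierstrass_m_test[OF _ sm])
    fix n s assume "s \<in> {0..b}"
    then show "norm (a n * s ^ n) \<le> \<bar>a n\<bar> * b ^ n"
      by (auto simp: abs_mult power_abs intro!: mult_left_mono power_mono)
  qed
qed (auto intro!: always_eventually continuous_intros)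

lemma summable_power_series_mono:
  fixes a :: "nat \<Rightarrow> real"
  assumes "\<And>k. 0 \<le> a k" "0 \<le> s" "s \<le> t" "summable (\<lambda>k. a k * t ^ k)"
  shows "summable (\<lambda>k. a k * s ^ k)"
  using assms(4)
  by (rule summable_comparison_test'[where N = 0])
     (use assms in \<open>auto simp: abs_mult power_abs intro!: mult_left_mono power_mono\<close>)

lemma pmf_nat_expectation:
  fixes h :: "nat \<Rightarrow> real"
  shows pmf_nat_integrable_iff:
      "integrable (measure_pmf p) h \<longleftrightarrow> summable (\<lambda>k. \<bar>pmf p k * h k\<bar>)"
    and pmf_nat_expectation_eq:
      "integrable (measure_pmf p) h \<Longrightarrow> measure_pmf.expectation p h = (\<Sum>k. pmf p k * h k)"
proof -
  show "integrable (measure_pmf p) h \<longleftrightarrow> summable (\<lambda>k. \<bar>pmf p k * h k\<bar>)"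
    by (simp add: measure_pmf_eq_density integrable_density integrable_count_space_nat_iff)
  assume h: "integrable (measure_pmf p) h"
  then have "integrable (count_space UNIV) (\<lambda>k. pmf p k * h k)"
    by (simp add: measure_pmf_eq_density integrable_density)
  then show "measure_pmf.expectation p h = (\<Sum>k. pmf p k * h k)"
    by (simp add: measure_pmf_eq_density integral_density integral_count_space_nat)
qed

section \<open>The generating function and its critical point\<close>

text \<open>
  The function \<open>s f'(s) - f(s)\<close>. Its sign is the sign of the derivative of \<open>f(s)/s\<close>, so it governs
  the position of \<open>s0\<close>, which minimises \<open>f(s)/s\<close>.
\<close>

definition excess :: "nat pmf \<Rightarrow> real \<Rightarrow> real" where
  "excess p s = (\<Sum>k. (real k - 1) * pmf p k * s ^ k)"

abbreviation gf_summable :: "nat pmf \<Rightarrow> real \<Rightarrow> bool" where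
  "gf_summable p s \<equiv> summable (\<lambda>k. pmf p k * s ^ k)"

abbreviation gfd_summable :: "nat pmf \<Rightarrow> real \<Rightarrow> bool" where
  "gfd_summable p s \<equiv> summable (\<lambda>k. real k * pmf p k * s ^ k)"

lemma gfd_summable_imp_gf:
  assumes "gfd_summable p s" "0 \<le> s"
  shows "gf_summable p s"
  using assms(1)
proof (rule summable_comparison_test'[where N = 1])
  fix n :: nat assume n: "1 \<le> n"
  have "1 * (pmf p n * s ^ n) \<le> real n * (pmf p n * s ^ n)"
    using n assms(2) by (intro mult_right_mono) auto
  then show "norm (pmf p n * s ^ n) \<le> real n * pmf p n * s ^ n"
    using assms(2) by (simp add: abs_mult mult.assoc)
qed

lemma excess_summable:
  assumes "gfd_summable p s" "0 \<le> s"
  shows "summable (\<lambda>k. (real k - 1) * pmf p k * s ^ k)"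
    and "summable (\<lambda>k. \<bar>(real k - 1) * pmf p k\<bar> * s ^ k)"
proof -
  note f = gfd_summable_imp_gf[OF assms]
  show "summable (\<lambda>k. (real k - 1) * pmf p k * s ^ k)"
    using summable_diff[OF assms(1) f] by (simp add: algebra_simps)
  have "summable (\<lambda>k. real k * pmf p k * s ^ k + pmf p k * s ^ k)"
    by (intro summable_add assms f)
  then show "summable (\<lambda>k. \<bar>(real k - 1) * pmf p k\<bar> * s ^ k)"
  proof (rule summable_comparison_test'[where N = 0])
    fix n :: nat
    have "\<bar>real n - 1\<bar> * (pmf p n * s ^ n) \<le> (real n + 1) * (pmf p n * s ^ n)"
      using assms(2) by (intro mult_right_mono) auto
    also have "\<bar>real n - 1\<bar> * (pmf p n * s ^ n) = norm (\<bar>(real n - 1) * pmf p n\<bar> * s ^ n)"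
      using assms(2) by (simp add: abs_mult mult.assoc)
    finally show "norm (\<bar>(real n - 1) * pmf p n\<bar> * s ^ n) \<le> real n * pmf p n * s ^ n + pmf p n * s ^ n"
      by (simp add: algebra_simps)
  qed
qed

lemma diffs_series_shift:
  "s * (diffs (pmf p) k * s ^ k) = real (Suc k) * pmf p (Suc k) * s ^ Suc k"
  by (simp add: diffs_def)

lemma diffs_summable_iff:
  assumes "s > 0"
  shows "summable (\<lambda>k. diffs (pmf p) k * s ^ k) \<longleftrightarrow> gfd_summable p s"
proof -
  have "summable (\<lambda>k. diffs (pmf p) k * s ^ k) \<longleftrightarrow> summable (\<lambda>k. s * (diffs (pmf p) k * s ^ k))"
    using assms summable_mult_D[of s] summable_mult by auto
  also have "\<dots> \<longleftrightarrow> gfd_summable p s"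
    unfolding diffs_series_shift by (rule summable_Suc_iff)
  finally show ?thesis .
qed

lemma critical_root_iff:
  "critical_root p s \<longleftrightarrow> s > 0 \<and> gfd_summable p s \<and> excess p s = 0"
proof (cases "s > 0 \<and> gfd_summable p s")
  case True
  then have d: "summable (\<lambda>k. diffs (pmf p) k * s ^ k)" and f: "gf_summable p s"
    using diffs_summable_iff gfd_summable_imp_gf by auto
  have "s * gen_fun_deriv p s = (\<Sum>k. real (Suc k) * pmf p (Suc k) * s ^ Suc k)"
    unfolding gen_fun_deriv_def suminf_mult[OF d, symmetric] diffs_series_shift ..
  also have "\<dots> = (\<Sum>k. real k * pmf p k * s ^ k)"
    using suminf_split_head[of "\<lambda>k. real k * pmf p k * s ^ k"] True by simp
  finally have "s * gen_fun_deriv p s - gen_fun p s = excess p s"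
    unfolding gen_fun_def excess_def
    using suminf_diff[of "\<lambda>k. real k * pmf p k * s ^ k" "\<lambda>k. pmf p k * s ^ k"] True f
    by (simp add: algebra_simps)
  then show ?thesis using True d f unfolding critical_root_def by auto
next
  case False
  then show ?thesis unfolding critical_root_def by (auto simp: diffs_summable_iff)
qed

lemma gen_fun_continuous:
  assumes "gf_summable p b" "0 \<le> b"
  shows "continuous_on {0..b} (gen_fun p)"
  unfolding gen_fun_def using assms by (intro continuous_on_power_series_Icc) auto

lemma excess_continuous:
  assumes "gfd_summable p b" "0 \<le> b"
  shows "continuous_on {0..b} (excess p)"
  unfolding excess_def using assms excess_summable(2)
  by (intro continuous_on_power_series_Icc) auto

lemma gfd_summable_mono: "gfd_summable p t \<Longrightarrow> 0 \<le> s \<Longrightarrow> s \<le> t \<Longrightarrow> gfd_summable p s"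
  by (rule summable_power_series_mono[where t = t]) auto

lemma gf_summable_mono: "gf_summable p t \<Longrightarrow> 0 \<le> s \<Longrightarrow> s \<le> t \<Longrightarrow> gf_summable p s"
  by (rule summable_power_series_mono[where t = t]) auto

lemma gf_summable_1: "gf_summable p 1" and gen_fun_1: "gen_fun p 1 = 1"
proof -
  have i: "integrable (measure_pmf p) (\<lambda>_. 1 :: real)" by simp
  show "gf_summable p 1" using pmf_nat_integrable_iff[of p "\<lambda>_. 1"] i by simp
  show "gen_fun p 1 = 1" using pmf_nat_expectation_eq[OF i] by (simp add: gen_fun_def)
qed

lemma gfd_summable_in_conv_radius:
  assumes "ereal s < conv_radius (pmf p)" "0 < s"
  shows "gfd_summable p s"
proof -
  obtain t where t: "s < t" "ereal t < conv_radius (pmf p)"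
    using ereal_dense2[OF assms(1)] by auto
  have "summable (\<lambda>k. pmf p k * x ^ k)" if "norm x < t" for x :: real
  proof (rule summable_in_conv_radius)
    have "ereal (norm x) < ereal t" using that by simp
    then show "ereal (norm x) < conv_radius (pmf p)" using t(2) by (rule less_trans)
  qed
  then have "summable (\<lambda>k. diffs (pmf p) k * s ^ k)"
    using assms(2) t(1) by (intro termdiff_converges[where K = t]) auto
  then show ?thesis using diffs_summable_iff assms(2) by auto
qed

text \<open>
  Convexity of \<open>t ^ k\<close>. Multiplying the tangent inequality at \<open>s\<close> by \<open>s\<close> isolates the excess, so that
  the sign of the excess at \<open>s\<close> decides how the ratios \<open>f(s)/s\<close> and \<open>f(t)/t\<close> compare.
\<close>

lemma power_tangent_ray:
  fixes s t :: real
  assumes "0 \<le> s" "0 \<le> t"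
  shows "t * s ^ k + (real k - 1) * s ^ k * (t - s) \<le> s * t ^ k"
proof (induction k)
  case (Suc k)
  show ?case
  proof (cases k)
    case (Suc j)
    have "t * (t * s ^ k + (real k - 1) * s ^ k * (t - s)) \<le> t * (s * t ^ k)"
      by (intro mult_left_mono Suc.IH assms)
    moreover have "t * (t * s ^ k + (real k - 1) * s ^ k * (t - s))
        - (t * s ^ Suc k + (real (Suc k) - 1) * s ^ Suc k * (t - s)) = s ^ k * real k * (t - s)\<^sup>2"
      by (simp add: power2_eq_square algebra_simps)
    moreover have "0 \<le> s ^ k * real k * (t - s)\<^sup>2" using assms by simp
    ultimately show ?thesis by (simp add: algebra_simps)
  qed (use assms in \<open>simp add: algebra_simps\<close>)
qed (simp add: algebra_simps)

lemma gen_fun_tangent_ray: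
  assumes s: "gfd_summable p s" "0 \<le> s" and t: "gf_summable p t" "0 \<le> t"
  shows "t * gen_fun p s + excess p s * (t - s) \<le> s * gen_fun p t"
proof -
  note f = gfd_summable_imp_gf[OF s] and e = excess_summable(1)[OF s]
  have "t * gen_fun p s + excess p s * (t - s)
      = (\<Sum>k. t * (pmf p k * s ^ k) + (real k - 1) * pmf p k * s ^ k * (t - s))"
    unfolding gen_fun_def excess_def suminf_mult[OF f, symmetric] suminf_mult2[OF e]
    by (rule suminf_add[OF summable_mult[OF f] summable_mult2[OF e]])
  also have "\<dots> \<le> (\<Sum>k. s * (pmf p k * t ^ k))"
  proof (rule suminf_le)
    fix k
    have "pmf p k * (t * s ^ k + (real k - 1) * s ^ k * (t - s)) \<le> pmf p k * (s * t ^ k)"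
      by (intro mult_left_mono power_tangent_ray assms) auto
    then show "t * (pmf p k * s ^ k) + (real k - 1) * pmf p k * s ^ k * (t - s) \<le> s * (pmf p k * t ^ k)"
      by (simp add: algebra_simps)
  next
    show "summable (\<lambda>k. t * (pmf p k * s ^ k) + (real k - 1) * pmf p k * s ^ k * (t - s))"
      by (rule summable_add[OF summable_mult[OF f] summable_mult2[OF e]])
    show "summable (\<lambda>k. s * (pmf p k * t ^ k))" by (rule summable_mult[OF t(1)])
  qed
  also have "\<dots> = s * gen_fun p t" unfolding gen_fun_def by (rule suminf_mult[OF t(1)])
  finally show ?thesis .
qed

locale branching_law =
  fixes p :: "nat pmf"
  assumes p0_pos: "0 < pmf p 0" and p01_less: "pmf p 0 + pmf p 1 < 1"
begin

lemma ex_offspring_ge_2: obtains j where "2 \<le> j" "0 < pmf p j"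
proof -
  have "\<exists>j\<ge>2. 0 < pmf p j"
  proof (rule ccontr)
    assume "\<not> ?thesis"
    then have "\<And>j. 2 \<le> j \<Longrightarrow> pmf p j = 0" by (metis pmf_nonneg less_eq_real_def)
    then have "gen_fun p 1 = (\<Sum>k\<in>{0,1}. pmf p k * 1 ^ k)"
      unfolding gen_fun_def
      by (intro suminf_finite) (auto simp: not_less_eq_eq numeral_2_eq_2 Suc_le_eq)
    then show False using p01_less gen_fun_1 by simp
  qed
  then show ?thesis using that by blast
qed

lemma excess_strict_mono:
  assumes t: "gfd_summable p t" and s: "0 \<le> s" "s < t"
  shows "excess p s < excess p t"
proof -
  obtain j where j: "2 \<le> j" "0 < pmf p j" by (rule ex_offspring_ge_2)
  have ss: "gfd_summable p s" using gfd_summable_mono[OF t] s by simp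
  note es = excess_summable(1)[OF ss s(1)] and et = excess_summable(1)[OF t]
  let ?d = "\<lambda>k. (real k - 1) * pmf p k * t ^ k - (real k - 1) * pmf p k * s ^ k"
  have d: "?d k = (real k - 1) * pmf p k * (t ^ k - s ^ k)" for k by (simp add: algebra_simps)
  have "0 < suminf ?d"
  proof (rule suminf_pos2[where i = j])
    show "summable ?d" using es et s by (intro summable_diff) auto
    show "0 \<le> ?d k" for k
    proof (cases k)
      case (Suc m)
      have "s ^ k \<le> t ^ k" using s by (intro power_mono) auto
      then show ?thesis unfolding d using Suc by simp
    qed simp
    show "0 < ?d j" unfolding d using j s by (auto intro!: mult_pos_pos power_strict_mono)
  qed
  also have "suminf ?d = excess p t - excess p s"
    unfolding excess_def using es et s by (intro suminf_diff[symmetric]) auto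
  finally show ?thesis by simp
qed

lemma critical_root_unique:
  assumes "critical_root p s" "critical_root p t"
  shows "s = t"
proof -
  have *: "\<not> x < y" if "critical_root p x" "critical_root p y" for x y
  proof
    assume "x < y"
    then have "excess p x < excess p y"
      using that unfolding critical_root_iff by (intro excess_strict_mono) auto
    then show False using that unfolding critical_root_iff by simp
  qed
  show ?thesis using *[OF assms] *[OF assms(2,1)] by simp
qed

lemma excess_0: "excess p 0 = - pmf p 0"
proof -
  have "excess p 0 = (\<Sum>k\<in>{0}. (real k - 1) * pmf p k * 0 ^ k)"
    unfolding excess_def by (intro suminf_finite) auto
  then show ?thesis by simp
qed

lemma ex_critical_root:
  assumes "gfd_summable p s" "0 \<le> s" "0 \<le> excess p s"
  shows "\<exists>x. critical_root p x"
proof -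
  obtain x where x: "0 \<le> x" "x \<le> s" "excess p x = 0"
    using IVT'[of "excess p" 0 0 s] excess_0 p0_pos assms excess_continuous[OF assms(1,2)] by auto
  moreover have "x \<noteq> 0" using x(3) excess_0 p0_pos by auto
  moreover have "gfd_summable p x" using gfd_summable_mono assms x by blast
  ultimately have "critical_root p x" unfolding critical_root_iff by simp
  then show ?thesis ..
qed

text \<open>
  Without a critical root the excess stays negative up to the radius of convergence. Its positive
  part then remains below \<open>pmf p 0\<close>, which makes the radius finite
  and lets the series and its derivative converge there.
\<close>

lemma no_critical_root:
  assumes "\<nexists>s. critical_root p s"
  obtains r where "conv_radius (pmf p) = ereal r" "1 \<le> r" "gfd_summable p r" "excess p r \<le> 0"
proof -
  have r1: "1 \<le> conv_radius (pmf p)"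
    using conv_radius_geI[of "pmf p" 1] gf_summable_1 by (simp add: one_ereal_def)
  have neg: "excess p s < 0" if "0 < s" "ereal s < conv_radius (pmf p)" for s
  proof (rule ccontr)
    assume "\<not> excess p s < 0"
    then have "\<exists>x. critical_root p x"
      using gfd_summable_in_conv_radius[OF that(2,1)] that(1) by (intro ex_critical_root[of s]) auto
    then show False using assms by blast
  qed
  have part: "(\<Sum>k<n. (real k - 1) * pmf p k * s ^ k) \<le> 0"
    if "0 < s" "ereal s < conv_radius (pmf p)" for s n
  proof (cases n)
    case (Suc m)
    have "(\<Sum>k<n. (real k - 1) * pmf p k * s ^ k) \<le> excess p s"
      unfolding excess_def
    proof (rule sum_le_suminf[OF excess_summable(1)[OF gfd_summable_in_conv_radius[OF that(2,1)]]])
      fix k assume "k \<in> - {..<n}"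
      then have "1 \<le> k" using Suc by auto
      then show "0 \<le> (real k - 1) * pmf p k * s ^ k" using that by auto
    qed (use that in auto)
    then show ?thesis using neg[OF that] by simp
  qed simp
  obtain j where j: "2 \<le> j" "0 < pmf p j" by (rule ex_offspring_ge_2)
  have "conv_radius (pmf p) \<noteq> \<infinity>"
  proof
    assume inf: "conv_radius (pmf p) = \<infinity>"
    define s where "s = max 1 (2 * pmf p 0 / pmf p j)"
    have s: "1 \<le> s" "2 * pmf p 0 \<le> s * pmf p j"
      using j unfolding s_def by (auto simp: field_simps max_def)
    have "(\<Sum>k\<in>{0,j}. (real k - 1) * pmf p k * s ^ k) \<le> (\<Sum>k<Suc j. (real k - 1) * pmf p k * s ^ k)"
    proof (rule sum_mono2)
      show "0 \<le> (real b - 1) * pmf p b * s ^ b" if "b \<in> {..<Suc j} - {0, j}" for b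
        using that s by auto
    qed auto
    also have "\<dots> \<le> 0" using part[of s "Suc j"] s inf by simp
    finally have "(real j - 1) * pmf p j * s ^ j \<le> pmf p 0" using j by simp
    moreover have "1 * pmf p j * s ^ 1 \<le> (real j - 1) * pmf p j * s ^ j"
      using j s by (intro mult_mono power_increasing) auto
    ultimately show False using s p0_pos by (simp add: algebra_simps)
  qed
  then obtain r where r: "conv_radius (pmf p) = ereal r" "1 \<le> r"
    using r1 by (cases "conv_radius (pmf p)") auto
  have part_r: "(\<Sum>k<n. (real k - 1) * pmf p k * r ^ k) \<le> 0" for n
  proof (rule tendsto_upperbound)
    show "((\<lambda>s. \<Sum>k<n. (real k - 1) * pmf p k * s ^ k) \<longlongrightarrow> (\<Sum>k<n. (real k - 1) * pmf p k * r ^ k)) (at_left r)"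
      by (intro tendsto_intros)
    have "\<forall>\<^sub>F s in at_left r. s \<in> {0<..<r}" using r(2) by (intro eventually_at_left_real) auto
    then show "\<forall>\<^sub>F s in at_left r. (\<Sum>k<n. (real k - 1) * pmf p k * s ^ k) \<le> 0"
      by eventually_elim (use part r in auto)
  qed simp
  have "summable (\<lambda>k. real k * pmf p (Suc k) * r ^ Suc k)"
  proof (rule summableI_nonneg_bounded[where x = "pmf p 0"])
    fix n
    have "(\<Sum>k<Suc n. (real k - 1) * pmf p k * r ^ k)
        = - pmf p 0 + (\<Sum>k<n. real k * pmf p (Suc k) * r ^ Suc k)"
      by (subst sum.lessThan_Suc_shift) simp
    then show "(\<Sum>k<n. real k * pmf p (Suc k) * r ^ Suc k) \<le> pmf p 0" using part_r[of "Suc n"] by simp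
  qed (use r in auto)
  then have "summable (\<lambda>k. (real (Suc k) - 1) * pmf p (Suc k) * r ^ Suc k)" by simp
  then have ex: "summable (\<lambda>k. (real k - 1) * pmf p k * r ^ k)"
    by (rule summable_Suc_iff[THEN iffD1])
  have gfd: "gfd_summable p r"
  proof (rule summable_comparison_test'[where N = 2])
    show "summable (\<lambda>k. 2 * ((real k - 1) * pmf p k * r ^ k))" using ex by (rule summable_mult)
    fix n :: nat assume "2 \<le> n"
    then have "real n * (pmf p n * r ^ n) \<le> (2 * (real n - 1)) * (pmf p n * r ^ n)"
      using r by (intro mult_right_mono) auto
    also have "\<dots> = 2 * ((real n - 1) * (pmf p n * r ^ n))" by (rule mult.assoc)
    finally show "norm (real n * pmf p n * r ^ n) \<le> 2 * ((real n - 1) * pmf p n * r ^ n)"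
      using r by (simp add: abs_mult mult.assoc)
  qed
  have "excess p r \<le> 0" unfolding excess_def using ex part_r by (rule suminf_le_const)
  then show ?thesis by (rule that[OF r gfd])
qed

text \<open>
  The dichotomy behind all uses of \<open>s0\<close>: the ratio \<open>f(s)/s\<close> decreases up to \<open>s0\<close>, and beyond \<open>s0\<close> either
  it increases again or the series diverges.
\<close>

lemma s0_pos: "0 < s0 p"
  and s0_gfd_summable: "gfd_summable p (s0 p)"
  and s0_excess: "excess p (s0 p) \<le> 0"
  and s0_cases: "excess p (s0 p) = 0 \<or> (1 \<le> s0 p \<and> (\<forall>t>s0 p. \<not> gf_summable p t))"
proof -
  have "0 < s0 p \<and> gfd_summable p (s0 p) \<and> excess p (s0 p) \<le> 0 \<and>
      (excess p (s0 p) = 0 \<or> (1 \<le> s0 p \<and> (\<forall>t>s0 p. \<not> gf_summable p t)))"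
  proof (cases "\<exists>s. critical_root p s")
    case True
    then obtain x where "critical_root p x" ..
    then have "critical_root p (THE s. critical_root p s)"
      by (rule theI) (rule critical_root_unique[OF _ \<open>critical_root p x\<close>])
    then show ?thesis using True unfolding s0_def critical_root_iff by simp
  next
    case False
    obtain r where r: "conv_radius (pmf p) = ereal r" "1 \<le> r" "gfd_summable p r" "excess p r \<le> 0"
      by (rule no_critical_root[OF False])
    have "s0 p = r" unfolding s0_def if_not_P[OF False] r(1) by simp
    moreover have "\<not> gf_summable p t" if "r < t" for t
      using not_summable_outside_conv_radius[of "pmf p" t] r that by simp
    ultimately show ?thesis using r by auto
  qed
  then show "0 < s0 p" "gfd_summable p (s0 p)" "excess p (s0 p) \<le> 0"
    "excess p (s0 p) = 0 \<or> (1 \<le> s0 p \<and> (\<forall>t>s0 p. \<not> gf_summable p t))" by auto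
qed

lemma s0_gf_summable: "gf_summable p (s0 p)"
  by (rule gfd_summable_imp_gf[OF s0_gfd_summable less_imp_le[OF s0_pos]])

lemma gen_fun_pos:
  assumes "gf_summable p s" "0 \<le> s"
  shows "0 < gen_fun p s"
  unfolding gen_fun_def using assms p0_pos by (intro suminf_pos2[where i = 0]) auto

text \<open>
  At a boundary point of convergence the left limit defining \<open>R\<close> is still the value, because
  nonnegative coefficients make the series converge uniformly up to \<open>s0\<close>.
\<close>

lemma inverse_R_const: "1 / R_const p = gen_fun p (s0 p) / s0 p"
proof -
  have "continuous_on {0..s0 p} (\<lambda>s. s / gen_fun p s)"
  proof (intro continuous_intros gen_fun_continuous s0_gf_summable)
    show "\<forall>s\<in>{0..s0 p}. gen_fun p s \<noteq> 0"
    proof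
      fix s assume "s \<in> {0..s0 p}"
      then have "0 < gen_fun p s"
        by (intro gen_fun_pos gf_summable_mono[OF s0_gf_summable]) auto
      then show "gen_fun p s \<noteq> 0" by simp
    qed
  qed (use s0_pos in auto)
  then have "((\<lambda>s. s / gen_fun p s) \<longlongrightarrow> s0 p / gen_fun p (s0 p)) (at (s0 p) within {0..s0 p})"
    using s0_pos unfolding continuous_on_def by auto
  then have "((\<lambda>s. s / gen_fun p s) \<longlongrightarrow> s0 p / gen_fun p (s0 p)) (at_left (s0 p))"
    using s0_pos by (simp add: at_within_Icc_at_left)
  then have "R_const p = s0 p / gen_fun p (s0 p)"
    unfolding R_const_def by (intro tendsto_Lim) auto
  then show ?thesis by simp
qed

lemma R_const_pos: "0 < 1 / R_const p"
  unfolding inverse_R_const using s0_pos gen_fun_pos[OF s0_gf_summable] by simp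

lemma inverse_R_const_le:
  assumes t: "0 < t" "gf_summable p t"
  shows "1 / R_const p \<le> gen_fun p t / t"
proof -
  have "excess p (s0 p) * (t - s0 p) \<ge> 0"
    using s0_cases s0_excess t by (cases "t > s0 p") (auto intro: mult_nonpos_nonpos)
  then have "t * gen_fun p (s0 p) \<le> s0 p * gen_fun p t"
    using gen_fun_tangent_ray[OF s0_gfd_summable less_imp_le[OF s0_pos] t(2) less_imp_le[OF t(1)]] by simp
  then show ?thesis unfolding inverse_R_const using t s0_pos by (simp add: field_simps)
qed

lemma gen_fun_ratio_strict_antimono:
  assumes s: "0 < s" "s < t" "t < s0 p"
  shows "gen_fun p t / t < gen_fun p s / s"
proof -
  have "excess p t < 0" using excess_strict_mono[OF s0_gfd_summable, of t] s s0_excess by simp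
  then have "0 < excess p t * (s - t)" using s by (intro mult_neg_neg) auto
  moreover have "s * gen_fun p t + excess p t * (s - t) \<le> t * gen_fun p s"
    using gfd_summable_mono[OF s0_gfd_summable, of t] gf_summable_mono[OF s0_gf_summable, of s] s
    by (intro gen_fun_tangent_ray) auto
  ultimately have "s * gen_fun p t < t * gen_fun p s" by simp
  then show ?thesis using s by (simp add: field_simps)
qed

lemma gfd_summable_1: "integrable (measure_pmf p) real \<Longrightarrow> gfd_summable p 1"
  using pmf_nat_integrable_iff[of p real] by (simp add: mult.commute)

lemma excess_1:
  assumes "integrable (measure_pmf p) real"
  shows "excess p 1 = measure_pmf.expectation p real - 1"
proof -
  have "excess p 1 = (\<Sum>k. real k * pmf p k - pmf p k)" by (simp add: excess_def algebra_simps)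
  also have "\<dots> = (\<Sum>k. real k * pmf p k) - (\<Sum>k. pmf p k)"
    using gfd_summable_1[OF assms] gf_summable_1 by (intro suminf_diff[symmetric]) auto
  also have "\<dots> = measure_pmf.expectation p real - 1"
    using pmf_nat_expectation_eq[OF assms] gen_fun_1 by (simp add: gen_fun_def mult.commute)
  finally show ?thesis .
qed

lemma s0_ge_1:
  assumes "integrable (measure_pmf p) real" "measure_pmf.expectation p real \<le> 1"
  shows "1 \<le> s0 p"
proof (rule ccontr)
  assume "\<not> 1 \<le> s0 p"
  then have "excess p (s0 p) < excess p 1"
    using s0_pos by (intro excess_strict_mono gfd_summable_1 assms(1)) auto
  then show False using s0_cases \<open>\<not> 1 \<le> s0 p\<close> excess_1[OF assms(1)] assms(2) by auto
qed

lemma s0_less_1: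
  assumes "integrable (measure_pmf p) real" "1 < measure_pmf.expectation p real"
  shows "s0 p < 1"
proof (rule ccontr)
  assume "\<not> s0 p < 1"
  then have "excess p 1 \<le> excess p (s0 p)"
    using excess_strict_mono[OF s0_gfd_summable, of 1] by (cases "s0 p = 1") auto
  then show False using s0_excess excess_1[OF assms(1)] assms(2) by simp
qed

text \<open>
  Between the critical point and 1 the excess is positive, so the ratio \<open>f(u)/u\<close> is strictly below its
  value 1 at the point 1.
\<close>

lemma supercritical_contraction:
  assumes "integrable (measure_pmf p) real" "1 < measure_pmf.expectation p real"
  obtains u where "0 < u" "u < 1" "gen_fun p u < u"
proof -
  define u where "u = (s0 p + 1) / 2"
  have u: "s0 p < u" "u < 1" "0 < u" using s0_less_1[OF assms] s0_pos by (auto simp: u_def)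
  have su: "gfd_summable p u" using gfd_summable_mono[OF gfd_summable_1[OF assms(1)]] u by simp
  have "excess p (s0 p) = 0" using s0_cases u by auto
  then have "0 < excess p u" using excess_strict_mono[OF su, of "s0 p"] u s0_pos by simp
  then have "0 < excess p u * (1 - u)" using u by simp
  then have "gen_fun p u < u"
    using gen_fun_tangent_ray[OF su less_imp_le[OF u(3)] gf_summable_1] gen_fun_1 by simp
  then show ?thesis by (rule that[OF u(3,2)])
qed

lemma q_star_less_1:
  assumes "integrable (measure_pmf p) real" "1 < measure_pmf.expectation p real"
  shows "q_star p < 1"
proof -
  obtain u where u: "0 < u" "u < 1" "gen_fun p u < u"
    by (rule supercritical_contraction[OF assms])
  have sm: "gf_summable p q" if "0 \<le> q" "q \<le> 1" for q
    using gf_summable_mono[OF gf_summable_1] that by simp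
  have f0: "gen_fun p 0 > 0" using gen_fun_pos[of 0] sm[of 0] by simp
  define S where "S = {0..u} \<inter> (\<lambda>q. gen_fun p q - q) -` {0}"
  have c: "continuous_on {0..u} (\<lambda>q. gen_fun p q - q)"
    using gen_fun_continuous[OF sm, of u] u by (intro continuous_intros) auto
  have "closed S" unfolding S_def using c by (intro continuous_closed_preimage) auto
  moreover have "bounded S" unfolding S_def by (rule bounded_subset[OF bounded_closed_interval]) auto
  ultimately have "compact S" by (simp add: compact_eq_bounded_closed)
  moreover obtain x where "0 \<le> x" "x \<le> u" "gen_fun p x - x = 0"
    using IVT2'[of "\<lambda>q. gen_fun p q - q" u 0 0] c u f0 by force
  then have "S \<noteq> {}" unfolding S_def by auto
  ultimately obtain q where q: "q \<in> S" "\<And>y. y \<in> S \<Longrightarrow> q \<le> y"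
    using compact_attains_inf by metis
  have "0 < q" using q(1) f0 unfolding S_def by (cases "q = 0") auto
  have "q_star p = q" unfolding q_star_def
  proof (rule Least_equality)
    show "0 < q \<and> gf_summable p q \<and> gen_fun p q = q"
      using q(1) \<open>0 < q\<close> sm[of q] u unfolding S_def by auto
    show "q \<le> y" if "0 < y \<and> gf_summable p y \<and> gen_fun p y = y" for y
      using that q unfolding S_def by (cases "y \<le> u") auto
  qed
  then show ?thesis using q(1) u unfolding S_def by auto
qed

end

section \<open>Recursive trees as parent functions\<close>

text \<open>
  A tree on \<open>0, 1, 2, \<dots>\<close> in which every vertex is younger than its parent is coded by its parent
  function. Since the root is its own parent, \<open>(g ^^ z) v\<close> is the ancestor of \<open>v\<close> at distance
  \<open>min z (depth v)\<close>, so truncation at the root needs no case distinction.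
\<close>

definition parent_function :: "(nat \<Rightarrow> nat) \<Rightarrow> bool" where
  "parent_function g \<longleftrightarrow> g 0 = 0 \<and> (\<forall>i>0. g i < i)"

definition descends :: "(nat \<Rightarrow> nat) \<Rightarrow> nat \<Rightarrow> nat \<Rightarrow> bool" where
  "descends g k i \<longleftrightarrow> (\<exists>l. (g ^^ l) i = k)"

definition rdist :: "(nat \<Rightarrow> nat) \<Rightarrow> nat \<Rightarrow> nat \<Rightarrow> nat" where
  "rdist g k i = (LEAST l. (g ^^ l) i = k)"

definition weight :: "(nat \<Rightarrow> nat) \<Rightarrow> nat \<Rightarrow> (nat \<Rightarrow> real) \<Rightarrow> nat \<Rightarrow> real" where
  "weight g k G i = (if descends g k i then G (rdist g k i) else 0)"

lemma parent_function_0: "parent_function g \<Longrightarrow> g 0 = 0"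
  and parent_function_less: "parent_function g \<Longrightarrow> 0 < i \<Longrightarrow> g i < i"
  by (auto simp: parent_function_def)

lemma parent_function_le: "parent_function g \<Longrightarrow> g i \<le> i"
  using parent_function_0[of g] parent_function_less[of g i] by (cases "i = 0") auto

lemma funpow_parent_0: "parent_function g \<Longrightarrow> (g ^^ l) 0 = 0"
  by (induction l) (auto simp: parent_function_0)

lemma funpow_parent_le: "parent_function g \<Longrightarrow> (g ^^ l) i \<le> i"
  by (induction l) (auto intro: order_trans[OF parent_function_le])

lemma descends_self [simp]: "descends g k k"
  unfolding descends_def by (rule exI[of _ 0]) simp

lemma rdist_self [simp]: "rdist g k k = 0"
  unfolding rdist_def by (rule Least_equality) auto

lemma descends_le: "parent_function g \<Longrightarrow> descends g k i \<Longrightarrow> k \<le> i"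
  unfolding descends_def using funpow_parent_le by blast

lemma descends_parent_iff:
  assumes "i \<noteq> k"
  shows "descends g k i \<longleftrightarrow> descends g k (g i)"
proof
  assume "descends g k i"
  then obtain l where l: "(g ^^ l) i = k" unfolding descends_def by blast
  with assms obtain m where "l = Suc m" by (cases l) auto
  then show "descends g k (g i)" using l unfolding descends_def
    by (intro exI[of _ m]) (simp add: funpow_swap1)
next
  assume "descends g k (g i)"
  then obtain l where "(g ^^ l) (g i) = k" unfolding descends_def by blast
  then show "descends g k i" unfolding descends_def
    by (intro exI[of _ "Suc l"]) (simp add: funpow_swap1)
qed

lemma rdist_parent:
  assumes "i \<noteq> k" "descends g k i"
  shows "rdist g k i = Suc (rdist g k (g i))"
proof -
  obtain l where "(g ^^ l) i = k" using assms(2) unfolding descends_def by blast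
  then have "rdist g k i = Suc (LEAST m. (g ^^ Suc m) i = k)"
    unfolding rdist_def using assms(1) by (intro Least_Suc) auto
  then show ?thesis unfolding rdist_def by (simp add: funpow_swap1)
qed

lemma funpow_rdist: "descends g k i \<Longrightarrow> (g ^^ rdist g k i) i = k"
  unfolding descends_def rdist_def by (rule LeastI_ex)

lemma rdist_le:
  assumes "parent_function g"
  shows "descends g k i \<Longrightarrow> rdist g k i \<le> i - k"
proof (induction i rule: less_induct)
  case (less i)
  show ?case
  proof (cases "i = k")
    case False
    then have d: "descends g k (g i)" using less.prems descends_parent_iff by blast
    have "k < i" using descends_le[OF assms less.prems] False by simp
    then have "g i < i" using parent_function_less[OF assms] by simp
    with less.IH[OF this d] rdist_parent[OF False less.prems] descends_le[OF assms d]
    show ?thesis by simp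
  qed simp
qed

lemma weight_self [simp]: "weight g k G k = G 0"
  by (simp add: weight_def)

lemma weight_parent: "i \<noteq> k \<Longrightarrow> weight g k G i = weight g k (\<lambda>m. G (Suc m)) (g i)"
  unfolding weight_def using descends_parent_iff[of i k g] rdist_parent[of i k g] by simp

lemma weight_less: "parent_function g \<Longrightarrow> i < k \<Longrightarrow> weight g k G i = 0"
  unfolding weight_def using descends_le[of g k i] by auto

text \<open>
  A walk of \<open>z\<close> steps towards the root lowers the distance to \<open>k\<close> by \<open>z\<close>. A walk that passes \<open>k\<close> reaches
  an older vertex, which does not descend from \<open>k\<close>, unless \<open>k\<close> is the root and the walk stops there.
\<close>

lemma weight_ancestor:
  assumes "parent_function g"
  shows "weight g k G ((g ^^ z) v) = weight g k (\<lambda>m. if z \<le> m \<or> k = 0 then G (m - z) else 0) v"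
proof (induction z arbitrary: v)
  case (Suc z)
  have "weight g k G ((g ^^ Suc z) v)
      = weight g k (\<lambda>m. if z \<le> m \<or> k = 0 then G (m - z) else 0) (g v)"
    using Suc.IH[of "g v"] by (simp add: funpow_swap1)
  also have "\<dots> = weight g k (\<lambda>m. if Suc z \<le> m \<or> k = 0 then G (m - Suc z) else 0) v"
  proof (cases "v = k")
    case True
    show ?thesis
    proof (cases "k = 0")
      case True
      then show ?thesis using \<open>v = k\<close> parent_function_0[OF assms] by simp
    next
      case False
      then have "g v < k" using \<open>v = k\<close> parent_function_less[OF assms] by simp
      then show ?thesis using weight_less[OF assms] \<open>v = k\<close> False by simp
    qed
  qed (simp add: weight_parent cong: if_cong)
  finally show ?case .
qed simp

lemma weight_cong:
  assumes "parent_function g" "\<And>j. j \<le> i \<Longrightarrow> g j = h j"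
  shows "weight g k G i = weight h k G i"
proof -
  have "(g ^^ l) i = (h ^^ l) i" for l
  proof (induction l)
    case (Suc l)
    then show ?case using assms(2) funpow_parent_le[OF assms(1), of l i] by simp
  qed simp
  then show ?thesis unfolding weight_def descends_def rdist_def by simp
qed

lemma weight_nonneg: "(\<And>m. 0 \<le> G m) \<Longrightarrow> 0 \<le> weight g k G i"
  by (simp add: weight_def)

lemma weight_mono: "(\<And>m. G m \<le> H m) \<Longrightarrow> weight g k G i \<le> weight g k H i"
  by (simp add: weight_def)

lemma abs_weight_le:
  assumes "parent_function g"
  shows "\<bar>weight g k G i\<bar> \<le> (\<Sum>m\<le>i. \<bar>G m\<bar>)"
proof (cases "descends g k i")
  case True
  then have "rdist g k i \<le> i" using rdist_le[OF assms] by (meson diff_le_self le_trans)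
  then have "\<bar>G (rdist g k i)\<bar> \<le> (\<Sum>m\<le>i. \<bar>G m\<bar>)" by (intro member_le_sum) auto
  then show ?thesis using True by (simp add: weight_def)
qed (simp add: weight_def sum_nonneg)

section \<open>The attachment tree and PageRank in terms of the parent function\<close>

text \<open>
  The uniform variable is cut off at \<open>n\<close>, which makes every realisation a recursive tree; under the
  model this changes nothing outside a null set.
\<close>

fun parents :: "(nat \<Rightarrow> nat) \<Rightarrow> (nat \<Rightarrow> nat) \<Rightarrow> nat \<Rightarrow> nat \<Rightarrow> nat" where
  "parents z u 0 = (\<lambda>_. 0)"
| "parents z u (Suc n) =
     (parents z u n)(Suc n := (parents z u n ^^ z (Suc n)) (min n (u n)))"

lemma parent_function_parents: "parent_function (parents z u n)"
proof (induction n)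
  case (Suc n)
  have "(parents z u n ^^ z (Suc n)) (min n (u n)) \<le> min n (u n)"
    by (rule funpow_parent_le[OF Suc.IH])
  then show ?case using Suc.IH unfolding parent_function_def by (auto simp: less_Suc_eq_le)
qed (simp add: parent_function_def)

lemma parents_beyond: "n < i \<Longrightarrow> parents z u n i = 0"
  by (induction n) auto

lemma parents_stable:
  assumes "m \<le> n" "i \<le> m"
  shows "parents z u n i = parents z u m i"
  using assms by (induction n rule: dec_induct) auto

lemma parents_cong:
  assumes "\<And>i. 2 \<le> i \<Longrightarrow> i \<le> n \<Longrightarrow> z i = z' i" "\<And>i. 1 \<le> i \<Longrightarrow> i < n \<Longrightarrow> u i = u' i"
  shows "parents z u n = parents z' u' n"
  using assms
proof (induction n)
  case (Suc n)
  then have *: "parents z u n = parents z' u' n" by simp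
  show ?case
  proof (cases "n = 0")
    case True
    then show ?thesis by (simp add: funpow_parent_0[of "\<lambda>_. 0"] parent_function_def)
  next
    case False
    then show ?thesis using * Suc.prems(1)[of "Suc n"] Suc.prems(2)[of n] by simp
  qed
qed simp

definition tree_graph :: "(nat \<Rightarrow> nat) \<Rightarrow> nat \<Rightarrow> nat pair_pre_digraph" where
  "tree_graph g n = \<lparr> pverts = {..n}, parcs = (\<lambda>i. (i, g i)) ` {1..n} \<rparr>"

primrec ancestral_walk :: "(nat \<Rightarrow> nat) \<Rightarrow> nat \<Rightarrow> nat \<Rightarrow> (nat \<times> nat) list" where
  "ancestral_walk g i 0 = []"
| "ancestral_walk g i (Suc l) = (i, g i) # ancestral_walk g (g i) l"

lemma length_ancestral_walk [simp]: "length (ancestral_walk g i l) = l"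
  by (induction l arbitrary: i) auto

lemma ancestral_walk_verts:
  "pawalk_verts i (ancestral_walk g i l) = map (\<lambda>j. (g ^^ j) i) [0..<Suc l]"
proof (induction l arbitrary: i)
  case (Suc l)
  have "map (\<lambda>j. (g ^^ j) i) [0..<Suc (Suc l)] = i # map (\<lambda>j. (g ^^ Suc j) i) [0..<Suc l]"
    by (simp add: upt_conv_Cons map_Suc_upt[symmetric] del: upt_Suc)
  then show ?case using Suc.IH[of "g i"] by (simp add: funpow_swap1 del: upt_Suc)
qed simp

text \<open>
  Every vertex has at most one outgoing arc, so a directed walk is determined by its starting point
  and its length; it ends at the latest at the root.
\<close>

lemma awalk_tree_graph_iff:
  assumes g: "parent_function g"
  shows "pre_digraph.awalk (with_proj (tree_graph g n)) i w v \<longleftrightarrow>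
    i \<le> n \<and> w = ancestral_walk g i (length w) \<and> (\<forall>j<length w. (g ^^ j) i \<noteq> 0) \<and> (g ^^ length w) i = v"
  unfolding pre_digraph.awalk_def cas_with_proj_eq
proof (induction w arbitrary: i)
  case (Cons a w)
  have split: "(\<forall>j<Suc (length w). (g ^^ j) i \<noteq> 0)
      \<longleftrightarrow> i \<noteq> 0 \<and> (\<forall>j<length w. (g ^^ j) (g i) \<noteq> 0)"
    by (auto simp: less_Suc_eq_0_disj funpow_swap1)
  have "g i \<le> n" if "i \<le> n" using parent_function_le[OF g, of i] that by simp
  then show ?case using Cons.IH[of "g i"] unfolding split length_Cons
    by (cases a) (auto simp: tree_graph_def funpow_swap1)
qed (auto simp: tree_graph_def)

lemma apath_tree_graph_iff:
  assumes g: "parent_function g"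
  shows "pre_digraph.apath (with_proj (tree_graph g n)) i w v \<longleftrightarrow>
    i \<le> n \<and> w = ancestral_walk g i (length w) \<and> (\<forall>j<length w. (g ^^ j) i \<noteq> 0) \<and> (g ^^ length w) i = v"
proof -
  have "distinct (pawalk_verts i (ancestral_walk g i l))" if "\<forall>j<l. (g ^^ j) i \<noteq> 0" for l
    using that
  proof (induction l arbitrary: i)
    case (Suc l)
    then have i: "i \<noteq> 0" by auto
    have "\<forall>j<l. (g ^^ j) (g i) \<noteq> 0" using Suc.prems by (auto simp: funpow_swap1)
    then have "distinct (pawalk_verts (g i) (ancestral_walk g (g i) l))" by (rule Suc.IH)
    moreover have "x < i" if "x \<in> set (pawalk_verts (g i) (ancestral_walk g (g i) l))" for x
      using that funpow_parent_le[OF g] parent_function_less[OF g, of i] i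
      unfolding ancestral_walk_verts by (auto intro: le_less_trans)
    ultimately show ?case by auto
  qed simp
  then show ?thesis
    unfolding pre_digraph.apath_def awalk_tree_graph_iff[OF g] awalk_verts_with_proj_eq by metis
qed

lemma descends_0: "parent_function g \<Longrightarrow> descends g 0 i"
proof (induction i rule: less_induct)
  case (less i)
  then show ?case
    using descends_parent_iff[of i 0 g] parent_function_less[of g i] by (cases "i = 0") auto
qed

lemma rdist_eq_iff:
  assumes g: "parent_function g"
  shows "(g ^^ l) i = k \<and> (\<forall>j<l. (g ^^ j) i \<noteq> 0) \<longleftrightarrow> descends g k i \<and> rdist g k i = l"
proof (induction l arbitrary: i)
  case 0
  show ?case using funpow_rdist[of g k i] by auto
next
  case (Suc l)
  show ?case
  proof (cases "i = k")
    case True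
    have "(g ^^ Suc l) k \<noteq> k" if "k \<noteq> 0"
    proof -
      have "(g ^^ l) (g k) \<le> g k" by (rule funpow_parent_le[OF g])
      then show ?thesis using parent_function_less[OF g, of k] that by (simp add: funpow_swap1)
    qed
    then show ?thesis using True by (cases "k = 0") auto
  next
    case False
    show ?thesis
    proof (cases "i = 0")
      case True
      then show ?thesis using False descends_le[OF g, of k i] by auto
    next
      case i: False
      have "(\<forall>j<Suc l. (g ^^ j) i \<noteq> 0) \<longleftrightarrow> (\<forall>j<l. (g ^^ j) (g i) \<noteq> 0)"
        using i by (auto simp: less_Suc_eq_0_disj funpow_swap1)
      then show ?thesis using Suc.IH[of "g i"] descends_parent_iff[OF False, of g]
        rdist_parent[OF False, of g] by (auto simp: funpow_swap1)
    qed
  qed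
qed

lemma root_path_tree_graph:
  assumes g: "parent_function g" and v: "v \<le> n"
  shows "root_path (tree_graph g n) v = ancestral_walk g v (rdist g 0 v)"
  unfolding root_path_def
proof (rule the_equality)
  show "pre_digraph.apath (with_proj (tree_graph g n)) v (ancestral_walk g v (rdist g 0 v)) 0"
    unfolding apath_tree_graph_iff[OF g] length_ancestral_walk
    using v rdist_eq_iff[OF g, of "rdist g 0 v" v 0] descends_0[OF g] by simp
  fix w assume "pre_digraph.apath (with_proj (tree_graph g n)) v w 0"
  then show "w = ancestral_walk g v (rdist g 0 v)"
    unfolding apath_tree_graph_iff[OF g] using rdist_eq_iff[OF g, of "length w" v 0] by metis
qed

lemma attach_point_tree_graph:
  assumes g: "parent_function g" and v: "v \<le> n"
  shows "attach_point (tree_graph g n) v z = (g ^^ z) v"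
proof -
  let ?d = "rdist g 0 v"
  have "attach_point (tree_graph g n) v z = (g ^^ min z ?d) v"
    unfolding attach_point_def root_dist_def root_path_tree_graph[OF assms]
      awalk_verts_with_proj_eq ancestral_walk_verts length_ancestral_walk
    by (subst nth_map) (auto simp del: upt_Suc)
  also have "\<dots> = (g ^^ z) v"
  proof (cases "z \<le> ?d")
    case False
    have "(g ^^ z) v = (g ^^ (z - ?d + ?d)) v" using False by simp
    also have "\<dots> = 0" unfolding funpow_add o_def
      using funpow_rdist[OF descends_0[OF g]] funpow_parent_0[OF g] by simp
    finally show ?thesis using False funpow_rdist[OF descends_0[OF g], of v] by simp
  qed simp
  finally show ?thesis .
qed

lemma attach_tree_eq:
  assumes "\<And>i. 1 \<le> i \<Longrightarrow> u i \<le> i"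
  shows "attach_tree z u n = tree_graph (parents z u n) n"
  using assms
proof (induction z u n rule: attach_tree.induct)
  case (1 z u)
  show ?case by (simp add: tree_graph_def)
next
  case (2 z u)
  have "(((\<lambda>_. 0) :: nat \<Rightarrow> nat) ^^ l) 0 = 0" for l by (induction l) auto
  then show ?case by (auto simp: tree_graph_def)
next
  case (3 z u n)
  let ?g = "parents z u (Suc n)" and ?h = "parents z u (Suc (Suc n))"
  have u: "u (Suc n) \<le> Suc n" using "3.prems" by simp
  have h: "?h (Suc (Suc n)) = (?g ^^ z (Suc (Suc n))) (u (Suc n))"
    by (simp only: parents.simps(2)[of z u "Suc n"] fun_upd_same min_absorb2[OF u])
  have "attach_tree z u (Suc n) = tree_graph ?g (Suc n)" using "3.IH" "3.prems" by blast
  then have "attach_tree z u (Suc (Suc n)) = \<lparr> pverts = insert (Suc (Suc n)) {..Suc n},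
      parcs = insert (Suc (Suc n), ?h (Suc (Suc n))) ((\<lambda>i. (i, ?g i)) ` {1..Suc n}) \<rparr>"
    unfolding attach_tree.simps(3) Let_def h
    using attach_point_tree_graph[OF parent_function_parents u, of z u "Suc n" "z (Suc (Suc n))"]
    by (simp add: tree_graph_def del: parents.simps)
  also have "(\<lambda>i. (i, ?g i)) ` {1..Suc n} = (\<lambda>i. (i, ?h i)) ` {1..Suc n}"
    by (intro image_cong) auto
  also have "insert (Suc (Suc n), ?h (Suc (Suc n))) ((\<lambda>i. (i, ?h i)) ` {1..Suc n})
      = (\<lambda>i. (i, ?h i)) ` {1..Suc (Suc n)}"
    by (simp only: image_insert[symmetric] atLeastAtMostSuc_conv[of 1 "Suc n"]) simp
  finally show ?case unfolding tree_graph_def by (simp only: atMost_Suc)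
qed

text \<open>
  Paths ending at \<open>k\<close> are counted by their starting points, the descendants of \<open>k\<close> at the distance in
  question.
\<close>

lemma num_paths_to_tree_graph:
  assumes g: "parent_function g"
  shows "num_paths_to (tree_graph g n) (Suc l) k = card {i \<in> {..n}. descends g k i \<and> rdist g k i = Suc l}"
proof -
  let ?S = "{i \<in> {..n}. descends g k i \<and> rdist g k i = Suc l}"
  have "{w. length w = Suc l \<and> (\<exists>i. pre_digraph.apath (with_proj (tree_graph g n)) i w k)}
      = (\<lambda>i. ancestral_walk g i (Suc l)) ` ?S"
  proof (intro set_eqI iffI)
    fix w assume "w \<in> {w. length w = Suc l \<and> (\<exists>i. pre_digraph.apath (with_proj (tree_graph g n)) i w k)}"
    then obtain i where "i \<le> n" "w = ancestral_walk g i (Suc l)"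
      "(g ^^ Suc l) i = k \<and> (\<forall>j<Suc l. (g ^^ j) i \<noteq> 0)"
      unfolding apath_tree_graph_iff[OF g] by auto
    then show "w \<in> (\<lambda>i. ancestral_walk g i (Suc l)) ` ?S" unfolding rdist_eq_iff[OF g] by blast
  next
    fix w assume "w \<in> (\<lambda>i. ancestral_walk g i (Suc l)) ` ?S"
    then obtain i where i: "i \<le> n" "w = ancestral_walk g i (Suc l)" "descends g k i \<and> rdist g k i = Suc l"
      by auto
    then have "pre_digraph.apath (with_proj (tree_graph g n)) i w k"
      unfolding apath_tree_graph_iff[OF g] using rdist_eq_iff[OF g, of "Suc l" i k] by simp
    then show "w \<in> {w. length w = Suc l \<and> (\<exists>i. pre_digraph.apath (with_proj (tree_graph g n)) i w k)}"
      using i(2) by auto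
  qed
  moreover have "inj_on (\<lambda>i. ancestral_walk g i (Suc l)) ?S" by (rule inj_onI) simp
  ultimately show ?thesis unfolding num_paths_to_def by (simp add: card_image del: ancestral_walk.simps)
qed

lemma pagerank_tree_graph:
  assumes g: "parent_function g" and k: "k \<le> n"
  shows "pagerank c (tree_graph g n) k = (1 - c) * (\<Sum>i\<le>n. weight g k (\<lambda>m. c ^ m) i)"
proof -
  have le: "rdist g k i \<le> n" if "descends g k i" "i \<le> n" for i
    using rdist_le[OF g that(1)] that(2) by simp
  have r0: "rdist g k i = 0 \<longleftrightarrow> i = k" if "descends g k i" for i
    using funpow_rdist[OF that] by (cases "rdist g k i = 0") auto
  have "(\<Sum>l. c ^ Suc l * real (num_paths_to (tree_graph g n) (Suc l) k))
      = (\<Sum>l<n. c ^ Suc l * real (num_paths_to (tree_graph g n) (Suc l) k))"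
  proof (rule suminf_finite)
    fix l assume "l \<notin> {..<n}"
    then have "{i \<in> {..n}. descends g k i \<and> rdist g k i = Suc l} = {}" using le by force
    then show "c ^ Suc l * real (num_paths_to (tree_graph g n) (Suc l) k) = 0"
      unfolding num_paths_to_tree_graph[OF g] by (simp only: card.empty)
  qed simp
  also have "\<dots> = (\<Sum>l<n. \<Sum>i\<le>n. if descends g k i \<and> rdist g k i = Suc l then c ^ Suc l else 0)"
    unfolding num_paths_to_tree_graph[OF g]
    by (intro sum.cong refl) (simp add: sum.If_cases Int_def mult.commute del: power_Suc)
  also have "\<dots> = (\<Sum>i\<le>n. \<Sum>l<n. if descends g k i \<and> rdist g k i = Suc l then c ^ Suc l else 0)"
    by (rule sum.swap)
  also have "\<dots> = (\<Sum>i\<in>{..n} - {k}. weight g k (\<lambda>m. c ^ m) i)"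
  proof -
    have "(\<Sum>l<n. if descends g k i \<and> rdist g k i = Suc l then c ^ Suc l else 0)
        = (if i = k then 0 else weight g k (\<lambda>m. c ^ m) i)" if "i \<le> n" for i
    proof (cases "descends g k i \<and> i \<noteq> k")
      case True
      then obtain m where m: "rdist g k i = Suc m" using r0 by (cases "rdist g k i") auto
      then have "m < n" using le[of i] True that by simp
      then show ?thesis using True m by (simp add: weight_def sum.delta)
    next
      case False
      then show ?thesis by (auto simp: weight_def)
    qed
    then have "(\<Sum>i\<le>n. \<Sum>l<n. if descends g k i \<and> rdist g k i = Suc l then c ^ Suc l else 0)
        = (\<Sum>i\<le>n. if i = k then 0 else weight g k (\<lambda>m. c ^ m) i)" by (intro sum.cong) auto
    also have "\<dots> = (\<Sum>i\<in>{..n} - {k}. weight g k (\<lambda>m. c ^ m) i)"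
      using k by (subst sum.remove[of _ k]) (auto intro!: sum.cong)
    finally show ?thesis .
  qed
  finally show ?thesis unfolding pagerank_def
    using k sum.remove[of "{..n}" k "weight g k (\<lambda>m. c ^ m)"] by simp
qed

section \<open>One step of the chain\<close>

text \<open>
  A vertex chosen at distance \<open>m\<close> below \<open>k\<close> produces, on average over the number of steps walked up,
  a new vertex of weight \<open>drift p k G m\<close>. Walks that overshoot \<open>k\<close> are lost, except at the root,
  where they stop.
\<close>

definition drift :: "nat pmf \<Rightarrow> nat \<Rightarrow> (nat \<Rightarrow> real) \<Rightarrow> nat \<Rightarrow> real" where
  "drift p k G m = measure_pmf.expectation p (\<lambda>z. if z \<le> m \<or> k = 0 then G (Suc (m - z)) else 0)"

text \<open>
  Conditioning on the value of the variable with finite range reduces the expectation to products of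
  real random variables.
\<close>

lemma (in prob_space) indep_var_expectation_finite:
  fixes \<phi> :: "'b \<Rightarrow> 'b \<Rightarrow> real"
  assumes ind: "indep_var (count_space UNIV) X (count_space UNIV) Y"
    and S: "finite S" "\<And>\<omega>. \<omega> \<in> space M \<Longrightarrow> X \<omega> \<in> S"
    and B: "\<And>x y. x \<in> S \<Longrightarrow> \<bar>\<phi> x y\<bar> \<le> B x"
  shows "expectation (\<lambda>\<omega>. \<phi> (X \<omega>) (Y \<omega>)) = (\<Sum>x\<in>S. \<P>(\<omega> in M. X \<omega> = x) * expectation (\<lambda>\<omega>. \<phi> x (Y \<omega>)))"
proof -
  have [measurable]: "X \<in> M \<rightarrow>\<^sub>M count_space UNIV" "Y \<in> M \<rightarrow>\<^sub>M count_space UNIV"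
    using ind unfolding indep_var_eq by auto
  have iY: "integrable M (\<lambda>\<omega>. \<phi> x (Y \<omega>))" if "x \<in> S" for x
  proof (rule integrable_const_bound[where B = "B x"])
    show "(\<lambda>\<omega>. \<phi> x (Y \<omega>)) \<in> borel_measurable M"
      by (rule measurable_compose[of Y _ "count_space UNIV"]) auto
  qed (use B that in auto)
  have iX: "integrable M (\<lambda>\<omega>. indicator {x} (X \<omega>) :: real)" for x
  proof (rule integrable_const_bound[where B = 1])
    show "(\<lambda>\<omega>. indicator {x} (X \<omega>) :: real) \<in> borel_measurable M"
      by (rule measurable_compose[of X _ "count_space UNIV"]) auto
  qed (auto simp: indicator_def)
  have EX: "expectation (\<lambda>\<omega>. indicator {x} (X \<omega>) :: real) = \<P>(\<omega> in M. X \<omega> = x)" for x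
  proof -
    have "expectation (\<lambda>\<omega>. indicator {x} (X \<omega>) :: real)
        = expectation (indicator {\<omega>\<in>space M. X \<omega> = x})"
      by (intro Bochner_Integration.integral_cong) (auto simp: indicator_def)
    also have "\<dots> = \<P>(\<omega> in M. X \<omega> = x)" by simp
    finally show ?thesis .
  qed
  have ix: "indep_var borel (\<lambda>\<omega>. indicator {x} (X \<omega>) :: real) borel (\<lambda>\<omega>. \<phi> x (Y \<omega>))" for x
    using indep_var_compose[OF ind, of "indicator {x}" borel "\<phi> x" borel] by (simp add: o_def)
  have "expectation (\<lambda>\<omega>. \<phi> (X \<omega>) (Y \<omega>))
      = expectation (\<lambda>\<omega>. \<Sum>x\<in>S. indicator {x} (X \<omega>) * \<phi> x (Y \<omega>))"
  proof (rule Bochner_Integration.integral_cong[OF refl])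
    fix \<omega> assume "\<omega> \<in> space M"
    then show "\<phi> (X \<omega>) (Y \<omega>) = (\<Sum>x\<in>S. indicator {x} (X \<omega>) * \<phi> x (Y \<omega>))"
      using S sum.delta[OF S(1), of "X \<omega>" "\<lambda>x. \<phi> x (Y \<omega>)"]
      by (simp add: indicator_def if_distrib[of "\<lambda>a. a * _"] eq_commute cong: if_cong)
  qed
  also have "\<dots> = (\<Sum>x\<in>S. expectation (\<lambda>\<omega>. indicator {x} (X \<omega>) * \<phi> x (Y \<omega>)))"
    by (intro Bochner_Integration.integral_sum indep_var_integrable ix iX iY)
  also have "\<dots> = (\<Sum>x\<in>S. \<P>(\<omega> in M. X \<omega> = x) * expectation (\<lambda>\<omega>. \<phi> x (Y \<omega>)))"
    by (intro sum.cong refl) (simp add: indep_var_lebesgue_integral[OF ix iX iY] EX)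
  finally show ?thesis .
qed

context attachment_model
begin

definition state :: "nat \<Rightarrow> 'a \<Rightarrow> nat \<Rightarrow> nat" where
  "state n \<omega> = parents (\<lambda>i. Z i \<omega>) (\<lambda>i. V i \<omega>) n"

definition wpop :: "(nat \<Rightarrow> real) \<Rightarrow> nat \<Rightarrow> nat \<Rightarrow> 'a \<Rightarrow> real" where
  "wpop G k n \<omega> = (\<Sum>i\<le>n. weight (state n \<omega>) k G i)"

text \<open>
  Measurability with respect to the tree at time \<open>n\<close>, without mentioning a sub-algebra. Since there are
  finitely many trees on \<open>{0..n}\<close>, every adapted real function is bounded and integrable.
\<close>

definition adapted :: "nat \<Rightarrow> ('a \<Rightarrow> 'b) \<Rightarrow> bool" where
  "adapted n A \<longleftrightarrow> (\<forall>\<omega> \<omega>'. state n \<omega> = state n \<omega>' \<longrightarrow> A \<omega> = A \<omega>')"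

lemma parent_function_state: "parent_function (state n \<omega>)"
  unfolding state_def by (rule parent_function_parents)

lemma adapted_const [simp]: "adapted n (\<lambda>_. a)"
  by (simp add: adapted_def)

lemma adapted_map: "adapted n A \<Longrightarrow> adapted n (\<lambda>\<omega>. f (A \<omega>))"
  unfolding adapted_def by metis

lemma adapted_map2: "adapted n A \<Longrightarrow> adapted n B \<Longrightarrow> adapted n (\<lambda>\<omega>. f (A \<omega>) (B \<omega>))"
  unfolding adapted_def by metis

lemma state_restrict:
  assumes "m \<le> n"
  shows "state m \<omega> = (\<lambda>i. if i \<le> m then state n \<omega> i else 0)"
  unfolding state_def using parents_stable[OF assms] parents_beyond by fastforce

lemma adapted_mono: "adapted m A \<Longrightarrow> m \<le> n \<Longrightarrow> adapted n A"
  unfolding adapted_def using state_restrict by metis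

lemma adapted_wpop: "m \<le> n \<Longrightarrow> adapted n (wpop G k m)"
  by (rule adapted_mono[of m]) (auto simp: adapted_def wpop_def)

lemma wpop_Suc:
  assumes "k \<le> n"
  shows "wpop G k (Suc n) \<omega> = wpop G k n \<omega> + weight (state n \<omega>) k
     (\<lambda>m. if Z (Suc n) \<omega> \<le> m \<or> k = 0 then G (Suc (m - Z (Suc n) \<omega>)) else 0) (min n (V n \<omega>))"
proof -
  let ?g = "state n \<omega>" and ?h = "state (Suc n) \<omega>"
  have eq: "?g j = ?h j" if "j \<le> n" for j using that unfolding state_def by simp
  have hn: "?h (Suc n) = (?g ^^ Z (Suc n) \<omega>) (min n (V n \<omega>))" unfolding state_def by simp
  have le: "?h (Suc n) \<le> n"
    unfolding hn by (rule order_trans[OF funpow_parent_le[OF parent_function_state]]) simp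
  have "weight ?h k G (Suc n) = weight ?h k (\<lambda>m. G (Suc m)) (?h (Suc n))"
    using assms by (intro weight_parent) auto
  also have "\<dots> = weight ?g k (\<lambda>m. G (Suc m)) (?h (Suc n))"
    using le eq by (intro weight_cong[symmetric] parent_function_state) auto
  also have "\<dots> = weight ?g k
     (\<lambda>m. if Z (Suc n) \<omega> \<le> m \<or> k = 0 then G (Suc (m - Z (Suc n) \<omega>)) else 0) (min n (V n \<omega>))"
    unfolding hn by (rule weight_ancestor[OF parent_function_state])
  finally have new: "weight ?h k G (Suc n) = \<dots>" .
  have "(\<Sum>i\<le>n. weight ?h k G i) = (\<Sum>i\<le>n. weight ?g k G i)"
    using eq by (intro sum.cong weight_cong[symmetric] parent_function_state) auto
  then show ?thesis unfolding wpop_def using new by simp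
qed

definition state_space :: "nat \<Rightarrow> (nat \<Rightarrow> nat) set" where
  "state_space n = {g. \<forall>i. (i \<in> {..n} \<longrightarrow> g i \<in> {..n}) \<and> (i \<notin> {..n} \<longrightarrow> g i = 0)}"

lemma finite_state_space: "finite (state_space n)"
  unfolding state_space_def by (intro finite_set_of_finite_funs) auto

lemma state_in_space: "state n \<omega> \<in> state_space n"
  unfolding state_space_def using parent_function_le[OF parent_function_state, of n \<omega>]
    parents_beyond[of n] by (auto simp: state_def intro: order_trans)

text \<open>
  On finitely many integer coordinates the product algebra is discrete, so arbitrary functions of
  disjoint finite sets of driving variables are independent random elements.
\<close>

lemma indep_discrete:
  assumes "finite A" "finite B" "A \<inter> B = {}"
    and "A \<subseteq> Inl ` {1..} \<union> Inr ` {1..}" "B \<subseteq> Inl ` {1..} \<union> Inr ` {1..}"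
  shows "indep_var (count_space UNIV) (\<lambda>\<omega>. F (restrict (\<lambda>i. case_sum Z V i \<omega>) A))
    (count_space UNIV) (\<lambda>\<omega>. H (restrict (\<lambda>i. case_sum Z V i \<omega>) B))"
proof -
  have m: "K \<in> PiM C (\<lambda>_. count_space UNIV) \<rightarrow>\<^sub>M count_space UNIV" if "finite C"
    for C :: "(nat + nat) set" and K :: "(nat + nat \<Rightarrow> nat) \<Rightarrow> 'd"
    using count_space_PiM_finite[OF that, of "\<lambda>_. UNIV :: nat set"] by simp
  show ?thesis
    using indep_var_compose[OF indep_var_restrict[OF indep assms(3-5)] m[OF assms(1)] m[OF assms(2)]]
    by (simp add: o_def)
qed

lemma measurable_Z: "1 \<le> n \<Longrightarrow> Z n \<in> M \<rightarrow>\<^sub>M count_space UNIV"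
  and measurable_V: "1 \<le> n \<Longrightarrow> V n \<in> M \<rightarrow>\<^sub>M count_space UNIV"
  using indep unfolding indep_vars_def2 by force+

text \<open>
  The two variables used by the step from \<open>n\<close> to \<open>n + 1\<close>, at the indices 0 and 1 of a function, so
  that they form a random element of the same type as the tree.
\<close>

definition draw :: "nat \<Rightarrow> 'a \<Rightarrow> nat \<Rightarrow> nat" where
  "draw n \<omega> = case_nat (V n \<omega>) (\<lambda>_. Z (Suc n) \<omega>)"

lemma draw_simps [simp]: "draw n \<omega> 0 = V n \<omega>" "draw n \<omega> (Suc 0) = Z (Suc n) \<omega>"
  by (simp_all add: draw_def)

lemma indep_state_draw:
  assumes "1 \<le> n"
  shows "indep_var (count_space UNIV) (state n) (count_space UNIV) (draw n)"
proof -
  let ?A = "Inl ` {2..n} \<union> Inr ` {1..<n} :: (nat + nat) set" and ?B = "{Inr n, Inl (Suc n)} :: (nat + nat) set"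
  let ?F = "\<lambda>f. parents (\<lambda>i. f (Inl i)) (\<lambda>i. f (Inr i)) n"
  let ?H = "\<lambda>f :: nat + nat \<Rightarrow> nat. case_nat (f (Inr n)) (\<lambda>_. f (Inl (Suc n)))"
  have "indep_var (count_space UNIV) (\<lambda>\<omega>. ?F (restrict (\<lambda>i. case_sum Z V i \<omega>) ?A))
    (count_space UNIV) (\<lambda>\<omega>. ?H (restrict (\<lambda>i. case_sum Z V i \<omega>) ?B))"
    using assms by (intro indep_discrete) auto
  moreover have "?F (restrict (\<lambda>i. case_sum Z V i \<omega>) ?A) = state n \<omega>" for \<omega>
    unfolding state_def by (intro parents_cong) auto
  moreover have "?H (restrict (\<lambda>i. case_sum Z V i \<omega>) ?B) = draw n \<omega>" for \<omega>
    unfolding draw_def by simp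
  ultimately show ?thesis by simp
qed

lemma indep_V_Z:
  assumes "1 \<le> n"
  shows "indep_var (count_space UNIV) (\<lambda>\<omega>. min n (V n \<omega>)) (count_space UNIV) (Z (Suc n))"
proof -
  have "indep_var (count_space UNIV) (\<lambda>\<omega>. (\<lambda>f. min n (f (Inr n))) (restrict (\<lambda>i. case_sum Z V i \<omega>) {Inr n}))
    (count_space UNIV) (\<lambda>\<omega>. (\<lambda>f. f (Inl (Suc n))) (restrict (\<lambda>i. case_sum Z V i \<omega>) {Inl (Suc n)}))"
    using assms by (intro indep_discrete) auto
  then show ?thesis by simp
qed

lemma measurable_state: "state n \<in> M \<rightarrow>\<^sub>M count_space UNIV"
proof (cases "1 \<le> n")
  case True
  then show ?thesis using indep_state_draw[OF True] unfolding indep_var_eq by auto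
next
  case False
  then have "n = 0" by simp
  then have "state n = (\<lambda>_ _. 0)" by (intro ext) (simp add: state_def)
  then show ?thesis by simp
qed

lemma adapted_factor:
  assumes "adapted n A"
  obtains a where "\<And>\<omega>. A \<omega> = a (state n \<omega>)"
proof
  fix \<omega>
  have "state n (SOME \<omega>'. state n \<omega>' = state n \<omega>) = state n \<omega>"
    by (rule someI[of "\<lambda>\<omega>'. state n \<omega>' = state n \<omega>" \<omega>]) simp
  then show "A \<omega> = (\<lambda>g. A (SOME \<omega>'. state n \<omega>' = g)) (state n \<omega>)"
    using assms unfolding adapted_def by metis
qed

lemma measurable_adapted:
  assumes "adapted n A"
  shows "A \<in> M \<rightarrow>\<^sub>M count_space UNIV"
proof -
  obtain a where "\<And>\<omega>. A \<omega> = a (state n \<omega>)" using adapted_factor[OF assms] by blast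
  then have "A = (\<lambda>\<omega>. a (state n \<omega>))" by (intro ext)
  then show ?thesis using measurable_compose[OF measurable_state, of a "count_space UNIV" n] by simp
qed

lemma borel_measurable_adapted:
  "adapted n (A :: 'a \<Rightarrow> 'b :: topological_space) \<Longrightarrow> A \<in> borel_measurable M"
  using measurable_compose[OF measurable_adapted, of n A "\<lambda>x. x" borel] by simp

lemma integrable_adapted:
  assumes "adapted n (A :: 'a \<Rightarrow> real)"
  shows "integrable M A"
proof -
  obtain a where a: "\<And>\<omega>. A \<omega> = a (state n \<omega>)" using adapted_factor[OF assms] by blast
  show ?thesis
  proof (rule integrable_const_bound[where B = "\<Sum>g\<in>state_space n. \<bar>a g\<bar>"])
    have "norm (A \<omega>) \<le> (\<Sum>g\<in>state_space n. \<bar>a g\<bar>)" for \<omega>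
      using finite_state_space state_in_space unfolding a real_norm_def by (intro member_le_sum) auto
    then show "AE \<omega> in M. norm (A \<omega>) \<le> (\<Sum>g\<in>state_space n. \<bar>a g\<bar>)" by simp
  qed (rule borel_measurable_adapted[OF assms])
qed

lemma prob_truncated_V:
  assumes "1 \<le> n" "v \<le> n"
  shows "\<P>(\<omega> in M. min n (V n \<omega>) = v) = 1 / real (Suc n)"
proof -
  have "\<P>(\<omega> in M. min n (V n \<omega>) = v) = measure M (V n -` {x. min n x = v} \<inter> space M)"
    by (rule arg_cong[where f = "measure M"]) auto
  also have "\<dots> = measure (distr M (count_space UNIV) (V n)) {x. min n x = v}"
    using measurable_V[OF assms(1)] by (subst measure_distr) auto
  also have "\<dots> = measure_pmf.prob (pmf_of_set {0..n}) {x. min n x = v}"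
    unfolding law_V[OF assms(1)] ..
  also have "\<dots> = card ({0..n} \<inter> {x. min n x = v}) / card {0..n}"
    by (rule measure_pmf_of_set) auto
  also have "{0..n} \<inter> {x. min n x = v} = {v}" using assms(2) by auto
  finally show ?thesis by simp
qed

lemma expectation_Z:
  fixes h :: "nat \<Rightarrow> real"
  assumes "1 \<le> n"
  shows "expectation (\<lambda>\<omega>. h (Z n \<omega>)) = measure_pmf.expectation p h"
  using integral_distr[OF measurable_Z[OF assms], of h] law_Z[OF assms] by simp

lemma AE_V_le: "AE \<omega> in M. \<forall>n\<ge>1. V n \<omega> \<le> n"
proof -
  have "AE \<omega> in M. 1 \<le> n \<longrightarrow> V n \<omega> \<le> n" for n
  proof (cases "1 \<le> n")
    case True
    have "AE x in distr M (count_space UNIV) (V n). x \<le> n"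
      unfolding law_V[OF True] by (auto simp: AE_measure_pmf_iff)
    then show ?thesis using AE_distrD[OF measurable_V[OF True]] by auto
  qed simp
  then have "AE \<omega> in M. \<forall>n. 1 \<le> n \<longrightarrow> V n \<omega> \<le> n" unfolding AE_all_countable by blast
  then show ?thesis by simp
qed

text \<open>
  The identity behind every estimate below: conditionally on the tree at time \<open>n\<close>, the expected
  increment of a weighted population is the population weighted by the drift, over the number of
  vertices.
\<close>

lemma expected_increment:
  assumes A: "adapted n A" and n: "1 \<le> n" "k \<le> n"
  shows "expectation (\<lambda>\<omega>. A \<omega> * (wpop G k (Suc n) \<omega> - wpop G k n \<omega>))
    = expectation (\<lambda>\<omega>. A \<omega> * wpop (drift p k G) k n \<omega>) / real (Suc n)"
proof -
  obtain a where a: "\<And>\<omega>. A \<omega> = a (state n \<omega>)" using adapted_factor[OF A] by blast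
  define new where "new z = (\<lambda>m. if z \<le> m \<or> k = 0 then G (Suc (m - z)) else 0)" for z
  let ?S = "state_space n \<inter> {g. parent_function g}"
  have S: "finite ?S" "\<And>\<omega>. state n \<omega> \<in> ?S"
    using finite_state_space state_in_space parent_function_state by auto
  have newbd: "\<bar>weight g k (new z) v\<bar> \<le> (\<Sum>m\<le>v. \<Sum>l\<le>Suc m. \<bar>G l\<bar>)" if "parent_function g" for g z v
  proof -
    have "\<bar>weight g k (new z) v\<bar> \<le> (\<Sum>m\<le>v. \<bar>new z m\<bar>)" by (rule abs_weight_le[OF that])
    also have "\<dots> \<le> (\<Sum>m\<le>v. \<Sum>l\<le>Suc m. \<bar>G l\<bar>)"
    proof (rule sum_mono)
      fix m
      have "\<bar>G (Suc (m - z))\<bar> \<le> (\<Sum>l\<le>Suc m. \<bar>G l\<bar>)" by (intro member_le_sum) auto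
      then show "\<bar>new z m\<bar> \<le> (\<Sum>l\<le>Suc m. \<bar>G l\<bar>)" unfolding new_def by (auto intro: sum_nonneg)
    qed
    finally show ?thesis .
  qed
  have inner: "expectation (\<lambda>\<omega>. weight g k (new (Z (Suc n) \<omega>)) v) = weight g k (drift p k G) v" for g v
    using expectation_Z[of "Suc n" "\<lambda>z. new z (rdist g k v)"]
    by (simp add: weight_def drift_def new_def)
  have middle: "expectation (\<lambda>\<omega>. weight g k (new (Z (Suc n) \<omega>)) (min n (V n \<omega>)))
      = (\<Sum>v\<le>n. weight g k (drift p k G) v) / real (Suc n)" if "parent_function g" for g
  proof -
    have "expectation (\<lambda>\<omega>. weight g k (new (Z (Suc n) \<omega>)) (min n (V n \<omega>)))
        = (\<Sum>v\<in>{..n}. \<P>(\<omega> in M. min n (V n \<omega>) = v) * expectation (\<lambda>\<omega>. weight g k (new (Z (Suc n) \<omega>)) v))"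
      by (rule indep_var_expectation_finite[OF indep_V_Z[OF n(1)],
            where \<phi> = "\<lambda>v z. weight g k (new z) v"]) (auto intro: newbd that)
    also have "\<dots> = (\<Sum>v\<in>{..n}. 1 / real (Suc n) * weight g k (drift p k G) v)"
      unfolding inner using prob_truncated_V[OF n(1)] by (intro sum.cong) auto
    finally show ?thesis by (simp add: sum_divide_distrib)
  qed
  define \<phi> where "\<phi> g d = a g * weight g k (new (d (Suc 0))) (min n (d 0))" for g d :: "nat \<Rightarrow> nat"
  have "expectation (\<lambda>\<omega>. A \<omega> * (wpop G k (Suc n) \<omega> - wpop G k n \<omega>))
      = expectation (\<lambda>\<omega>. \<phi> (state n \<omega>) (draw n \<omega>))"
    using wpop_Suc[OF n(2)] by (simp add: a new_def \<phi>_def)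
  also have "\<dots> = (\<Sum>g\<in>?S. \<P>(\<omega> in M. state n \<omega> = g) * expectation (\<lambda>\<omega>. \<phi> g (draw n \<omega>)))"
  proof (rule indep_var_expectation_finite[OF indep_state_draw[OF n(1)] S(1),
        where B = "\<lambda>g. \<bar>a g\<bar> * (\<Sum>m\<le>n. \<Sum>l\<le>Suc m. \<bar>G l\<bar>)"])
    fix g d :: "nat \<Rightarrow> nat" assume "g \<in> ?S"
    then have g: "parent_function g" by simp
    have "(\<Sum>m\<le>min n (d 0). \<Sum>l\<le>Suc m. \<bar>G l\<bar>) \<le> (\<Sum>m\<le>n. \<Sum>l\<le>Suc m. \<bar>G l\<bar>)"
      by (intro sum_mono2) (auto intro: sum_nonneg)
    then have "\<bar>weight g k (new (d (Suc 0))) (min n (d 0))\<bar> \<le> (\<Sum>m\<le>n. \<Sum>l\<le>Suc m. \<bar>G l\<bar>)"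
      using newbd[OF g, of "d (Suc 0)" "min n (d 0)"] by linarith
    then show "\<bar>\<phi> g d\<bar> \<le> \<bar>a g\<bar> * (\<Sum>m\<le>n. \<Sum>l\<le>Suc m. \<bar>G l\<bar>)"
      unfolding \<phi>_def abs_mult by (intro mult_left_mono) auto
  qed (rule S)
  also have "\<dots> = (\<Sum>g\<in>?S. \<P>(\<omega> in M. state n \<omega> = g) *
      expectation (\<lambda>\<omega>. a g * ((\<Sum>v\<le>n. weight g k (drift p k G) v) / real (Suc n))))"
    by (intro sum.cong refl) (simp add: \<phi>_def middle prob_space)
  also have "\<dots> = expectation (\<lambda>\<omega>. a (state n \<omega>) *
      ((\<Sum>v\<le>n. weight (state n \<omega>) k (drift p k G) v) / real (Suc n)))"
    by (rule indep_var_expectation_finite[OF indep_state_draw[OF n(1)] S, symmetric,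
          where \<phi> = "\<lambda>g _. a g * ((\<Sum>v\<le>n. weight g k (drift p k G) v) / real (Suc n))"]) auto
  also have "\<dots> = expectation (\<lambda>\<omega>. A \<omega> * wpop (drift p k G) k n \<omega>) / real (Suc n)"
    by (simp add: wpop_def a)
  finally show ?thesis .
qed

lemma AE_random_tree: "AE \<omega> in M. \<forall>n. random_tree Z V n \<omega> = tree_graph (state n \<omega>) n"
  using AE_V_le
proof eventually_elim
  case (elim \<omega>)
  then show ?case unfolding random_tree_def state_def by (intro allI attach_tree_eq) auto
qed

lemma AE_pagerank:
  "AE \<omega> in M. \<forall>n\<ge>k. pagerank c (random_tree Z V n \<omega>) k = (1 - c) * wpop (\<lambda>m. c ^ m) k n \<omega>"
  using AE_random_tree
proof eventually_elim
  case (elim \<omega>)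
  then show ?case
    unfolding wpop_def using pagerank_tree_graph[OF parent_function_state] by simp
qed

end

section \<open>From expectations along powers of two to almost sure growth\<close>

text \<open>
  This inequality and the next turn the factors \<open>1 + a / (n + 1)\<close> and \<open>1 - a / (n + 1)\<close> of the recursions
  for expectations into ratios of consecutive powers, with exact constants.
\<close>

lemma one_plus_le_powr_ratio:
  assumes "0 \<le> a" "1 \<le> n"
  shows "(1 + a / real (Suc n)) * real n powr a \<le> real (Suc n) powr a"
proof -
  have n: "0 < real n" using assms by simp
  have "ln (real n / real (Suc n)) \<le> real n / real (Suc n) - 1" using n by (intro ln_le_minus_one) auto
  also have "\<dots> = - (1 / real (Suc n))" by (simp add: field_simps)
  finally have "1 / real (Suc n) \<le> ln (real (Suc n) / real n)" using n by (simp add: ln_div)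
  then have "1 + a * (1 / real (Suc n)) \<le> 1 + a * ln (real (Suc n) / real n)"
    using assms by (intro add_left_mono mult_left_mono)
  also have "\<dots> \<le> exp (a * ln (real (Suc n) / real n))" by (rule exp_ge_add_one_self)
  also have "\<dots> = real (Suc n) powr a / real n powr a"
    using n by (simp add: powr_def ln_div exp_diff[symmetric] algebra_simps)
  finally show ?thesis using n by (simp add: field_simps)
qed

lemma one_minus_le_powr_ratio:
  assumes "0 \<le> a"
  shows "(1 - a / real (Suc n)) * real (Suc (Suc n)) powr a \<le> real (Suc n) powr a"
proof -
  have "ln (real (Suc (Suc n)) / real (Suc n)) \<le> real (Suc (Suc n)) / real (Suc n) - 1"
    by (intro ln_le_minus_one) auto
  also have "\<dots> = 1 / real (Suc n)" by (simp add: field_simps)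
  finally have "- (1 / real (Suc n)) \<le> ln (real (Suc n) / real (Suc (Suc n)))" by (simp add: ln_div)
  then have "1 + a * (- (1 / real (Suc n))) \<le> 1 + a * ln (real (Suc n) / real (Suc (Suc n)))"
    using assms by (intro add_left_mono mult_left_mono)
  also have "\<dots> \<le> exp (a * ln (real (Suc n) / real (Suc (Suc n))))" by (rule exp_ge_add_one_self)
  also have "\<dots> = real (Suc n) powr a / real (Suc (Suc n)) powr a"
    by (simp add: powr_def ln_div exp_diff[symmetric] algebra_simps)
  finally show ?thesis by (simp add: field_simps)
qed

lemma (in finite_measure) AE_summable_of_summable_expectation:
  fixes f :: "nat \<Rightarrow> 'a \<Rightarrow> real"
  assumes f: "\<And>i. integrable M (f i)" "\<And>i \<omega>. 0 \<le> f i \<omega>"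
    and sm: "summable (\<lambda>i. integral\<^sup>L M (f i))"
  shows "AE \<omega> in M. summable (\<lambda>i. f i \<omega>)"
proof -
  have [measurable]: "f i \<in> borel_measurable M" for i using f(1) by auto
  have "(\<integral>\<^sup>+\<omega>. (\<Sum>i. ennreal (f i \<omega>)) \<partial>M) = (\<Sum>i. \<integral>\<^sup>+\<omega>. ennreal (f i \<omega>) \<partial>M)"
    by (rule nn_integral_suminf) simp
  also have "\<dots> = (\<Sum>i. ennreal (integral\<^sup>L M (f i)))"
    using f by (simp add: nn_integral_eq_integral)
  also have "\<dots> = ennreal (\<Sum>i. integral\<^sup>L M (f i))"
    using sm f by (intro suminf_ennreal2) (auto intro: Bochner_Integration.integral_nonneg)
  finally have "(\<integral>\<^sup>+\<omega>. (\<Sum>i. ennreal (f i \<omega>)) \<partial>M) \<noteq> \<infinity>" by simp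
  then have "AE \<omega> in M. (\<Sum>i. ennreal (f i \<omega>)) \<noteq> \<infinity>"
    by (intro nn_integral_PInf_AE) auto
  then show ?thesis
    by eventually_elim (use f in \<open>auto intro!: summable_suminf_not_top\<close>)
qed

lemma filterlim_floor_log: "filterlim floor_log at_top sequentially"
  unfolding filterlim_at_top
proof
  fix K
  show "\<forall>\<^sub>F n in sequentially. K \<le> floor_log n"
    using eventually_ge_at_top[of "2 ^ K"]
  proof eventually_elim
    case (elim n)
    then show ?case using monoD[OF floor_log_mono elim] by simp
  qed
qed

lemma dyadic_upper_growth:
  fixes y :: "nat \<Rightarrow> real"
  assumes mono: "incseq y" and nonneg: "\<And>n. 0 \<le> y n" and a: "0 \<le> a" "0 < e"
    and lim: "(\<lambda>i. y (2 ^ i) / (real (2 ^ i) powr a * real i powr e)) \<longlonglongrightarrow> 0"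
  shows "(\<lambda>n. y n / (real n powr a * ln (real n) powr e)) \<longlonglongrightarrow> 0"
proof -
  define t where "t i = y (2 ^ i) / (real (2 ^ i) powr a * real i powr e)" for i
  have "filterlim (\<lambda>n. Suc (floor_log n)) at_top sequentially"
    by (rule filterlim_compose[OF filterlim_Suc filterlim_floor_log])
  then have "(\<lambda>n. t (Suc (floor_log n))) \<longlonglongrightarrow> 0"
    by (rule filterlim_compose[OF lim[folded t_def]])
  then have t0: "(\<lambda>n. t (Suc (floor_log n)) * (2 powr a * 4 powr e)) \<longlonglongrightarrow> 0"
    by (rule tendsto_mult_left_zero)
  show ?thesis
  proof (rule tendsto_sandwich[OF _ _ tendsto_const t0])
    show "\<forall>\<^sub>F n in sequentially. 0 \<le> y n / (real n powr a * ln (real n) powr e)"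
      using nonneg by simp
    show "\<forall>\<^sub>F n in sequentially. y n / (real n powr a * ln (real n) powr e)
        \<le> t (Suc (floor_log n)) * (2 powr a * 4 powr e)"
      using eventually_ge_at_top[of 2]
    proof eventually_elim
      case (elim n)
      define i where "i = floor_log n"
      have i1: "1 \<le> i" using monoD[OF floor_log_mono elim] floor_log_power[of 1] unfolding i_def by simp
      have lo: "2 ^ i \<le> n" and hi: "n \<le> 2 ^ Suc i"
        using floor_log_exp2_le[of n] floor_log_exp2_gt[of n] elim unfolding i_def by auto
      have lnn: "real (Suc i) / 4 \<le> ln (real n)"
      proof -
        have "ln (1 / 2 :: real) \<le> 1 / 2 - 1" by (rule ln_le_minus_one) simp
        then have "1 / 2 \<le> ln (2 :: real)" by (simp add: ln_div)
        then have "real i * (1 / 2) \<le> real i * ln 2" by (rule mult_left_mono) simp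
        moreover have "real (Suc i) / 4 \<le> real i * (1 / 2)" using i1 by simp
        ultimately have "real (Suc i) / 4 \<le> real i * ln 2" by linarith
        also have "\<dots> = ln (real (2 ^ i))" by (simp add: ln_realpow)
        also have "\<dots> \<le> ln (real n)" using lo elim by (subst ln_le_cancel_iff) (auto simp flip: of_nat_le_iff)
        finally show ?thesis .
      qed
      \<comment> \<open>monotonicity up to the next power of two costs the factor \<open>2 powr a * 4 powr e\<close>\<close>
      have "y n \<le> y (2 ^ Suc i)" using mono hi by (rule incseqD)
      also have "\<dots> = t (Suc i) * (real (2 ^ Suc i) powr a * real (Suc i) powr e)" by (simp add: t_def)
      also have "\<dots> \<le> t (Suc i) * ((2 powr a * real n powr a) * (4 powr e * ln (real n) powr e))"
      proof (intro mult_left_mono mult_mono)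
        have "real (2 ^ Suc i) \<le> 2 * real n" using lo by (simp flip: of_nat_le_iff)
        then have "real (2 ^ Suc i) powr a \<le> (2 * real n) powr a" using a by (intro powr_mono2) auto
        then show "real (2 ^ Suc i) powr a \<le> 2 powr a * real n powr a" by (simp add: powr_mult)
        have "real (Suc i) powr e \<le> (4 * ln (real n)) powr e" using a lnn by (intro powr_mono2) auto
        then show "real (Suc i) powr e \<le> 4 powr e * ln (real n) powr e"
          using lnn by (simp add: powr_mult)
        show "0 \<le> t (Suc i)" unfolding t_def using nonneg by simp
      qed auto
      finally have "y n \<le> t (Suc i) * (2 powr a * 4 powr e) * (real n powr a * ln (real n) powr e)"
        by (simp add: mult_ac)
      moreover have "0 < real n powr a * ln (real n) powr e" using elim by simp
      ultimately show ?case unfolding i_def by (simp add: pos_divide_le_eq)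
    qed
  qed
qed

text \<open>
  Along \<open>n = 2 ^ i\<close> the logarithm is of order \<open>i\<close>, and the extra factor \<open>i powr (- 1 - \<delta>)\<close> makes the
  expectations summable; monotonicity bridges the gaps at the price of a constant.
\<close>

lemma (in prob_space) AE_upper_growth:
  fixes Y :: "nat \<Rightarrow> 'a \<Rightarrow> real"
  assumes Y: "\<And>n. integrable M (Y n)" "\<And>n \<omega>. 0 \<le> Y n \<omega>" "\<And>\<omega>. incseq (\<lambda>n. Y n \<omega>)"
    and a: "0 \<le> a" "0 < \<delta>" and C: "\<And>n. n0 \<le> n \<Longrightarrow> expectation (Y n) \<le> C * real n powr a"
  shows "AE \<omega> in M. (\<lambda>n. Y n \<omega> / (real n powr a * ln (real n) powr (1 + \<delta>))) \<longlonglongrightarrow> 0"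
proof -
  define f where "f i \<omega> = Y (2 ^ i) \<omega> / (real (2 ^ i) powr a * real i powr (1 + \<delta>))" for i \<omega>
  have "AE \<omega> in M. summable (\<lambda>i. f i \<omega>)"
  proof (rule AE_summable_of_summable_expectation)
    show "summable (\<lambda>i. expectation (f i))"
    proof (rule summable_comparison_test'[where N = n0])
      show "summable (\<lambda>i. C * real i powr (- (1 + \<delta>)))"
        using a by (intro summable_mult) (simp add: summable_real_powr_iff)
      fix i assume i: "n0 \<le> i"
      have "n0 \<le> 2 ^ i" using i less_exp[of i] by (meson less_imp_le order_trans)
      have "expectation (f i) = expectation (Y (2 ^ i)) / (real (2 ^ i) powr a * real i powr (1 + \<delta>))"
        unfolding f_def by simp
      also have "\<dots> \<le> (C * real (2 ^ i) powr a) / (real (2 ^ i) powr a * real i powr (1 + \<delta>))"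
        using C[OF \<open>n0 \<le> 2 ^ i\<close>] by (intro divide_right_mono) auto
      also have "\<dots> = C * real i powr (- (1 + \<delta>))" by (subst powr_minus_divide) simp
      finally show "norm (expectation (f i)) \<le> C * real i powr (- (1 + \<delta>))"
        using Y(2) by (simp add: f_def Bochner_Integration.integral_nonneg)
    qed
  qed (use Y in \<open>auto simp: f_def\<close>)
  then show ?thesis
  proof eventually_elim
    case (elim \<omega>)
    then show ?case
      using a Y by (intro dyadic_upper_growth) (auto dest: summable_LIMSEQ_zero simp: f_def)
  qed
qed

lemma (in prob_space) AE_decreasing_decay:
  fixes U :: "nat \<Rightarrow> 'a \<Rightarrow> real"
  assumes U: "\<And>n. integrable M (U n)" "\<And>n \<omega>. 0 \<le> U n \<omega>"
      "\<And>m n \<omega>. n0 \<le> m \<Longrightarrow> m \<le> n \<Longrightarrow> U n \<omega> \<le> U m \<omega>"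
    and a: "0 \<le> b" "b < a" and C: "\<And>n. n0 \<le> n \<Longrightarrow> expectation (U n) \<le> C * real n powr (- a)"
  shows "AE \<omega> in M. (\<lambda>n. real n powr b * U n \<omega>) \<longlonglongrightarrow> 0"
proof -
  define f where "f i \<omega> = real (2 ^ i) powr b * U (2 ^ i) \<omega>" for i \<omega>
  have "AE \<omega> in M. summable (\<lambda>i. f i \<omega>)"
  proof (rule AE_summable_of_summable_expectation)
    show "summable (\<lambda>i. expectation (f i))"
    proof (rule summable_comparison_test'[where N = n0])
      have "(2 :: real) powr (b - a) < 1" using a by (simp add: powr_less_one)
      then show "summable (\<lambda>i. C * (2 powr (b - a)) ^ i)"
        by (intro summable_mult summable_geometric) auto
      fix i assume i: "n0 \<le> i"
      have "n0 \<le> 2 ^ i" using i less_exp[of i] by (meson less_imp_le order_trans)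
      have "expectation (f i) = real (2 ^ i) powr b * expectation (U (2 ^ i))"
        unfolding f_def by simp
      also have "\<dots> \<le> real (2 ^ i) powr b * (C * real (2 ^ i) powr (- a))"
        using C[OF \<open>n0 \<le> 2 ^ i\<close>] by (intro mult_left_mono) auto
      also have "\<dots> = C * (2 powr (b - a)) ^ i"
        by (simp add: powr_realpow[symmetric] powr_powr powr_add[symmetric] algebra_simps)
      finally show "norm (expectation (f i)) \<le> C * (2 powr (b - a)) ^ i"
        using U(2) by (simp add: f_def Bochner_Integration.integral_nonneg)
    qed
  qed (use U in \<open>auto simp: f_def\<close>)
  then show ?thesis
  proof eventually_elim
    case (elim \<omega>)
    then have "(\<lambda>i. f i \<omega>) \<longlonglongrightarrow> 0" by (rule summable_LIMSEQ_zero)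
    then have t0: "(\<lambda>n. f (floor_log n) \<omega> * 2 powr b) \<longlonglongrightarrow> 0"
      using tendsto_mult_left_zero[OF filterlim_compose[OF _ filterlim_floor_log]] by blast
    show ?case
    proof (rule tendsto_sandwich[OF _ _ tendsto_const t0])
      show "\<forall>\<^sub>F n in sequentially. 0 \<le> real n powr b * U n \<omega>" using U(2) by simp
      show "\<forall>\<^sub>F n in sequentially. real n powr b * U n \<omega> \<le> f (floor_log n) \<omega> * 2 powr b"
        using eventually_ge_at_top[of "2 ^ n0"]
      proof eventually_elim
        case (elim n)
        have n: "0 < n" using elim by (meson less_le_trans zero_less_numeral zero_less_power)
        have lo: "2 ^ floor_log n \<le> n" and hi: "n \<le> 2 * 2 ^ floor_log n"
          using floor_log_exp2_le[OF n] floor_log_exp2_gt[of n] by auto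
        have "n0 \<le> floor_log n" using monoD[OF floor_log_mono elim] by simp
        then have "n0 \<le> 2 ^ floor_log n" using less_exp[of "floor_log n"] by (meson less_imp_le order_trans)
        then have "U n \<omega> \<le> U (2 ^ floor_log n) \<omega>" using U(3) lo by blast
        moreover have "real n powr b \<le> (2 * real (2 ^ floor_log n)) powr b"
          using of_nat_mono[OF hi, where 'a = real] a by (intro powr_mono2) auto
        ultimately have "real n powr b * U n \<omega> \<le> (2 * real (2 ^ floor_log n)) powr b * U (2 ^ floor_log n) \<omega>"
          using U(2) by (intro mult_mono) auto
        then show ?case by (simp add: f_def powr_mult mult_ac)
      qed
    qed
  qed
qed

section \<open>Weighted populations\<close>

lemma drift_series:
  shows drift_summable: "summable (\<lambda>z. pmf p z * (if z \<le> m \<or> k = 0 then G (Suc (m - z)) else 0))"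
    and drift_eq_suminf: "drift p k G m = (\<Sum>z. pmf p z * (if z \<le> m \<or> k = 0 then G (Suc (m - z)) else 0))"
proof -
  let ?h = "\<lambda>z. if z \<le> m \<or> k = 0 then G (Suc (m - z)) else 0"
  have "integrable (measure_pmf p) ?h"
  proof (rule measure_pmf.integrable_const_bound[where B = "\<Sum>l\<le>Suc m. \<bar>G l\<bar>"])
    have "\<bar>G (Suc (m - z))\<bar> \<le> (\<Sum>l\<le>Suc m. \<bar>G l\<bar>)" for z by (intro member_le_sum) auto
    then show "AE z in measure_pmf p. norm (?h z) \<le> (\<Sum>l\<le>Suc m. \<bar>G l\<bar>)"
      by (auto intro!: AE_pmfI sum_nonneg)
  qed simp
  then show "summable (\<lambda>z. pmf p z * ?h z)" "drift p k G m = (\<Sum>z. pmf p z * ?h z)"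
    unfolding drift_def using pmf_nat_integrable_iff[of p ?h] pmf_nat_expectation_eq[of p ?h]
    by (auto intro: summable_rabs_cancel)
qed

lemma drift_le_suminf:
  assumes "summable (\<lambda>z. pmf p z * h z)"
    and "\<And>z. (if z \<le> m \<or> k = 0 then G (Suc (m - z)) else 0) \<le> h z"
  shows "drift p k G m \<le> (\<Sum>z. pmf p z * h z)"
  unfolding drift_eq_suminf
  by (intro suminf_le drift_summable assms(1) mult_left_mono assms(2)) simp

lemma suminf_le_drift:
  assumes "summable (\<lambda>z. pmf p z * h z)"
    and "\<And>z. h z \<le> (if z \<le> m \<or> k = 0 then G (Suc (m - z)) else 0)"
  shows "(\<Sum>z. pmf p z * h z) \<le> drift p k G m"
  unfolding drift_eq_suminf
  by (intro suminf_le drift_summable assms(1) mult_left_mono assms(2)) simp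

lemma drift_nonneg: "(\<And>m. 0 \<le> G m) \<Longrightarrow> 0 \<le> drift p k G m"
  unfolding drift_def by (intro Bochner_Integration.integral_nonneg) auto

text \<open>
  Geometric weights are eigenvectors of the walk without a boundary, with eigenvalue \<open>f(s)/s\<close>; the
  boundary only removes positive terms, or at the root, when \<open>s \<ge> 1\<close>, replaces them by smaller ones.
\<close>

lemma geometric_weight_shift:
  fixes s :: real
  assumes "0 < s" "z \<le> m"
  shows "(1 / s) ^ Suc (m - z) = s ^ z * (1 / s) ^ Suc m"
proof -
  have "(1 / s) ^ Suc m = (1 / s) ^ Suc (m - z) * (1 / s) ^ z"
    using assms(2) by (simp flip: power_add)
  then show ?thesis using assms(1) by (simp add: power_one_over)
qed

lemma drift_geometric_le:
  assumes s: "0 < s" "gf_summable p s" and ks: "1 \<le> k \<or> 1 \<le> s"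
  shows "drift p k (\<lambda>m. (1 / s) ^ m) m \<le> gen_fun p s / s * (1 / s) ^ m"
proof -
  have "drift p k (\<lambda>m. (1 / s) ^ m) m \<le> (\<Sum>z. pmf p z * (s ^ z * (1 / s) ^ Suc m))"
  proof (rule drift_le_suminf)
    show "summable (\<lambda>z. pmf p z * (s ^ z * (1 / s) ^ Suc m))"
      using summable_mult2[OF s(2), of "(1 / s) ^ Suc m"] by (simp add: mult.assoc)
    fix z
    show "(if z \<le> m \<or> k = 0 then (1 / s) ^ Suc (m - z) else 0) \<le> s ^ z * (1 / s) ^ Suc m"
    proof (cases "z \<le> m")
      case True
      then show ?thesis using geometric_weight_shift[OF s(1) True] by (simp del: power_Suc)
    next
      case False
      show ?thesis
      proof (cases "k = 0")
        case True
        then have s1: "1 \<le> s" using ks by simp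
        have "1 / s * s ^ Suc m \<le> s ^ Suc m" using s1 by (simp add: mult_left_le_one_le)
        also have "\<dots> \<le> s ^ z" using False s1 by (intro power_increasing) auto
        finally have "1 / s \<le> s ^ z / s ^ Suc m" using s(1) by (simp add: pos_le_divide_eq)
        then show ?thesis using True False by (simp add: power_one_over)
      qed (use False s in auto)
    qed
  qed
  also have "\<dots> = gen_fun p s * (1 / s) ^ Suc m"
    unfolding gen_fun_def using suminf_mult2[OF s(2), of "(1 / s) ^ Suc m"] by (simp add: mult.assoc)
  finally show ?thesis by simp
qed

context attachment_model
begin

lemma wpop_mono_weight: "(\<And>m. G m \<le> H m) \<Longrightarrow> wpop G k n \<omega> \<le> wpop H k n \<omega>"
  unfolding wpop_def by (intro sum_mono weight_mono)

lemma wpop_nonneg: "(\<And>m. 0 \<le> G m) \<Longrightarrow> 0 \<le> wpop G k n \<omega>"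
  unfolding wpop_def by (intro sum_nonneg weight_nonneg)

lemma wpop_scale: "wpop (\<lambda>m. a * G m) k n \<omega> = a * wpop G k n \<omega>"
  unfolding wpop_def sum_distrib_left by (intro sum.cong) (auto simp: weight_def)

lemma wpop_add: "wpop (\<lambda>m. G m + H m) k n \<omega> = wpop G k n \<omega> + wpop H k n \<omega>"
  unfolding wpop_def sum.distrib[symmetric] by (intro sum.cong) (auto simp: weight_def)

lemma wpop_diff: "wpop (\<lambda>m. G m - H m) k n \<omega> = wpop G k n \<omega> - wpop H k n \<omega>"
  unfolding wpop_def sum_subtractf[symmetric] by (intro sum.cong) (auto simp: weight_def)

lemma wpop_Suc_weight:
  "wpop G k (Suc n) \<omega> = wpop G k n \<omega> + weight (state (Suc n) \<omega>) k G (Suc n)"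
proof -
  have "(\<Sum>i\<le>n. weight (state (Suc n) \<omega>) k G i) = (\<Sum>i\<le>n. weight (state n \<omega>) k G i)"
    using state_restrict[of n "Suc n" \<omega>] by (intro sum.cong weight_cong parent_function_state) auto
  then show ?thesis unfolding wpop_def by simp
qed

lemma wpop_incseq: "(\<And>m. 0 \<le> G m) \<Longrightarrow> incseq (\<lambda>n. wpop G k n \<omega>)"
  by (intro incseq_SucI) (simp add: wpop_Suc_weight weight_nonneg)

lemma wpop_mono_time: "(\<And>m. 0 \<le> G m) \<Longrightarrow> m \<le> n \<Longrightarrow> wpop G k m \<omega> \<le> wpop G k n \<omega>"
  using incseqD[OF wpop_incseq] by blast

lemma wpop_ge_self:
  assumes "\<And>m. 0 \<le> G m" "k \<le> n"
  shows "G 0 \<le> wpop G k n \<omega>"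
proof -
  have "weight (state n \<omega>) k G k \<le> wpop G k n \<omega>"
    unfolding wpop_def using assms by (intro member_le_sum weight_nonneg) auto
  then show ?thesis by simp
qed

lemma integrable_wpop: "integrable M (wpop G k n)"
  by (rule integrable_adapted[OF adapted_wpop[OF order_refl]])

lemma expected_step:
  assumes A: "adapted n A" and n: "1 \<le> n" "k \<le> n"
  shows "expectation (\<lambda>\<omega>. A \<omega> * wpop G k (Suc n) \<omega>)
    = expectation (\<lambda>\<omega>. A \<omega> * wpop G k n \<omega>) + expectation (\<lambda>\<omega>. A \<omega> * wpop (drift p k G) k n \<omega>) / real (Suc n)"
proof -
  have i: "integrable M (\<lambda>\<omega>. A \<omega> * wpop G k m \<omega>)" if "m \<le> Suc n" for m
    using that by (intro integrable_adapted[of "Suc n"] adapted_map2[where f = "(*)"] adapted_wpop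
        adapted_mono[OF A]) auto
  have "expectation (\<lambda>\<omega>. A \<omega> * (wpop G k (Suc n) \<omega> - wpop G k n \<omega>))
      = expectation (\<lambda>\<omega>. A \<omega> * wpop G k (Suc n) \<omega>) - expectation (\<lambda>\<omega>. A \<omega> * wpop G k n \<omega>)"
    using i[of "Suc n"] i[of n] by (simp add: right_diff_distrib)
  then show ?thesis using expected_increment[OF A n, of G] by simp
qed

lemma expected_step_le:
  assumes A: "adapted n A" "\<And>\<omega>. 0 \<le> A \<omega>" and n: "1 \<le> n" "k \<le> n"
    and G: "\<And>m. drift p k G m \<le> H m"
  shows "expectation (\<lambda>\<omega>. A \<omega> * wpop G k (Suc n) \<omega>)
    \<le> expectation (\<lambda>\<omega>. A \<omega> * wpop G k n \<omega>) + expectation (\<lambda>\<omega>. A \<omega> * wpop H k n \<omega>) / real (Suc n)"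
  unfolding expected_step[OF A(1) n]
  by (intro add_left_mono divide_right_mono integral_mono integrable_adapted[of n]
      adapted_map2[where f = "(*)"] A adapted_wpop mult_left_mono wpop_mono_weight G) auto

lemma expected_step_ge:
  assumes A: "adapted n A" "\<And>\<omega>. 0 \<le> A \<omega>" and n: "1 \<le> n" "k \<le> n"
    and G: "\<And>m. H m \<le> drift p k G m"
  shows "expectation (\<lambda>\<omega>. A \<omega> * wpop G k n \<omega>) + expectation (\<lambda>\<omega>. A \<omega> * wpop H k n \<omega>) / real (Suc n)
    \<le> expectation (\<lambda>\<omega>. A \<omega> * wpop G k (Suc n) \<omega>)"
  unfolding expected_step[OF A(1) n]
  by (intro add_left_mono divide_right_mono integral_mono integrable_adapted[of n]
      adapted_map2[where f = "(*)"] A adapted_wpop mult_left_mono wpop_mono_weight G) auto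

section \<open>Upper bounds\<close>

lemma wpop_expectation_growth:
  assumes G: "\<And>m. 0 \<le> G m" and d: "\<And>m. drift p k G m \<le> a * G m" and a: "0 \<le> a"
  obtains C where "\<And>n. max 1 k \<le> n \<Longrightarrow> expectation (wpop G k n) \<le> C * real n powr a"
proof (rule that)
  let ?N = "max 1 k"
  fix n assume "?N \<le> n"
  then show "expectation (wpop G k n) \<le> expectation (wpop G k ?N) / real ?N powr a * real n powr a"
  proof (induction n rule: dec_induct)
    case base
    then show ?case by simp
  next
    case (step n)
    then have n: "1 \<le> n" "k \<le> n" by auto
    have "expectation (wpop G k (Suc n)) \<le> (1 + a / real (Suc n)) * expectation (wpop G k n)"
      using expected_step_le[of n "\<lambda>_. 1" k G "\<lambda>m. a * G m"] n d by (simp add: wpop_scale algebra_simps)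
    also have "\<dots> \<le> (1 + a / real (Suc n)) * (expectation (wpop G k ?N) / real ?N powr a * real n powr a)"
      using a by (intro mult_left_mono step.IH) auto
    also have "\<dots> = expectation (wpop G k ?N) / real ?N powr a * ((1 + a / real (Suc n)) * real n powr a)"
      by simp
    also have "\<dots> \<le> expectation (wpop G k ?N) / real ?N powr a * real (Suc n) powr a"
      using a n G by (intro mult_left_mono one_plus_le_powr_ratio divide_nonneg_nonneg
          Bochner_Integration.integral_nonneg wpop_nonneg) auto
    finally show ?case .
  qed
qed

lemma wpop_upper_growth:
  assumes G: "\<And>m. 0 \<le> G m" and d: "\<And>m. drift p k G m \<le> a * G m" and a: "0 \<le> a" "0 < \<delta>"
  shows "AE \<omega> in M. (\<lambda>n. wpop G k n \<omega> / (real n powr a * ln (real n) powr (1 + \<delta>))) \<longlonglongrightarrow> 0"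
proof -
  obtain C where C: "\<And>n. max 1 k \<le> n \<Longrightarrow> expectation (wpop G k n) \<le> C * real n powr a"
    using wpop_expectation_growth[OF G d a(1)] by blast
  show ?thesis
    by (rule AE_upper_growth[where ?n0.0 = "max 1 k", OF integrable_wpop wpop_nonneg wpop_incseq a C])
      (auto intro: G)
qed

section \<open>Lower bounds\<close>

text \<open>
  For bounded weights with drift at least \<open>lam\<close> times the weight, \<open>1 / wpop\<close> decays: a jump of size
  \<open>d \<le> B\<close> lowers \<open>1 / y\<close> by at least \<open>d / (y (y + B))\<close>. While \<open>y \<ge> K\<close> this costs only the factor
  \<open>K / (K + B)\<close> in the rate.
\<close>

lemma wpop_inverse_decay:
  assumes G: "\<And>m. 0 \<le> G m" "\<And>m. G m \<le> B" "0 < G 0" and lam: "0 < lam"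
    and d: "\<And>m. lam * G m \<le> drift p k G m"
    and K: "0 < K" and N: "max 1 k \<le> N" and b: "0 \<le> b" "b < lam * K / (K + B)"
  shows "AE \<omega> in M. (\<lambda>n. real n powr b * (of_bool (K \<le> wpop G k N \<omega>) / wpop G k n \<omega>)) \<longlonglongrightarrow> 0"
proof -
  define A :: "'a \<Rightarrow> real" where "A \<omega> = of_bool (K \<le> wpop G k N \<omega>)" for \<omega>
  define U where "U n \<omega> = A \<omega> / wpop G k n \<omega>" for n \<omega>
  define r where "r = lam * K / (K + B)"
  have B: "0 < B" using G(2)[of 0] G(3) by simp
  have r: "0 \<le> r" unfolding r_def using lam K B by simp
  have A01: "0 \<le> A \<omega>" for \<omega> unfolding A_def by simp
  have pos: "0 < wpop G k n \<omega>" if "N \<le> n" for n \<omega>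
    using wpop_ge_self[of G k n \<omega>] G N that by simp
  have adA: "adapted n A" if "N \<le> n" for n
    unfolding A_def using adapted_map[OF adapted_wpop[OF that], of "\<lambda>x. of_bool (K \<le> x)"] .
  have iU: "integrable M (U n)" for n
    unfolding U_def by (rule integrable_adapted[of "max n N"])
      (intro adapted_map2[where f = "(/)"] adA adapted_wpop, auto)
  have U0: "0 \<le> U n \<omega>" for n \<omega> unfolding U_def using wpop_nonneg[OF G(1)] A01 by simp
  have decay: "expectation (U n) * real (Suc n) powr r \<le> expectation (U N) * real (Suc N) powr r"
    if "N \<le> n" for n
    using that
  proof (induction n rule: dec_induct)
    case (step n)
    define Y where "Y = wpop G k n"
    define A' where "A' \<omega> = A \<omega> * (1 / (Y \<omega> * (Y \<omega> + B)))" for \<omega>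
    have n: "1 \<le> n" "k \<le> n" using step N by auto
    have Y: "0 < Y \<omega>" for \<omega> unfolding Y_def using pos step by simp
    have adA': "adapted n A'" unfolding A'_def Y_def
      using adapted_map2[OF adA adapted_wpop[OF order_refl], of n "\<lambda>x y. x * (1 / (y * (y + B)))"] step
      by simp
    have A'0: "0 \<le> A' \<omega>" for \<omega> unfolding A'_def using Y[of \<omega>] B A01[of \<omega>] by simp
    have i1: "integrable M (\<lambda>\<omega>. A' \<omega> * wpop H k m \<omega>)" if "m \<le> Suc n" for H m
      using that by (intro integrable_adapted[of "Suc n"] adapted_map2[where f = "(*)"]
          adapted_mono[OF adA'] adapted_wpop) auto
    have point: "U (Suc n) \<omega> \<le> U n \<omega> - (A' \<omega> * wpop G k (Suc n) \<omega> - A' \<omega> * wpop G k n \<omega>)" for \<omega>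
    proof -
      define y where "y = Y \<omega>"
      define w where "w = weight (state (Suc n) \<omega>) k G (Suc n)"
      define q where "q = 1 / (y * (y + B))"
      have y: "0 < y" unfolding y_def by (rule Y)
      have w: "0 \<le> w" "w \<le> B" unfolding w_def using G B by (auto simp: weight_def)
      \<comment> \<open>\<open>w\<close> is the jump, and \<open>w * q\<close> the guaranteed decrease of \<open>1 / y\<close>\<close>
      have "w * q \<le> w * (1 / (y * (y + w)))"
        unfolding q_def using y w B by (intro mult_left_mono divide_left_mono mult_pos_pos) auto
      also have "\<dots> = 1 / y - 1 / (y + w)"
      proof -
        have "1 / y - 1 / (y + w) = ((y + w) - y) / (y * (y + w))"
          using y w by (subst diff_frac_eq) auto
        then show ?thesis by simp
      qed
      finally have "1 / (y + w) \<le> 1 / y - w * q" by simp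
      then have "A \<omega> * (1 / (y + w)) \<le> A \<omega> * (1 / y - w * q)" by (rule mult_left_mono[OF _ A01])
      moreover have yw: "wpop G k (Suc n) \<omega> = y + w" "wpop G k n \<omega> = y"
        unfolding y_def w_def Y_def by (simp_all add: wpop_Suc_weight)
      moreover have "A' \<omega> = A \<omega> * q" unfolding A'_def q_def y_def ..
      ultimately show ?thesis unfolding U_def yw by (simp add: algebra_simps)
    qed
    have gain: "r * expectation (U n) \<le> expectation (\<lambda>\<omega>. A' \<omega> * wpop (\<lambda>m. lam * G m) k n \<omega>)"
    proof -
      have "r * U n \<omega> \<le> A' \<omega> * wpop (\<lambda>m. lam * G m) k n \<omega>" for \<omega>
      proof (cases "K \<le> wpop G k N \<omega>")
        case True
        have "wpop G k N \<omega> \<le> Y \<omega>" unfolding Y_def using step by (intro wpop_mono_time G(1)) auto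
        then have "K \<le> Y \<omega>" using True by simp
        then have "K / (K + B) \<le> Y \<omega> / (Y \<omega> + B)" using K B by (simp add: field_simps)
        then have "lam * (K / (K + B)) * (1 / Y \<omega>) \<le> lam * (Y \<omega> / (Y \<omega> + B)) * (1 / Y \<omega>)"
          using lam Y[of \<omega>] by (intro mult_right_mono mult_left_mono) auto
        then show ?thesis
          using True Y[of \<omega>] by (simp add: wpop_scale U_def A'_def A_def r_def flip: Y_def)
      next
        case False
        then show ?thesis by (simp add: U_def A'_def A_def)
      qed
      then have "expectation (\<lambda>\<omega>. r * U n \<omega>) \<le> expectation (\<lambda>\<omega>. A' \<omega> * wpop (\<lambda>m. lam * G m) k n \<omega>)"
        by (intro integral_mono integrable_mult_right iU i1) auto
      then show ?thesis by simp
    qed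
    have "expectation (U (Suc n)) \<le> expectation (\<lambda>\<omega>. U n \<omega> - (A' \<omega> * wpop G k (Suc n) \<omega> - A' \<omega> * wpop G k n \<omega>))"
      using iU i1 point by (intro integral_mono Bochner_Integration.integrable_diff) auto
    also have "\<dots> = expectation (U n) - (expectation (\<lambda>\<omega>. A' \<omega> * wpop G k (Suc n) \<omega>) - expectation (\<lambda>\<omega>. A' \<omega> * wpop G k n \<omega>))"
      using i1[of "Suc n" G] i1[of n G] iU[of n] by simp
    also have "\<dots> \<le> expectation (U n) - expectation (\<lambda>\<omega>. A' \<omega> * wpop (\<lambda>m. lam * G m) k n \<omega>) / real (Suc n)"
      using expected_step_ge[OF adA' A'0 n d] by linarith
    also have "\<dots> \<le> expectation (U n) - r * expectation (U n) / real (Suc n)"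
      by (intro diff_left_mono divide_right_mono gain) auto
    also have "\<dots> = (1 - r / real (Suc n)) * expectation (U n)" by (simp add: algebra_simps)
    finally have "expectation (U (Suc n)) * real (Suc (Suc n)) powr r
        \<le> (1 - r / real (Suc n)) * expectation (U n) * real (Suc (Suc n)) powr r"
      by (rule mult_right_mono) simp
    also have "\<dots> = expectation (U n) * ((1 - r / real (Suc n)) * real (Suc (Suc n)) powr r)" by simp
    also have "\<dots> \<le> expectation (U n) * real (Suc n) powr r"
      using U0 by (intro mult_left_mono one_minus_le_powr_ratio[OF r] Bochner_Integration.integral_nonneg) auto
    also have "\<dots> \<le> expectation (U N) * real (Suc N) powr r" by (rule step.IH)
    finally show ?case .
  qed simp
  have "AE \<omega> in M. (\<lambda>n. real n powr b * U n \<omega>) \<longlonglongrightarrow> 0"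
  proof (rule AE_decreasing_decay[where ?n0.0 = N])
    show "U n \<omega> \<le> U m \<omega>" if "N \<le> m" "m \<le> n" for m n \<omega>
      unfolding U_def using that pos[of m \<omega>] pos[of n \<omega>] A01
      by (intro divide_left_mono wpop_mono_time G(1)) auto
    show "0 \<le> b" "b < r" using b unfolding r_def by auto
    show "expectation (U n) \<le> expectation (U N) * real (Suc N) powr r * real n powr - r" if "N \<le> n" for n
    proof -
      have n: "0 < real n" using that N by auto
      have "expectation (U n) * real n powr r \<le> expectation (U n) * real (Suc n) powr r"
        using n r U0 by (intro mult_left_mono powr_mono2 Bochner_Integration.integral_nonneg) auto
      then have "expectation (U n) * real n powr r \<le> expectation (U N) * real (Suc N) powr r"
        using decay[OF that] by linarith
      then show ?thesis using n by (simp add: powr_minus field_simps)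
    qed
  qed (rule iU U0)+
  then show ?thesis unfolding U_def A_def .
qed

text \<open>
  Two passes: since the population never falls below \<open>G 0\<close>, the first pass shows that it diverges, and
  then it exceeds every level \<open>K\<close>, for which the rate is as close to \<open>lam\<close> as desired.
\<close>

lemma wpop_lower_growth:
  assumes G: "\<And>m. 0 \<le> G m" "\<And>m. G m \<le> B" "0 < G 0"
    and d: "\<And>m. lam * G m \<le> drift p k G m" and b: "0 \<le> b" "b < lam"
  shows "AE \<omega> in M. (\<lambda>n. real n powr b / wpop G k n \<omega>) \<longlonglongrightarrow> 0"
proof -
  let ?N0 = "max 1 k"
  have B: "0 < B" using G(2)[of 0] G(3) by simp
  have lam: "0 < lam" using b by simp
  \<comment> \<open>large enough for \<open>b < lam * K / (K + B)\<close>\<close>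
  define K where "K = b * B / (lam - b) + 1"
  have K: "0 < K" using b B unfolding K_def by (intro add_nonneg_pos divide_nonneg_pos mult_nonneg_nonneg) auto
  have "b * B < K * (lam - b)" using b unfolding K_def by (simp add: distrib_right)
  then have bK: "b < lam * K / (K + B)" using K B by (simp add: pos_less_divide_eq algebra_simps)
  have "AE \<omega> in M. (\<lambda>n. real n powr 0 * (of_bool (G 0 \<le> wpop G k ?N0 \<omega>) / wpop G k n \<omega>)) \<longlonglongrightarrow> 0"
    using lam G B by (intro wpop_inverse_decay[OF G lam d G(3)]) auto
  moreover have "AE \<omega> in M. \<forall>N\<in>{?N0..}. (\<lambda>n. real n powr b * (of_bool (K \<le> wpop G k N \<omega>) / wpop G k n \<omega>)) \<longlonglongrightarrow> 0"
    using wpop_inverse_decay[OF G lam d K _ b(1) bK] by (intro AE_ball_countable') auto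
  ultimately show ?thesis
  proof eventually_elim
    case (elim \<omega>)
    have "\<forall>\<^sub>F n in sequentially. real n powr 0 * (of_bool (G 0 \<le> wpop G k ?N0 \<omega>) / wpop G k n \<omega>) < 1 / K"
      using elim(1) K by (intro order_tendstoD(2)) auto
    then obtain N where N: "real N powr 0 * (of_bool (G 0 \<le> wpop G k ?N0 \<omega>) / wpop G k N \<omega>) < 1 / K" "?N0 \<le> N"
      by (metis (no_types, lifting) eventually_sequentially max.cobounded1 max.cobounded2)
    have "0 < wpop G k N \<omega>" using wpop_ge_self[of G k N \<omega>] G N(2) by simp
    moreover have "1 / wpop G k N \<omega> < 1 / K"
      using N wpop_ge_self[of G k ?N0 \<omega>] G by (simp split: if_splits)
    ultimately have "K \<le> wpop G k N \<omega>" using K by (simp add: field_simps)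
    then show ?case using bspec[OF elim(2), of N] N(2) by simp
  qed
qed

end

context branching_law
begin

text \<open>
  Truncating the offspring law at \<open>J\<close> gives a polynomial with a critical point \<open>\<sigma>\<close>. If the minimal
  ratios stayed below some \<open>\<mu> < 1 / R\<close>, a limit point of the critical points would be a point of
  convergence of the full series with ratio at most \<open>\<mu>\<close>.
\<close>

lemma ex_truncated_critical_point:
  assumes mu: "\<mu> < 1 / R_const p"
  obtains J \<sigma> where "0 < \<sigma>" "(\<Sum>z\<le>J. (real z - 1) * pmf p z * \<sigma> ^ z) = 0"
    "\<mu> * \<sigma> < (\<Sum>z\<le>J. pmf p z * \<sigma> ^ z)"
proof -
  obtain j where j: "2 \<le> j" "0 < pmf p j" by (rule ex_offspring_ge_2)
  let ?e = "\<lambda>J s. \<Sum>z\<le>J. (real z - 1) * pmf p z * s ^ z" and ?f = "\<lambda>J s. \<Sum>z\<le>J. pmf p z * s ^ z"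
  have "\<exists>s. 0 < s \<and> ?e J s = 0" if J: "j \<le> J" for J
  proof -
    define t where "t = max 1 (pmf p 0 / pmf p j)"
    have t: "1 \<le> t" "pmf p 0 \<le> pmf p j * t" using j unfolding t_def by (auto simp: field_simps max_def)
    have "pmf p 0 \<le> 1 * pmf p j * t ^ 1" using t by simp
    also have "\<dots> \<le> (real j - 1) * pmf p j * t ^ j"
      using j t by (intro mult_mono power_increasing) auto
    finally have "0 \<le> (\<Sum>z\<in>{0, j}. (real z - 1) * pmf p z * t ^ z)" using j by simp
    also have "\<dots> \<le> ?e J t"
    proof (rule sum_mono2)
      show "0 \<le> (real z - 1) * pmf p z * t ^ z" if "z \<in> {..J} - {0, j}" for z
        using that t by auto
    qed (use J in auto)
    finally have "0 \<le> ?e J t" .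
    moreover have e0: "?e J 0 = - pmf p 0"
    proof -
      have "?e J 0 = (\<Sum>z\<in>{0}. (real z - 1) * pmf p z * 0 ^ z)"
        by (rule sum.mono_neutral_right) auto
      then show ?thesis by simp
    qed
    moreover have "continuous_on {0..t} (?e J)" by (intro continuous_intros)
    ultimately obtain s where s: "0 \<le> s" "?e J s = 0"
      using IVT'[of "?e J" 0 0 t] t p0_pos by auto
    then have "s \<noteq> 0" using e0 p0_pos by auto
    then show ?thesis using s by (intro exI[of _ s]) simp
  qed
  then obtain \<sigma> where \<sigma>: "\<And>J. j \<le> J \<Longrightarrow> 0 < \<sigma> J" "\<And>J. j \<le> J \<Longrightarrow> ?e J (\<sigma> J) = 0" by metis
  have "\<exists>J\<ge>j. \<mu> * \<sigma> J < ?f J (\<sigma> J)"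
  proof (rule ccontr)
    assume "\<not> ?thesis"
    then have le: "?f J (\<sigma> J) \<le> \<mu> * \<sigma> J" if "j \<le> J" for J using that by force
    have term_le: "pmf p z * \<sigma> J ^ z \<le> \<mu> * \<sigma> J" if "j \<le> J" "z \<le> J" for J z
    proof -
      have "pmf p z * \<sigma> J ^ z \<le> ?f J (\<sigma> J)"
        using that \<sigma>(1)[OF that(1)] by (intro member_le_sum) auto
      then show ?thesis using le[OF that(1)] by simp
    qed
    have "0 < \<mu> * \<sigma> j" using term_le[of j 0] p0_pos by simp
    then have mu0: "0 < \<mu>" using \<sigma>(1)[of j] by (simp add: zero_less_mult_iff)
    define lo where "lo = pmf p 0 / \<mu>"
    define hi where "hi = max 1 (\<mu> / pmf p j)"
    have lo0: "0 < lo" unfolding lo_def using mu0 p0_pos by simp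
    have bounds: "\<sigma> J \<in> {lo..hi}" if J: "j \<le> J" for J
    proof -
      have "lo \<le> \<sigma> J" using term_le[OF J, of 0] mu0 unfolding lo_def by (simp add: field_simps)
      moreover have "\<sigma> J \<le> hi"
      proof (cases "\<sigma> J \<le> 1")
        case False
        have "pmf p j * \<sigma> J ^ 2 \<le> pmf p j * \<sigma> J ^ j"
          using False j by (intro mult_left_mono power_increasing) auto
        also have "\<dots> \<le> \<mu> * \<sigma> J" by (rule term_le[OF J J])
        finally have "pmf p j * \<sigma> J \<le> \<mu>" using False by (simp add: power2_eq_square)
        then have "\<sigma> J \<le> \<mu> / pmf p j" using j by (simp add: field_simps)
        then show ?thesis unfolding hi_def by simp
      qed (simp add: hi_def)
      ultimately show ?thesis by simp
    qed
    define \<tau> where "\<tau> n = \<sigma> (j + n)" for n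
    have "\<forall>n. \<tau> n \<in> {lo..hi}" unfolding \<tau>_def using bounds by simp
    then obtain l r where l: "l \<in> {lo..hi}" and r: "strict_mono r" and lim: "(\<tau> \<circ> r) \<longlonglongrightarrow> l"
      using compact_imp_seq_compact[OF compact_Icc, of lo hi] unfolding seq_compact_def by metis
    have l0: "0 < l" using l lo0 by simp
    have part: "?f I l \<le> \<mu> * l" for I
    proof (rule LIMSEQ_le)
      show "(\<lambda>n. ?f I ((\<tau> \<circ> r) n)) \<longlonglongrightarrow> ?f I l" by (intro tendsto_intros lim)
      show "(\<lambda>n. \<mu> * (\<tau> \<circ> r) n) \<longlonglongrightarrow> \<mu> * l" by (intro tendsto_intros lim)
      show "\<exists>N. \<forall>n\<ge>N. ?f I ((\<tau> \<circ> r) n) \<le> \<mu> * (\<tau> \<circ> r) n"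
      proof (intro exI[of _ I] allI impI)
        fix n assume "I \<le> n"
        then have "I \<le> j + r n" using seq_suble[OF r, of n] by simp
        then have "?f I (\<sigma> (j + r n)) \<le> ?f (j + r n) (\<sigma> (j + r n))"
          using less_imp_le[OF \<sigma>(1)[of "j + r n"]] by (intro sum_mono2) auto
        also have "\<dots> \<le> \<mu> * \<sigma> (j + r n)" by (rule le) simp
        finally show "?f I ((\<tau> \<circ> r) n) \<le> \<mu> * (\<tau> \<circ> r) n" by (simp add: \<tau>_def)
      qed
    qed
    have part': "(\<Sum>z<n. pmf p z * l ^ z) \<le> \<mu> * l" for n
      using part[of n] l0 by (rule_tac order_trans[OF sum_mono2]) auto
    have sm: "gf_summable p l"
      by (rule summableI_nonneg_bounded[OF _ part']) (use l0 in simp)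
    have "gen_fun p l \<le> \<mu> * l" unfolding gen_fun_def by (rule suminf_le_const[OF sm part'])
    then have "gen_fun p l / l \<le> \<mu>" using l0 by (simp add: field_simps)
    then show False using inverse_R_const_le[OF l0 sm] mu by simp
  qed
  then obtain J where "j \<le> J" "\<mu> * \<sigma> J < ?f J (\<sigma> J)" by blast
  then show ?thesis using that[of "\<sigma> J" J] \<sigma>[of J] by blast
qed

text \<open>
  At the critical point the tilted steps \<open>z - 1\<close> have mean zero, so for the parabola \<open>m (N - m)\<close> the
  walk without boundary loses exactly the second moment \<open>v\<close>, a fraction at most \<open>v / (N - 1)\<close> inside
  \<open>1, \<dots>, N - 1\<close>. Outside, the parabola is negative and its positive part only helps. The weight at 0
  is chosen small, because no new vertex ever appears at distance 0.
\<close>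

lemma ex_compact_lower_weights:
  assumes mu: "\<mu> < 1 / R_const p"
  obtains G :: "nat \<Rightarrow> real" and B lam N where
    "\<And>m. 0 \<le> G m" "\<And>m. G m \<le> B" "0 < G 0" "\<And>m. N \<le> m \<Longrightarrow> G m = 0" "\<mu> < lam"
    "\<And>k m. lam * G m \<le> drift p k G m"
proof -
  obtain J \<sigma> where \<sigma>: "0 < \<sigma>" and crit: "(\<Sum>z\<le>J. (real z - 1) * pmf p z * \<sigma> ^ z) = 0"
    and gt: "\<mu> * \<sigma> < (\<Sum>z\<le>J. pmf p z * \<sigma> ^ z)" by (rule ex_truncated_critical_point[OF mu])
  define x where "x = 1 / \<sigma>"
  have x: "0 < x" unfolding x_def using \<sigma> by simp
  define a where "a = x * (\<Sum>z\<le>J. pmf p z * \<sigma> ^ z)"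
  define v where "v = x * (\<Sum>z\<le>J. pmf p z * \<sigma> ^ z * (real z - 1)\<^sup>2)"
  have a_mu: "\<mu> < a" using gt \<sigma> unfolding a_def x_def by (simp add: field_simps)
  have a0: "0 < a" unfolding a_def using x \<sigma> p0_pos
    by (intro mult_pos_pos sum_pos2[of _ 0]) auto
  have v0: "0 \<le> v" unfolding v_def using x \<sigma> by (intro mult_nonneg_nonneg sum_nonneg) auto
  obtain N0 :: nat where N0: "v / (a - \<mu>) < real N0" using reals_Archimedean2 by blast
  define N where "N = N0 + 2"
  have N: "0 < real N - 1" "v < (a - \<mu>) * (real N - 1)"
    using N0 a_mu unfolding N_def by (auto simp: pos_divide_less_eq algebra_simps)
  define lam where "lam = a - v / (real N - 1)"
  have lam: "\<mu> < lam" "lam \<le> a" 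
  proof -
    have "v / (real N - 1) < a - \<mu>" using N by (simp add: pos_divide_less_eq)
    moreover have "0 \<le> v / (real N - 1)" using N v0 by simp
    ultimately show "\<mu> < lam" "lam \<le> a" unfolding lam_def by linarith+
  qed
  define h where "h y = y * (real N - y)" for y :: real
  define w0 where "w0 = pmf p 0 * (x * (real N - 1)) / a"
  define G where "G m = (if m = 0 then w0 else x ^ m * max 0 (h (real m)))" for m
  have w0: "0 < w0" unfolding w0_def using p0_pos x N a0 by simp
  have G0: "0 \<le> G m" for m unfolding G_def using w0 x by simp
  have Gz: "G m = 0" if "N \<le> m" for m
  proof -
    have "h (real m) \<le> 0" unfolding h_def using that by (intro mult_nonneg_nonpos) auto
    then show ?thesis unfolding G_def using that by (simp add: N_def)
  qed
  have GB: "G m \<le> (\<Sum>l\<le>N. G l)" for m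
  proof (cases "m \<le> N")
    case True
    then show ?thesis using G0 by (intro member_le_sum) auto
  qed (use Gz[of m] G0 in \<open>auto intro: sum_nonneg\<close>)
  have drift: "lam * G m \<le> drift p k G m" for k m
  proof (cases "m = 0")
    case True
    define h0 where "h0 z = (if z = 0 then G 1 else 0)" for z :: nat
    have fin: "pmf p z * h0 z = 0" if "z \<notin> {0}" for z using that by (simp add: h0_def)
    have "(\<Sum>z. pmf p z * h0 z) \<le> drift p k G m"
    proof (rule suminf_le_drift)
      show "summable (\<lambda>z. pmf p z * h0 z)" by (rule summable_finite[of "{0}"]) (use fin in auto)
      show "h0 z \<le> (if z \<le> m \<or> k = 0 then G (Suc (m - z)) else 0)" for z
        using True G0[of "Suc 0"] by (simp add: h0_def)
    qed
    moreover have "(\<Sum>z. pmf p z * h0 z) = pmf p 0 * G 1"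
      using suminf_finite[of "{0}" "\<lambda>z. pmf p z * h0 z"] fin by (simp add: h0_def)
    moreover have "G 1 = x * (real N - 1)" unfolding G_def h_def using N by simp
    moreover have "lam * G 0 \<le> a * G 0" using lam(2) G0 by (rule mult_right_mono)
    moreover have "a * G 0 = pmf p 0 * (x * (real N - 1))" unfolding G_def w0_def using a0 by simp
    ultimately show ?thesis using True by simp
  next
    case m0: False
    show ?thesis
    proof (cases "N \<le> m")
      case True
      then show ?thesis using Gz drift_nonneg[of G p k m] G0 by simp
    next
      case False
      then have m: "1 \<le> real m" "real m \<le> real N - 1" using m0 by auto
      define g where "g z = (if z \<le> J then \<sigma> ^ z * x ^ Suc m * h (real m + 1 - real z) else 0)" for z
      have fin: "pmf p z * g z = 0" if "z \<notin> {..J}" for z using that by (simp add: g_def)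
      have "(\<Sum>z. pmf p z * g z) \<le> drift p k G m"
      proof (rule suminf_le_drift)
        show "summable (\<lambda>z. pmf p z * g z)" by (rule summable_finite[of "{..J}"]) (use fin in auto)
        fix z
        show "g z \<le> (if z \<le> m \<or> k = 0 then G (Suc (m - z)) else 0)"
        proof (cases "z \<le> m")
          case True
          have "\<sigma> ^ z * x ^ Suc m * h (real m + 1 - real z) = x ^ Suc (m - z) * h (real (Suc (m - z)))"
            using geometric_weight_shift[OF \<sigma> True] True
            by (simp add: x_def of_nat_diff algebra_simps del: power_Suc)
          also have "\<dots> \<le> G (Suc (m - z))" unfolding G_def using x by simp
          finally show ?thesis using True G0[of "Suc (m - z)"] by (simp add: g_def)
        next
          case False
          then have "h (real m + 1 - real z) \<le> 0"
            unfolding h_def by (intro mult_nonpos_nonneg) auto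
          then have "\<sigma> ^ z * x ^ Suc m * h (real m + 1 - real z) \<le> 0"
            using \<sigma> x by (intro mult_nonneg_nonpos) auto
          then have "g z \<le> 0" by (simp add: g_def)
          then show ?thesis using G0[of "Suc (m - z)"] by auto
        qed
      qed
      moreover have "(\<Sum>z. pmf p z * g z) = x ^ m * (a * h (real m) - v)"
      proof -
        have hd: "h (real m + 1 - real z)
            = h (real m) - (real N - 2 * real m) * (real z - 1) - (real z - 1)\<^sup>2" for z
          unfolding h_def by (simp add: power2_eq_square algebra_simps)
        have "(\<Sum>z. pmf p z * g z) = (\<Sum>z\<le>J. pmf p z * g z)"
          using fin by (intro suminf_finite) auto
        also have "\<dots> = (\<Sum>z\<le>J. x ^ m * (x * h (real m) * (pmf p z * \<sigma> ^ z)
            - x * (real N - 2 * real m) * ((real z - 1) * pmf p z * \<sigma> ^ z)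
            - x * (pmf p z * \<sigma> ^ z * (real z - 1)\<^sup>2)))"
        proof (intro sum.cong refl)
          fix z assume "z \<in> {..J}"
          then have gz: "g z = \<sigma> ^ z * x ^ Suc m *
              (h (real m) - (real N - 2 * real m) * (real z - 1) - (real z - 1)\<^sup>2)"
            by (simp add: g_def hd)
          show "pmf p z * g z = x ^ m * (x * h (real m) * (pmf p z * \<sigma> ^ z)
            - x * (real N - 2 * real m) * ((real z - 1) * pmf p z * \<sigma> ^ z)
            - x * (pmf p z * \<sigma> ^ z * (real z - 1)\<^sup>2))" unfolding gz by (simp add: algebra_simps)
        qed
        also have "\<dots> = x ^ m * (a * h (real m) - v)"
          unfolding sum_distrib_left[symmetric] sum_subtractf crit a_def v_def by (simp add: mult_ac)
        finally show ?thesis .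
      qed
      moreover have "lam * G m \<le> x ^ m * (a * h (real m) - v)"
      proof -
        have "0 \<le> (real m - 1) * (real N - 1 - real m)" using m by (intro mult_nonneg_nonneg) auto
        then have hN: "real N - 1 \<le> h (real m)" unfolding h_def by (simp add: algebra_simps)
        then have Gm: "G m = x ^ m * h (real m)" unfolding G_def using m0 N by simp
        have "v = v / (real N - 1) * (real N - 1)" using N by simp
        also have "\<dots> \<le> v / (real N - 1) * h (real m)"
          using hN v0 N by (intro mult_left_mono) auto
        finally have "lam * h (real m) \<le> a * h (real m) - v" unfolding lam_def by (simp add: algebra_simps)
        then have "x ^ m * (lam * h (real m)) \<le> x ^ m * (a * h (real m) - v)"
          using x by (intro mult_left_mono) auto
        then show ?thesis unfolding Gm by (simp add: mult_ac)
      qed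
      ultimately show ?thesis by linarith
    qed
  qed
  have "0 < G 0" using w0 by (simp add: G_def)
  then show ?thesis using that[OF G0 GB _ Gz lam(1) drift] by blast
qed

end

lemma attach_tree_cong:
  assumes "\<And>i. 2 \<le> i \<Longrightarrow> i \<le> n \<Longrightarrow> z i = z' i" "\<And>i. 1 \<le> i \<Longrightarrow> i < n \<Longrightarrow> u i = u' i"
  shows "attach_tree z u n = attach_tree z' u' n"
  using assms by (induction z u n rule: attach_tree.induct) (auto simp: Let_def)

lemma (in attachment_model) measurable_random_tree:
  "random_tree Z V n \<in> M \<rightarrow>\<^sub>M count_space UNIV"
proof -
  let ?A = "Inl ` {2..n} \<union> Inr ` {1..<n} :: (nat + nat) set"
  let ?F = "\<lambda>f. attach_tree (\<lambda>i. f (Inl i)) (\<lambda>i. f (Inr i)) n"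
  have "indep_var (count_space UNIV) (\<lambda>\<omega>. ?F (restrict (\<lambda>i. case_sum Z V i \<omega>) ?A))
    (count_space UNIV) (\<lambda>\<omega>. ?F (restrict (\<lambda>i. case_sum Z V i \<omega>) {}))"
    by (intro indep_discrete) auto
  then have "(\<lambda>\<omega>. ?F (restrict (\<lambda>i. case_sum Z V i \<omega>) ?A)) \<in> M \<rightarrow>\<^sub>M count_space UNIV"
    unfolding indep_var_eq by blast
  moreover have "?F (restrict (\<lambda>i. case_sum Z V i \<omega>) ?A) = random_tree Z V n \<omega>" for \<omega>
    unfolding random_tree_def by (intro attach_tree_cong) auto
  ultimately show ?thesis by simp
qed

locale branching_attachment = attachment_model + branching_law
begin

lemma AE_pagerank_upper:
  assumes c: "0 < c" "c \<le> 1 / s0 p" "c < 1" and ks: "1 \<le> k \<or> 1 \<le> s0 p" and \<delta>: "0 < \<delta>"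
  shows "AE \<omega> in M. (\<lambda>n. pagerank c (random_tree Z V n \<omega>) k
      / (real n powr (1 / R_const p) * ln (real n) powr (1 + \<delta>))) \<longlonglongrightarrow> 0"
proof -
  let ?G = "\<lambda>m. (1 / s0 p) ^ m"
  have "AE \<omega> in M. (\<lambda>n. wpop ?G k n \<omega> / (real n powr (1 / R_const p) * ln (real n) powr (1 + \<delta>))) \<longlonglongrightarrow> 0"
    using s0_pos R_const_pos drift_geometric_le[OF s0_pos s0_gf_summable ks] \<delta>
    by (intro wpop_upper_growth) (auto simp: inverse_R_const)
  then show ?thesis using AE_pagerank[of k c]
  proof eventually_elim
    case (elim \<omega>)
    have cG: "c ^ m \<le> ?G m" for m using c by (intro power_mono) auto
    show ?case
    proof (rule tendsto_sandwich[OF _ _ tendsto_const elim(1)])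
      show "\<forall>\<^sub>F n in sequentially. 0 \<le> pagerank c (random_tree Z V n \<omega>) k
          / (real n powr (1 / R_const p) * ln (real n) powr (1 + \<delta>))"
        using eventually_ge_at_top[of k]
        by eventually_elim (use elim(2) c wpop_nonneg in simp)
      show "\<forall>\<^sub>F n in sequentially. pagerank c (random_tree Z V n \<omega>) k
          / (real n powr (1 / R_const p) * ln (real n) powr (1 + \<delta>))
          \<le> wpop ?G k n \<omega> / (real n powr (1 / R_const p) * ln (real n) powr (1 + \<delta>))"
        using eventually_ge_at_top[of k]
      proof eventually_elim
        case (elim n)
        have "(1 - c) * wpop (\<lambda>m. c ^ m) k n \<omega> \<le> 1 * wpop ?G k n \<omega>"
          using c wpop_nonneg cG by (intro mult_mono wpop_mono_weight) auto
        then show ?case using \<open>\<forall>n\<ge>k. _ n\<close> elim by (intro divide_right_mono) auto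
      qed
    qed
  qed
qed

text \<open>
  Compactly supported weights are dominated by a multiple of \<open>c ^ m\<close>, whatever the
  damping factor, and the exponent of the population carries over to the score.
\<close>

lemma AE_pagerank_lower:
  assumes c: "0 < c" "c < 1" and \<delta>: "0 < \<delta>"
  shows "AE \<omega> in M. filterlim (\<lambda>n. pagerank c (random_tree Z V n \<omega>) k / real n powr (1 / R_const p - \<delta>))
      at_top sequentially"
proof -
  define b where "b = max (1 / R_const p - \<delta>) (1 / R_const p / 2)"
  have b: "0 \<le> b" "b < 1 / R_const p" "1 / R_const p - \<delta> \<le> b"
  proof -
    define a where "a = 1 / R_const p"
    have "0 < a" unfolding a_def by (rule R_const_pos)
    then show "0 \<le> b" "b < 1 / R_const p" "1 / R_const p - \<delta> \<le> b"
      using \<delta> unfolding b_def a_def[symmetric] by auto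
  qed
  obtain G :: "nat \<Rightarrow> real" and B lam N where
    G: "\<And>m. 0 \<le> G m" "\<And>m. G m \<le> B" "0 < G 0" and GN: "\<And>m. N \<le> m \<Longrightarrow> G m = 0"
    and lam: "b < lam" and d: "\<And>k m. lam * G m \<le> drift p k G m"
    using ex_compact_lower_weights[OF b(2)] by metis
  have B: "0 < B" using G(2)[of 0] G(3) by simp
  have "AE \<omega> in M. (\<lambda>n. real n powr b / wpop G k n \<omega>) \<longlonglongrightarrow> 0"
    by (rule wpop_lower_growth[OF G d b(1) lam])
  then show ?thesis using AE_pagerank[of k c]
  proof eventually_elim
    case (elim \<omega>)
    define \<kappa> where "\<kappa> = (1 - c) * (c ^ N / B)"
    have \<kappa>: "0 < \<kappa>" unfolding \<kappa>_def using c B by simp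
    have pos: "0 < wpop G k n \<omega>" if "k \<le> n" for n using wpop_ge_self[of G k n \<omega>] G that by simp
    have "filterlim (\<lambda>n. inverse (real n powr b / wpop G k n \<omega>)) at_top sequentially"
    proof (rule filterlim_inverse_at_top[OF elim(1)])
      show "\<forall>\<^sub>F n in sequentially. 0 < real n powr b / wpop G k n \<omega>"
        using eventually_ge_at_top[of "max 1 k"]
        by eventually_elim (use pos in auto)
    qed
    then have "filterlim (\<lambda>n. \<kappa> * inverse (real n powr b / wpop G k n \<omega>)) at_top sequentially"
      by (intro filterlim_tendsto_pos_mult_at_top[OF tendsto_const \<kappa>])
    then show ?case
    proof (rule filterlim_at_top_mono)
      show "\<forall>\<^sub>F n in sequentially. \<kappa> * inverse (real n powr b / wpop G k n \<omega>)
          \<le> pagerank c (random_tree Z V n \<omega>) k / real n powr (1 / R_const p - \<delta>)"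
        using eventually_ge_at_top[of "max 1 k"]
      proof eventually_elim
        case (elim n)
        have cmp: "c ^ N / B * G m \<le> c ^ m" for m
        proof (cases "N \<le> m")
          case False
          have "c ^ N / B * G m \<le> c ^ N / B * B" using c B G by (intro mult_left_mono) auto
          also have "\<dots> \<le> c ^ m" using False c B by (simp add: power_decreasing)
          finally show ?thesis .
        qed (use GN c in simp)
        have "\<kappa> * wpop G k n \<omega> = (1 - c) * wpop (\<lambda>m. c ^ N / B * G m) k n \<omega>"
          unfolding \<kappa>_def wpop_scale by simp
        also have "\<dots> \<le> (1 - c) * wpop (\<lambda>m. c ^ m) k n \<omega>"
          using c by (intro mult_left_mono wpop_mono_weight cmp) auto
        also have "\<dots> = pagerank c (random_tree Z V n \<omega>) k" using \<open>\<forall>n\<ge>k. _ n\<close> elim by simp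
        finally have "\<kappa> * wpop G k n \<omega> / real n powr b
            \<le> pagerank c (random_tree Z V n \<omega>) k / real n powr b" by (rule divide_right_mono) simp
        also have "\<dots> \<le> pagerank c (random_tree Z V n \<omega>) k / real n powr (1 / R_const p - \<delta>)"
        proof (rule divide_left_mono)
          show "real n powr (1 / R_const p - \<delta>) \<le> real n powr b"
            using elim b by (intro powr_mono) auto
          show "0 \<le> pagerank c (random_tree Z V n \<omega>) k" using \<open>\<forall>n\<ge>k. _ n\<close> elim c wpop_nonneg by simp
        qed (use elim in simp)
        finally show ?case by (simp add: field_simps)
      qed
    qed
  qed
qed

text \<open>
  Above criticality a geometrically growing weight is contracted by the drift, up to a constant, so
  its average over the tree stays bounded in mean: a uniformly chosen vertex has tight depth, and a
  positive fraction of all vertices contributes to the score of the root.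
\<close>

lemma root_pagerank_linear:
  assumes mean: "integrable (measure_pmf p) real" "1 < measure_pmf.expectation p real"
    and c: "0 < c" "c < 1" and \<delta>: "0 < \<delta>"
  obtains \<eta> where "0 < \<eta>"
    "\<And>n. 1 \<le> n \<Longrightarrow> 1 - \<delta> \<le> \<P>(\<omega> in M. \<eta> \<le> pagerank c (random_tree Z V n \<omega>) 0 / real n)"
proof -
  obtain u where u: "0 < u" "u < 1" "gen_fun p u < u" by (rule supercritical_contraction[OF mean])
  define x where "x = 1 / u"
  define r where "r = gen_fun p u / u"
  have x: "1 < x" unfolding x_def using u by simp
  have smu: "gf_summable p u" using gf_summable_mono[OF gf_summable_1, of u p] u by simp
  have r: "0 \<le> r" "r < 1" unfolding r_def using u gen_fun_pos[OF smu] by auto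
  have d: "drift p 0 (\<lambda>m. x ^ m) m \<le> r * x ^ m + x" for m
  proof -
    have s1: "summable (\<lambda>z. pmf p z * (u ^ z * x ^ Suc m))"
      using summable_mult2[OF smu, of "x ^ Suc m"] by (simp add: mult.assoc)
    have s2: "summable (\<lambda>z. pmf p z * x)" using summable_mult2[OF gf_summable_1, of p x] by simp
    have "drift p 0 (\<lambda>m. x ^ m) m \<le> (\<Sum>z. pmf p z * (u ^ z * x ^ Suc m + x))"
    proof (rule drift_le_suminf)
      show "summable (\<lambda>z. pmf p z * (u ^ z * x ^ Suc m + x))"
        using summable_add[OF s1 s2] by (simp add: distrib_left)
      show "(if z \<le> m \<or> (0::nat) = 0 then x ^ Suc (m - z) else 0) \<le> u ^ z * x ^ Suc m + x" for z
        using geometric_weight_shift[OF u(1), of z m] u x by (cases "z \<le> m") (auto simp: x_def)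
    qed
    also have "\<dots> = (\<Sum>z. pmf p z * (u ^ z * x ^ Suc m)) + (\<Sum>z. pmf p z * x)"
      using suminf_add[OF s1 s2] by (simp add: distrib_left)
    also have "(\<Sum>z. pmf p z * (u ^ z * x ^ Suc m)) = gen_fun p u * x ^ Suc m"
      unfolding gen_fun_def using suminf_mult2[OF smu, of "x ^ Suc m"] by (simp add: mult.assoc)
    also have "(\<Sum>z. pmf p z * x) = x"
      using suminf_mult2[OF gf_summable_1, of p x] gen_fun_1[of p] by (simp add: gen_fun_def)
    finally show ?thesis by (simp add: r_def x_def)
  qed
  have count: "wpop (\<lambda>_. 1) 0 n \<omega> = real (Suc n)" for n \<omega>
    unfolding wpop_def weight_def using descends_0[OF parent_function_state] by simp
  let ?U = "wpop (\<lambda>m. x ^ m) 0"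
  \<comment> \<open>the fixed point \<open>x / (1 - r)\<close> of the recursion \<open>C \<mapsto> r C + x\<close> for the mean weight per vertex, or the initial value\<close>
  define C where "C = max (expectation (?U 1)) (x / (1 - r))"
  have "x \<le> C * (1 - r)" using r unfolding C_def by (simp add: pos_divide_le_eq[symmetric])
  then have Cx: "C * r + x \<le> C" by (simp add: algebra_simps)
  have C0: "0 < C" using r x unfolding C_def by (simp add: less_max_iff_disj)
  have EU: "expectation (?U n) \<le> C * real (Suc n)" if "1 \<le> n" for n
    using that
  proof (induction n rule: dec_induct)
    case base
    have "expectation (?U 1) \<le> C" unfolding C_def by simp
    then show ?case using C0 by simp
  next
    case (step n)
    have eqH: "wpop (\<lambda>m. r * x ^ m + x) 0 n \<omega> = r * ?U n \<omega> + x * real (Suc n)" for \<omega>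
      using wpop_add[of "\<lambda>m. r * x ^ m" "\<lambda>_. x * 1" 0 n \<omega>]
      unfolding wpop_scale count unfolding mult_1_right .
    have "expectation (?U (Suc n)) \<le> expectation (?U n) + expectation (\<lambda>\<omega>. r * ?U n \<omega> + x * real (Suc n)) / real (Suc n)"
      using expected_step_le[of n "\<lambda>_. 1" 0 "\<lambda>m. x ^ m" "\<lambda>m. r * x ^ m + x"] step d
      by (simp add: eqH)
    also have "expectation (\<lambda>\<omega>. r * ?U n \<omega> + x * real (Suc n)) = r * expectation (?U n) + x * real (Suc n)"
      using integrable_wpop by (simp add: prob_space)
    also have "expectation (?U n) + (r * expectation (?U n) + x * real (Suc n)) / real (Suc n)
        = (1 + r / real (Suc n)) * expectation (?U n) + x" by (simp add: add_divide_distrib distrib_right del: of_nat_Suc)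
    also have "\<dots> \<le> (1 + r / real (Suc n)) * (C * real (Suc n)) + x"
      using r by (intro add_right_mono mult_left_mono step.IH) auto
    also have "\<dots> = C * real (Suc n) + (C * r + x)" by (simp add: field_simps)
    also have "\<dots> \<le> C * real (Suc (Suc n))" using Cx by (simp add: algebra_simps)
    finally show ?case .
  qed
  define K where "K = C / \<delta>"
  have K: "0 < K" unfolding K_def using C0 \<delta> by simp
  obtain D where D: "2 * K < x ^ D" using real_arch_pow[OF x] by blast
  define \<eta> where "\<eta> = (1 - c) * (c ^ D / 2)"
  have \<eta>: "0 < \<eta>" unfolding \<eta>_def using c by simp
  have main: "1 - \<delta> \<le> \<P>(\<omega> in M. \<eta> \<le> pagerank c (random_tree Z V n \<omega>) 0 / real n)" if n: "1 \<le> n" for n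
  proof -
    have U0: "0 \<le> ?U n \<omega>" for \<omega> using x by (intro wpop_nonneg) simp
    have [measurable]: "?U n \<in> borel_measurable M" using integrable_wpop by blast
    have [measurable]: "(\<lambda>\<omega>. pagerank c (random_tree Z V n \<omega>) 0) \<in> borel_measurable M"
      by (rule measurable_compose[OF measurable_random_tree]) simp
    have "\<P>(\<omega> in M. K * real (Suc n) \<le> ?U n \<omega>) \<le> expectation (?U n) / (K * real (Suc n))"
      using K U0 by (intro integral_Markov_inequality_measure[where A = "space M"] integrable_wpop) auto
    also have "\<dots> \<le> C * real (Suc n) / (K * real (Suc n))"
      using EU[OF n] K by (intro divide_right_mono) auto
    also have "\<dots> = \<delta>" unfolding K_def using C0 \<delta> by simp
    finally have bad: "\<P>(\<omega> in M. K * real (Suc n) \<le> ?U n \<omega>) \<le> \<delta>" .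
    have "1 - \<delta> \<le> 1 - \<P>(\<omega> in M. K * real (Suc n) \<le> ?U n \<omega>)" using bad by simp
    also have "\<dots> = \<P>(\<omega> in M. \<not> K * real (Suc n) \<le> ?U n \<omega>)" by (rule prob_neg[symmetric]) measurable
    also have "\<dots> \<le> \<P>(\<omega> in M. \<eta> \<le> pagerank c (random_tree Z V n \<omega>) 0 / real n)"
    proof (rule finite_measure_mono_AE)
      show "AE \<omega> in M. \<omega> \<in> {\<omega> \<in> space M. \<not> K * real (Suc n) \<le> ?U n \<omega>} \<longrightarrow>
          \<omega> \<in> {\<omega> \<in> space M. \<eta> \<le> pagerank c (random_tree Z V n \<omega>) 0 / real n}"
        using AE_pagerank[of 0 c]
      proof eventually_elim
        case (elim \<omega>)
        show ?case
        proof (intro impI)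
          assume \<omega>: "\<omega> \<in> {\<omega> \<in> space M. \<not> K * real (Suc n) \<le> ?U n \<omega>}"
          then have UK: "?U n \<omega> \<le> K * real (Suc n)" by simp
          \<comment> \<open>a lower bound for \<open>c ^ m\<close> that is affine in \<open>x ^ m\<close>, so that it can be summed over the tree\<close>
          have cD: "c ^ D * (1 - 1 / x ^ D * x ^ m) \<le> c ^ m" for m
          proof (cases "m \<le> D")
            case True
            have "c ^ D * (1 - 1 / x ^ D * x ^ m) \<le> c ^ D * 1" using c x by (intro mult_left_mono) auto
            also have "\<dots> \<le> c ^ m" using True c by (simp add: power_decreasing)
            finally show ?thesis .
          next
            case False
            then have "x ^ D \<le> x ^ m" using x by (intro power_increasing) auto
            then have "1 - 1 / x ^ D * x ^ m \<le> 0" using x by (simp add: pos_le_divide_eq)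
            then have "c ^ D * (1 - 1 / x ^ D * x ^ m) \<le> 0" using c by (intro mult_nonneg_nonpos) auto
            also have "\<dots> \<le> c ^ m" using c by simp
            finally show ?thesis .
          qed
          have "1 / x ^ D * ?U n \<omega> \<le> 1 / x ^ D * (K * real (Suc n))"
            using UK x by (intro mult_left_mono) auto
          also have "\<dots> = K / x ^ D * real (Suc n)" by simp
          also have "\<dots> \<le> 1 / 2 * real (Suc n)"
            using D x by (intro mult_right_mono) (auto simp: pos_divide_le_eq)
          finally have "1 / 2 * real (Suc n) \<le> real (Suc n) - 1 / x ^ D * ?U n \<omega>" by simp
          then have "c ^ D * (1 / 2 * real (Suc n)) \<le> c ^ D * (real (Suc n) - 1 / x ^ D * ?U n \<omega>)"
            using c by (intro mult_left_mono) auto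
          also have "\<dots> = wpop (\<lambda>m. c ^ D * (1 - 1 / x ^ D * x ^ m)) 0 n \<omega>"
            unfolding wpop_scale[of "c ^ D"] wpop_diff wpop_scale[of "1 / x ^ D"] count ..
          also have "\<dots> \<le> wpop (\<lambda>m. c ^ m) 0 n \<omega>" by (rule wpop_mono_weight[OF cD])
          finally have "(1 - c) * (c ^ D * (1 / 2 * real (Suc n))) \<le> (1 - c) * wpop (\<lambda>m. c ^ m) 0 n \<omega>"
            using c by (intro mult_left_mono) auto
          then have "\<eta> * real (Suc n) \<le> pagerank c (random_tree Z V n \<omega>) 0"
            using elim unfolding \<eta>_def by (simp add: mult_ac)
          moreover have "\<eta> * real n \<le> \<eta> * real (Suc n)" using \<eta> by simp
          ultimately have "\<eta> \<le> pagerank c (random_tree Z V n \<omega>) 0 / real n"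
            using n by (simp add: pos_le_divide_eq)
          then show "\<omega> \<in> {\<omega> \<in> space M. \<eta> \<le> pagerank c (random_tree Z V n \<omega>) 0 / real n}"
            using \<omega> by simp
        qed
      qed
    qed measurable
    finally show ?thesis .
  qed
  show ?thesis by (rule that[OF \<eta> main])
qed

end

section \<open>The normalising product\<close>

text \<open>
  The solution of \<open>e (n + 1) = (1 + a / (n + 1)) e n\<close>, that is \<open>pochhammer (a + 1) n / fact n\<close>. It is
  comparable to \<open>n powr a\<close>, but unlike the power it makes the normalised recursions exact.
\<close>

definition growth :: "real \<Rightarrow> nat \<Rightarrow> real" where
  "growth a n = (\<Prod>i<n. 1 + a / real (Suc i))"

lemma growth_Suc: "growth a (Suc n) = (1 + a / real (Suc n)) * growth a n"
  by (simp add: growth_def mult.commute)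

lemma growth_pos: "0 \<le> a \<Longrightarrow> 0 < growth a n"
  unfolding growth_def by (intro prod_pos) (auto intro: add_pos_nonneg)

lemma growth_le_Suc: "0 \<le> a \<Longrightarrow> growth a n \<le> growth a (Suc n)"
  unfolding growth_Suc using growth_pos[of a n] by (simp add: algebra_simps)

lemma growth_telescope:
  assumes "0 \<le> a"
  shows "1 / growth a n - 1 / growth a (Suc n) = a / real (Suc n) / growth a (Suc n)"
proof -
  have "growth a (Suc n) - growth a n = a / real (Suc n) * growth a n"
    unfolding growth_Suc by (simp add: algebra_simps)
  then show ?thesis using growth_pos[OF assms, of n] growth_pos[OF assms, of "Suc n"]
    by (simp add: diff_frac_eq mult.commute)
qed

lemma growth_ratio_telescope:
  assumes "0 \<le> a" "0 \<le> b"
  shows "growth b n / growth a n - growth b (Suc n) / growth a (Suc n)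
    = (a - b) / real (Suc n) * growth b n / growth a (Suc n)"
proof -
  have 1: "growth b n / growth a n = (1 + a / real (Suc n)) * growth b n / growth a (Suc n)"
    unfolding growth_Suc using growth_pos[OF assms(1), of n] assms(1)
      add_pos_nonneg[of 1 "a / real (Suc n)"] by simp
  have 2: "(1 + a / real (Suc n)) * growth b n - (1 + b / real (Suc n)) * growth b n
      = (a - b) / real (Suc n) * growth b n"
    by (simp add: algebra_simps diff_divide_distrib)
  show ?thesis unfolding 1 growth_Suc[of b] diff_divide_distrib[symmetric] 2 ..
qed

text \<open>
  Up to the factor \<open>a\<close>, the ratio \<open>n powr a / growth a n\<close> is the sequence in Gauss's limit formula for the
  Gamma function.
\<close>

lemma growth_asymptotics:
  assumes a: "0 < a"
  shows "\<exists>\<beta>>0. (\<lambda>n. growth a n / real n powr a) \<longlonglongrightarrow> \<beta> \<and>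
    (\<forall>n\<ge>1. \<beta> * real n powr a \<le> growth a n \<and> growth a n \<le> (1 + a) * real n powr a)"
proof -
  let ?q = "\<lambda>n. growth a n / real n powr a"
  have g: "growth a n = pochhammer (a + 1) n / fact n" for n
  proof (induction n)
    case (Suc n)
    show ?case unfolding growth_Suc Suc.IH pochhammer_Suc fact_Suc by (simp add: field_simps)
  qed (simp add: growth_def)
  have eq: "?q n = 1 / (a * Gamma_series a n)" if "1 \<le> n" for n
    using that a by (simp add: g Gamma_series_def pochhammer_rec powr_def field_simps)
  have "(\<lambda>n. 1 / (a * Gamma_series a n)) \<longlonglongrightarrow> 1 / (a * Gamma a)"
  proof (intro tendsto_intros Gamma_series_LIMSEQ)
    show "a * Gamma a \<noteq> 0" using a less_imp_neq[OF Gamma_real_pos[OF a]] by auto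
  qed
  moreover have "\<forall>\<^sub>F n in sequentially. 1 / (a * Gamma_series a n) = ?q n"
    using eventually_ge_at_top[of 1] by eventually_elim (simp add: eq)
  ultimately have lim: "?q \<longlonglongrightarrow> 1 / (a * Gamma a)" by (rule Lim_transform_eventually)
  have cross: "u / b \<le> y / d" if "0 < b" "0 < d" "u * d \<le> b * y" for u y b d :: real
    using that by (simp add: field_simps)
  have q_Suc: "?q (Suc n) \<le> ?q n" if "1 \<le> n" for n
  proof (rule cross)
    have "growth a (Suc n) * real n powr a = ((1 + a / real (Suc n)) * real n powr a) * growth a n"
      by (simp add: growth_Suc)
    also have "\<dots> \<le> real (Suc n) powr a * growth a n"
      using one_plus_le_powr_ratio[of a n] a growth_pos[of a n] that by (intro mult_right_mono) auto
    finally show "growth a (Suc n) * real n powr a \<le> real (Suc n) powr a * growth a n" .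
  qed (use that in auto)
  have anti: "?q n \<le> ?q m" if m: "1 \<le> m" and n: "m \<le> n" for m n
    using n
  proof (induction n rule: dec_induct)
    case (step n)
    have "1 \<le> n" using m step(1) by (rule order_trans)
    from q_Suc[OF this] step.IH show ?case by (rule order_trans)
  qed (rule order_refl)
  show ?thesis
  proof (intro exI[of _ "1 / (a * Gamma a)"] conjI lim allI impI)
    show "0 < 1 / (a * Gamma a)" using a Gamma_real_pos[OF a] by simp
    fix n :: nat assume n: "1 \<le> n"
    have "1 / (a * Gamma a) \<le> ?q n"
      using anti[OF n] by (intro LIMSEQ_le_const2[OF lim]) auto
    then show "1 / (a * Gamma a) * real n powr a \<le> growth a n" using n by (subst pos_le_divide_eq[symmetric]) auto
    have "?q n \<le> ?q 1" using anti[of 1 n] n by simp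
    also have "?q 1 = 1 + a" by (simp add: growth_def)
    finally show "growth a n \<le> (1 + a) * real n powr a" using n by (simp add: pos_divide_le_eq)
  qed
qed

section \<open>Filling in between powers\<close>

text \<open>
  Consecutive powers \<open>i ^ r\<close> have ratio tending to 1, so a monotone sequence cannot oscillate between
  them.
\<close>

lemma tendsto_between_powers:
  fixes X :: "nat \<Rightarrow> real"
  assumes mono: "incseq X" and nonneg: "\<And>n. 0 \<le> X n" and a: "0 \<le> a" and r: "1 \<le> r"
    and lim: "(\<lambda>i. X (i ^ r) / real (i ^ r) powr a) \<longlonglongrightarrow> w"
  shows "(\<lambda>n. X n / real n powr a) \<longlonglongrightarrow> w"
proof -
  define y where "y i = X (i ^ r) / real (i ^ r) powr a" for i
  define ix where "ix n = (LEAST i. n < Suc i ^ r)" for n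
  have hi: "n < Suc (ix n) ^ r" for n
  proof -
    have "Suc n ^ 1 \<le> Suc n ^ r" using r by (intro power_increasing) auto
    then have "n < Suc n ^ r" by simp
    then show ?thesis unfolding ix_def by (rule LeastI)
  qed
  have lo: "ix n ^ r \<le> n" for n
  proof (cases "ix n")
    case 0
    then show ?thesis using r by (simp add: power_0_left)
  next
    case (Suc i)
    then have "\<not> n < Suc i ^ r" using not_less_Least[of i "\<lambda>i. n < Suc i ^ r"] unfolding ix_def by simp
    then show ?thesis using Suc by simp
  qed
  have ix: "filterlim ix at_top sequentially"
    unfolding filterlim_at_top
  proof
    fix K
    show "\<forall>\<^sub>F n in sequentially. K \<le> ix n"
      using eventually_ge_at_top[of "K ^ r"]
    proof eventually_elim
      case (elim n)
      then have "K ^ r < Suc (ix n) ^ r" using hi[of n] by simp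
      then show ?case using power_less_imp_less_base[of K r "Suc (ix n)"] by simp
    qed
  qed
  have up: "(\<lambda>i. y (Suc i) * (real (Suc i) / real i) powr (real r * a)) \<longlonglongrightarrow> w * 1 powr (real r * a)"
    by (intro tendsto_intros LIMSEQ_Suc lim[folded y_def] LIMSEQ_Suc_n_over_n) auto
  have down: "(\<lambda>i. y i * (real i / real (Suc i)) powr (real r * a)) \<longlonglongrightarrow> w * 1 powr (real r * a)"
    by (intro tendsto_intros lim[folded y_def] LIMSEQ_n_over_Suc_n) auto
  have pw: "real (i ^ r) powr a = real i powr (real r * a)" for i
    using r by (cases "i = 0") (auto simp: powr_powr powr_realpow[symmetric])
  show ?thesis
  proof (rule tendsto_sandwich)
    show "(\<lambda>n. y (ix n) * (real (ix n) / real (Suc (ix n))) powr (real r * a)) \<longlonglongrightarrow> w"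
      using filterlim_compose[OF down ix] by simp
    show "(\<lambda>n. y (Suc (ix n)) * (real (Suc (ix n)) / real (ix n)) powr (real r * a)) \<longlonglongrightarrow> w"
      using filterlim_compose[OF up ix] by simp
    have big: "\<forall>\<^sub>F n in sequentially. 1 \<le> ix n" using ix unfolding filterlim_at_top by blast
    have n0: "0 < real n" if "1 \<le> ix n" for n
    proof -
      have "1 ^ r \<le> ix n ^ r" using that by (intro power_mono) auto
      then show ?thesis using lo[of n] by simp
    qed
    show "\<forall>\<^sub>F n in sequentially. y (ix n) * (real (ix n) / real (Suc (ix n))) powr (real r * a) \<le> X n / real n powr a"
      using big
    proof eventually_elim
      case (elim n)
      have "y (ix n) * (real (ix n) / real (Suc (ix n))) powr (real r * a)
          = X (ix n ^ r) / real (Suc (ix n) ^ r) powr a"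
        unfolding y_def pw using elim by (simp add: powr_divide)
      also have "\<dots> \<le> X n / real n powr a"
        using hi[of n] n0[OF elim] a nonneg
        by (intro frac_le incseqD[OF mono lo] powr_mono2) (auto simp del: of_nat_power)
      finally show ?case .
    qed
    show "\<forall>\<^sub>F n in sequentially. X n / real n powr a \<le> y (Suc (ix n)) * (real (Suc (ix n)) / real (ix n)) powr (real r * a)"
      using big
    proof eventually_elim
      case (elim n)
      have "X n / real n powr a \<le> X (Suc (ix n) ^ r) / real (ix n ^ r) powr a"
        using hi[of n] lo[of n] elim a nonneg
        by (intro frac_le incseqD[OF mono] powr_mono2) (auto simp del: of_nat_power)
      also have "\<dots> = y (Suc (ix n)) * (real (Suc (ix n)) / real (ix n)) powr (real r * a)"
        unfolding y_def pw using elim by (simp add: powr_divide)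
      finally show ?case .
    qed
  qed
qed

section \<open>Second moments and convergence\<close>

lemma drift_mono: "(\<And>m. G m \<le> H m) \<Longrightarrow> drift p k G m \<le> drift p k H m"
  unfolding drift_eq_suminf by (intro suminf_le drift_summable mult_left_mono) auto

text \<open>
  The difference of two geometric weights vanishes at 0 and would be negative at negative distances,
  so for it the boundary only removes negative terms.
\<close>

lemma drift_geometric_diff_ge:
  assumes s: "0 < s" "s \<le> t" "gf_summable p t"
  shows "gen_fun p s / s * (1 / s) ^ m - gen_fun p t / t * (1 / t) ^ m
    \<le> drift p k (\<lambda>m. (1 / s) ^ m - (1 / t) ^ m) m"
proof -
  have t: "0 < t" using s by simp
  have sms: "gf_summable p s" using gf_summable_mono[OF s(3)] s by simp
  have s1: "summable (\<lambda>z. pmf p z * (s ^ z * (1 / s) ^ Suc m))"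
    using summable_mult2[OF sms, of "(1 / s) ^ Suc m"] by (simp add: mult.assoc)
  have s2: "summable (\<lambda>z. pmf p z * (t ^ z * (1 / t) ^ Suc m))"
    using summable_mult2[OF s(3), of "(1 / t) ^ Suc m"] by (simp add: mult.assoc)
  have "gen_fun p s / s * (1 / s) ^ m - gen_fun p t / t * (1 / t) ^ m
      = (\<Sum>z. pmf p z * (s ^ z * (1 / s) ^ Suc m)) - (\<Sum>z. pmf p z * (t ^ z * (1 / t) ^ Suc m))"
    unfolding gen_fun_def
    using suminf_mult2[OF sms, of "(1 / s) ^ Suc m"] suminf_mult2[OF s(3), of "(1 / t) ^ Suc m"]
    by (simp add: mult.assoc)
  also have "\<dots> = (\<Sum>z. pmf p z * (s ^ z * (1 / s) ^ Suc m - t ^ z * (1 / t) ^ Suc m))"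
    using suminf_diff[OF s1 s2] by (simp add: right_diff_distrib)
  also have "\<dots> \<le> drift p k (\<lambda>m. (1 / s) ^ m - (1 / t) ^ m) m"
  proof (rule suminf_le_drift)
    show "summable (\<lambda>z. pmf p z * (s ^ z * (1 / s) ^ Suc m - t ^ z * (1 / t) ^ Suc m))"
      using summable_diff[OF s1 s2] by (simp add: right_diff_distrib)
    fix z
    show "s ^ z * (1 / s) ^ Suc m - t ^ z * (1 / t) ^ Suc m
        \<le> (if z \<le> m \<or> k = 0 then (1 / s) ^ Suc (m - z) - (1 / t) ^ Suc (m - z) else 0)"
    proof (cases "z \<le> m")
      case True
      then show ?thesis
        using geometric_weight_shift[OF s(1) True] geometric_weight_shift[OF t True] by (simp del: power_Suc)
    next
      case False
      have q: "x ^ z * (1 / x) ^ Suc m = x ^ (z - Suc m)" if "0 < x" for x :: real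
      proof -
        have "x ^ z * (1 / x) ^ Suc m = x ^ (z - Suc m) * (x * (1 / x)) ^ Suc m"
          unfolding power_mult_distrib using False by (simp add: mult.assoc[symmetric] del: power_Suc flip: power_add)
        then show ?thesis using that by simp
      qed
      have "s ^ (z - Suc m) \<le> t ^ (z - Suc m)" using s by (intro power_mono) auto
      then have "s ^ z * (1 / s) ^ Suc m - t ^ z * (1 / t) ^ Suc m \<le> 0"
        unfolding q[OF s(1)] q[OF t] by simp
      moreover have "(0 :: real) \<le> (1 / s) ^ Suc (m - z) - (1 / t) ^ Suc (m - z)"
        using power_mono[of "1 / t" "1 / s" "Suc (m - z)"] frac_le[of 1 1 s t] s t by (simp del: power_Suc)
      ultimately show ?thesis by auto
    qed
  qed
  finally show ?thesis .
qed

context attachment_model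
begin

lemma normalized_expectation_le:
  assumes A: "adapted m A" "\<And>\<omega>. 0 \<le> A \<omega>" and d: "\<And>i. drift p k G i \<le> a * G i" and a: "0 \<le> a"
    and m: "max 1 k \<le> m" and n: "m \<le> n"
  shows "expectation (\<lambda>\<omega>. A \<omega> * wpop G k n \<omega>) / growth a n \<le> expectation (\<lambda>\<omega>. A \<omega> * wpop G k m \<omega>) / growth a m"
  using n
proof (induction n rule: dec_induct)
  case (step n)
  let ?e = "\<lambda>n. expectation (\<lambda>\<omega>. A \<omega> * wpop G k n \<omega>)"
  have "?e (Suc n) \<le> ?e n + expectation (\<lambda>\<omega>. A \<omega> * wpop (\<lambda>i. a * G i) k n \<omega>) / real (Suc n)"
    using m step d by (intro expected_step_le adapted_mono[OF A(1)] A) auto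
  also have "expectation (\<lambda>\<omega>. A \<omega> * wpop (\<lambda>i. a * G i) k n \<omega>) = a * ?e n"
    unfolding wpop_scale by (simp add: mult.left_commute)
  finally have "?e (Suc n) \<le> (1 + a / real (Suc n)) * ?e n" by (simp add: algebra_simps)
  then have "?e (Suc n) / growth a (Suc n) \<le> (1 + a / real (Suc n)) * ?e n / growth a (Suc n)"
    using growth_pos[OF a] by (intro divide_right_mono) (auto intro: less_imp_le)
  also have "\<dots> = ?e n / growth a n"
    unfolding growth_Suc using a add_pos_nonneg[of 1 "a / real (Suc n)"] by simp
  finally show ?case using step.IH by linarith
qed simp

lemma normalized_expectation_ge:
  assumes d: "\<And>i. a * G i \<le> drift p k G i" and a: "0 \<le> a" and m: "max 1 k \<le> m" and n: "m \<le> n"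
  shows "expectation (wpop G k m) / growth a m \<le> expectation (wpop G k n) / growth a n"
  using n
proof (induction n rule: dec_induct)
  case (step n)
  let ?e = "\<lambda>n. expectation (wpop G k n)"
  have "?e n + a * ?e n / real (Suc n) \<le> ?e (Suc n)"
    using expected_step_ge[of n "\<lambda>_. 1" k "\<lambda>i. a * G i" G] m step d by (simp add: wpop_scale)
  then have "(1 + a / real (Suc n)) * ?e n \<le> ?e (Suc n)" by (simp add: algebra_simps)
  then have "(1 + a / real (Suc n)) * ?e n / growth a (Suc n) \<le> ?e (Suc n) / growth a (Suc n)"
    using growth_pos[OF a] by (intro divide_right_mono) (auto intro: less_imp_le)
  moreover have "(1 + a / real (Suc n)) * ?e n / growth a (Suc n) = ?e n / growth a n"
    unfolding growth_Suc using a add_pos_nonneg[of 1 "a / real (Suc n)"] by simp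
  ultimately show ?case using step.IH by linarith
qed simp

text \<open>
  The product of two increments is at most one of them, because weights are at most 1. Its expected
  contribution, divided by the normalisation, telescopes against \<open>1 / growth\<close>.
\<close>

lemma normalized_product_antimono:
  assumes G1: "\<And>i. 0 \<le> G1 i" "\<And>i. G1 i \<le> 1" "\<And>i. drift p k G1 i \<le> a1 * G1 i" "0 < a1"
    and G2: "\<And>i. 0 \<le> G2 i" "\<And>i. drift p k G2 i \<le> a2 * G2 i" "0 \<le> a2"
  shows "\<exists>D\<ge>0. \<forall>m n. max 1 k \<le> m \<longrightarrow> m \<le> n \<longrightarrow>
      expectation (\<lambda>\<omega>. wpop G1 k n \<omega> * wpop G2 k n \<omega>) / (growth a1 n * growth a2 n) + D / growth a1 n
      \<le> expectation (\<lambda>\<omega>. wpop G1 k m \<omega> * wpop G2 k m \<omega>) / (growth a1 m * growth a2 m) + D / growth a1 m"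
proof -
  let ?N = "max 1 k"
  define t where "t n = expectation (\<lambda>\<omega>. wpop G1 k n \<omega> * wpop G2 k n \<omega>)" for n
  define x2 where "x2 n = expectation (wpop G2 k n)" for n
  define C where "C = x2 ?N / growth a2 ?N"
  define D where "D = a2 * C / a1"
  have g1: "0 < growth a1 n" and g2: "0 < growth a2 n" for n using G1(4) G2(3) growth_pos by auto
  have C0: "0 \<le> C" unfolding C_def x2_def using g2[of ?N] G2(1)
    by (intro divide_nonneg_pos Bochner_Integration.integral_nonneg wpop_nonneg) auto
  have D0: "0 \<le> D" unfolding D_def using C0 G1(4) G2(3) by simp
  have x2_le: "x2 n \<le> C * growth a2 n" if "?N \<le> n" for n
    using normalized_expectation_le[of ?N "\<lambda>_. 1" k G2 a2 n] G2 that g2[of n]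
    by (simp add: C_def x2_def pos_divide_le_eq)
  have antimono_step: "t (Suc n) / (growth a1 (Suc n) * growth a2 (Suc n)) + D / growth a1 (Suc n)
      \<le> t n / (growth a1 n * growth a2 n) + D / growth a1 n" if n: "?N \<le> n" for n
  proof -
    have n': "1 \<le> n" "k \<le> n" using n by auto
    define S where "S = real (Suc n)"
    have S: "0 < S" unfolding S_def by simp
    have i: "integrable M (\<lambda>\<omega>. wpop G k i \<omega> * wpop H k j \<omega>)" if "i \<le> Suc n" "j \<le> Suc n" for G H i j
      using that by (intro integrable_adapted[of "Suc n"] adapted_map2[where f = "(*)"] adapted_wpop)
    have "t (Suc n) \<le> expectation (\<lambda>\<omega>. (wpop G1 k n \<omega> * wpop G2 k (Suc n) \<omega> + wpop G2 k n \<omega> * wpop G1 k (Suc n) \<omega>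
        - wpop G1 k n \<omega> * wpop G2 k n \<omega>) + (wpop G2 k (Suc n) \<omega> - wpop G2 k n \<omega>))"
      unfolding t_def
    proof (rule integral_mono)
      fix \<omega>
      define w1 where "w1 = weight (state (Suc n) \<omega>) k G1 (Suc n)"
      define w2 where "w2 = weight (state (Suc n) \<omega>) k G2 (Suc n)"
      have "w1 * w2 \<le> 1 * w2" unfolding w1_def w2_def
        using G1 G2 by (intro mult_right_mono) (auto simp: weight_def)
      then show "wpop G1 k (Suc n) \<omega> * wpop G2 k (Suc n) \<omega>
          \<le> (wpop G1 k n \<omega> * wpop G2 k (Suc n) \<omega> + wpop G2 k n \<omega> * wpop G1 k (Suc n) \<omega>
            - wpop G1 k n \<omega> * wpop G2 k n \<omega>) + (wpop G2 k (Suc n) \<omega> - wpop G2 k n \<omega>)"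
        unfolding wpop_Suc_weight w1_def[symmetric] w2_def[symmetric] by (simp add: algebra_simps)
    next
      show "integrable M (\<lambda>\<omega>. wpop G1 k (Suc n) \<omega> * wpop G2 k (Suc n) \<omega>)"
        using i[of "Suc n" "Suc n" G1 G2] by simp
      show "integrable M (\<lambda>\<omega>. (wpop G1 k n \<omega> * wpop G2 k (Suc n) \<omega> + wpop G2 k n \<omega> * wpop G1 k (Suc n) \<omega>
        - wpop G1 k n \<omega> * wpop G2 k n \<omega>) + (wpop G2 k (Suc n) \<omega> - wpop G2 k n \<omega>))"
        using i[of n "Suc n" G1 G2] i[of n "Suc n" G2 G1] i[of n n G1 G2]
          integrable_wpop[of G2 k "Suc n"] integrable_wpop[of G2 k n]
        by (intro Bochner_Integration.integrable_add Bochner_Integration.integrable_diff) auto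
    qed
    also have "\<dots> = expectation (\<lambda>\<omega>. wpop G1 k n \<omega> * wpop G2 k (Suc n) \<omega>)
        + expectation (\<lambda>\<omega>. wpop G2 k n \<omega> * wpop G1 k (Suc n) \<omega>) - t n + (x2 (Suc n) - x2 n)"
      using i[of n "Suc n" G1 G2] i[of n "Suc n" G2 G1] i[of n n G1 G2] integrable_wpop[of G2 k]
      by (simp add: t_def x2_def)
    also have "\<dots> \<le> (t n + a2 * t n / S) + (t n + a1 * t n / S) - t n + a2 * x2 n / S"
    proof -
      have e1: "expectation (\<lambda>\<omega>. wpop G1 k n \<omega> * wpop G2 k (Suc n) \<omega>) \<le> t n + a2 * t n / S"
        using expected_step_le[of n "wpop G1 k n" k G2 "\<lambda>i. a2 * G2 i"] n' G2 G1 wpop_nonneg[of G1]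
          adapted_wpop[of n n]
        unfolding wpop_scale by (simp add: mult.left_commute t_def S_def)
      have e2: "expectation (\<lambda>\<omega>. wpop G2 k n \<omega> * wpop G1 k (Suc n) \<omega>) \<le> t n + a1 * t n / S"
      proof -
        have "(\<lambda>\<omega>. wpop G2 k n \<omega> * wpop G1 k n \<omega>) = (\<lambda>\<omega>. wpop G1 k n \<omega> * wpop G2 k n \<omega>)"
          "(\<lambda>\<omega>. wpop G2 k n \<omega> * (a1 * wpop G1 k n \<omega>)) = (\<lambda>\<omega>. a1 * (wpop G1 k n \<omega> * wpop G2 k n \<omega>))"
          by (auto simp: fun_eq_iff)
        then show ?thesis
          using expected_step_le[of n "wpop G2 k n" k G1 "\<lambda>i. a1 * G1 i"] n' G2 G1 wpop_nonneg[of G2]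
            adapted_wpop[of n n]
          unfolding wpop_scale by (simp add: t_def S_def)
      qed
      have e3: "x2 (Suc n) \<le> x2 n + a2 * x2 n / S"
        using expected_step_le[of n "\<lambda>_. 1" k G2 "\<lambda>i. a2 * G2 i"] n' G2
        unfolding wpop_scale by (simp add: x2_def S_def)
      show ?thesis using e1 e2 e3 by linarith
    qed
    also have "\<dots> = (1 + (a1 + a2) / S) * t n + a2 / S * x2 n" using S by (simp add: field_simps)
    also have "\<dots> \<le> (1 + a1 / S) * (1 + a2 / S) * t n + a2 / S * (C * growth a2 (Suc n))"
    proof (intro add_mono mult_right_mono mult_left_mono)
      have "(1 + a1 / S) * (1 + a2 / S) = 1 + (a1 + a2) / S + a1 / S * (a2 / S)"
        by (simp add: algebra_simps add_divide_distrib)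
      moreover have "0 \<le> a1 / S * (a2 / S)" using G1(4) G2(3) S by simp
      ultimately show "1 + (a1 + a2) / S \<le> (1 + a1 / S) * (1 + a2 / S)" by linarith
      show "0 \<le> t n" unfolding t_def using G1 G2 wpop_nonneg by (intro Bochner_Integration.integral_nonneg) auto
      have "x2 n \<le> C * growth a2 n" by (rule x2_le[OF n])
      also have "\<dots> \<le> C * growth a2 (Suc n)" using C0 G2(3) by (intro mult_left_mono growth_le_Suc)
      finally show "x2 n \<le> C * growth a2 (Suc n)" .
    qed (use G2(3) S in simp)
    finally have "t (Suc n) / (growth a1 (Suc n) * growth a2 (Suc n))
        \<le> ((1 + a1 / S) * (1 + a2 / S) * t n + a2 / S * (C * growth a2 (Suc n))) / (growth a1 (Suc n) * growth a2 (Suc n))"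
      using g1[of "Suc n"] g2[of "Suc n"] by (intro divide_right_mono) auto
    also have "\<dots> = (1 + a1 / S) * (1 + a2 / S) * t n / (growth a1 (Suc n) * growth a2 (Suc n))
        + a2 / S * C / growth a1 (Suc n)"
      using g2[of "Suc n"] by (simp add: add_divide_distrib)
    also have "(1 + a1 / S) * (1 + a2 / S) * t n / (growth a1 (Suc n) * growth a2 (Suc n))
        = t n / (growth a1 n * growth a2 n)"
    proof -
      have "0 < 1 + a1 / S" "0 < 1 + a2 / S" using G1(4) G2(3) S by (auto intro: add_pos_nonneg)
      then show ?thesis unfolding growth_Suc S_def[symmetric]
        using mult_divide_mult_cancel_left[of "(1 + a1 / S) * (1 + a2 / S)" "t n" "growth a1 n * growth a2 n"]
        by (simp add: mult_ac)
    qed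
    also have "a2 / S * C / growth a1 (Suc n) = D * (a1 / S / growth a1 (Suc n))"
      unfolding D_def using G1(4) by simp
    also have "a1 / S / growth a1 (Suc n) = 1 / growth a1 n - 1 / growth a1 (Suc n)"
      using growth_telescope[of a1 n] G1(4) by (simp add: S_def)
    finally show ?thesis by (simp add: algebra_simps)
  qed
  show ?thesis
  proof (intro exI[of _ D] conjI D0 allI impI)
    fix m n assume m: "?N \<le> m" and n: "m \<le> n"
    show "expectation (\<lambda>\<omega>. wpop G1 k n \<omega> * wpop G2 k n \<omega>) / (growth a1 n * growth a2 n) + D / growth a1 n
      \<le> expectation (\<lambda>\<omega>. wpop G1 k m \<omega> * wpop G2 k m \<omega>) / (growth a1 m * growth a2 m) + D / growth a1 m"
      using n unfolding t_def[symmetric]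
    proof (induction n rule: dec_induct)
      case (step n)
      have "?N \<le> n" by (rule order_trans[OF m step(1)])
      then show ?case by (rule order_trans[OF antimono_step step.IH])
    qed (rule order_refl)
  qed
qed

end

text \<open>
  Mean square increments of polynomial decay: along \<open>i ^ r\<close> with \<open>r\<close> large they are summable even after
  multiplication by \<open>i\<^sup>2\<close>, which makes the increments themselves almost surely summable.
\<close>

lemma (in prob_space) AE_convergent_along_powers:
  fixes x :: "nat \<Rightarrow> 'a \<Rightarrow> real"
  assumes i: "\<And>m n. integrable M (\<lambda>\<omega>. (x n \<omega> - x m \<omega>)\<^sup>2)"
    and C: "\<And>m n. N \<le> m \<Longrightarrow> m \<le> n \<Longrightarrow> expectation (\<lambda>\<omega>. (x n \<omega> - x m \<omega>)\<^sup>2) \<le> C * real m powr (- \<eta>)"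
    and \<eta>: "0 < \<eta>"
  shows "\<exists>r\<ge>1. AE \<omega> in M. convergent (\<lambda>i. x (i ^ r) \<omega>)"
proof -
  obtain r :: nat where r: "4 / \<eta> < real r" using reals_Archimedean2 by blast
  have "0 < 4 / \<eta>" using \<eta> by simp
  then have "0 < real r" using r by linarith
  then have r1: "1 \<le> r" by simp
  have r4: "4 \<le> real r * \<eta>" using r \<eta> by (simp add: pos_divide_less_eq)
  define f where "f i \<omega> = (real i)\<^sup>2 * (x (Suc i ^ r) \<omega> - x (i ^ r) \<omega>)\<^sup>2" for i \<omega>
  have "AE \<omega> in M. summable (\<lambda>i. f i \<omega>)"
  proof (rule AE_summable_of_summable_expectation)
    show "summable (\<lambda>i. expectation (f i))"
    proof (rule summable_comparison_test'[where N = "max 1 N"])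
      show "summable (\<lambda>i. \<bar>C\<bar> * real i powr (- 2))" by (intro summable_mult) (simp add: summable_real_powr_iff)
      fix n assume n: "max 1 N \<le> n"
      have "n ^ 1 \<le> n ^ r" using n r1 by (intro power_increasing) auto
      then have Nn: "N \<le> n ^ r" using n by simp
      have "expectation (f n) = (real n)\<^sup>2 * expectation (\<lambda>\<omega>. (x (Suc n ^ r) \<omega> - x (n ^ r) \<omega>)\<^sup>2)"
        unfolding f_def by simp
      also have "\<dots> \<le> (real n)\<^sup>2 * (C * real (n ^ r) powr (- \<eta>))"
        by (intro mult_left_mono C[OF Nn] power_mono) auto
      also have "real (n ^ r) powr (- \<eta>) = real n powr (- (real r * \<eta>))"
        using n by (simp add: powr_realpow[symmetric] powr_powr)
      also have "(real n)\<^sup>2 * (C * real n powr (- (real r * \<eta>))) \<le> (real n)\<^sup>2 * (\<bar>C\<bar> * real n powr (- 4))"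
        using n r4 by (intro mult_left_mono mult_mono powr_mono) auto
      also have "\<dots> = \<bar>C\<bar> * (real n powr 2 * real n powr (- 4))"
        using n by simp
      also have "real n powr 2 * real n powr (- 4) = real n powr (2 + - 4)" by (rule powr_add[symmetric])
      also have "(2 + - 4 :: real) = - 2" by simp
      finally have "expectation (f n) \<le> \<bar>C\<bar> * real n powr (- 2)" .
      moreover have "0 \<le> expectation (f n)"
        unfolding f_def by (intro Bochner_Integration.integral_nonneg) simp
      ultimately show "norm (expectation (f n)) \<le> \<bar>C\<bar> * real n powr (- 2)" by simp
    qed
  qed (auto simp: f_def intro: i)
  then have "AE \<omega> in M. convergent (\<lambda>i. x (i ^ r) \<omega>)"
  proof eventually_elim
    case (elim \<omega>)
    have "summable (\<lambda>i. x (Suc i ^ r) \<omega> - x (i ^ r) \<omega>)"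
    proof (rule summable_comparison_test'[where N = 1])
      show "summable (\<lambda>i. real i powr (- 2) + f i \<omega>)"
        by (intro summable_add elim) (simp add: summable_real_powr_iff)
      fix n :: nat assume n: "1 \<le> n"
      define d where "d = x (Suc n ^ r) \<omega> - x (n ^ r) \<omega>"
      \<comment> \<open>the inequality between arithmetic and geometric mean for \<open>1 / n\<close> and \<open>n \<bar>d\<bar>\<close>\<close>
      have "0 \<le> (1 / real n - real n * \<bar>d\<bar>)\<^sup>2" by simp
      also have "\<dots> = (1 / real n)\<^sup>2 + f n \<omega> - 2 * \<bar>d\<bar>"
        using n unfolding f_def d_def[symmetric] by (simp add: power2_diff power_mult_distrib)
      also have "(1 / real n)\<^sup>2 = real n powr (- 2)"
        using n by (simp add: powr_minus power_one_over inverse_eq_divide)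
      finally show "norm (x (Suc n ^ r) \<omega> - x (n ^ r) \<omega>) \<le> real n powr (- 2) + f n \<omega>"
        unfolding real_norm_def d_def[symmetric] using abs_ge_zero[of d] by linarith
    qed
    then have "(\<lambda>n. (\<Sum>i<n. x (Suc i ^ r) \<omega> - x (i ^ r) \<omega>)) \<longlonglongrightarrow> (\<Sum>i. x (Suc i ^ r) \<omega> - x (i ^ r) \<omega>)"
      by (rule summable_LIMSEQ)
    then have "(\<lambda>n. (x (n ^ r) \<omega> - x (0 ^ r) \<omega>) + x (0 ^ r) \<omega>)
        \<longlonglongrightarrow> (\<Sum>i. x (Suc i ^ r) \<omega> - x (i ^ r) \<omega>) + x (0 ^ r) \<omega>"
      unfolding sum_lessThan_telescope[of "\<lambda>i. x (i ^ r) \<omega>"] by (intro tendsto_intros)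
    then show ?case by (auto simp: convergent_def)
  qed
  then show ?thesis using r1 by blast
qed

text \<open>
  Bounded second moments give uniform integrability, so means bounded away from 0 cannot disappear in
  an almost sure limit.
\<close>

lemma (in prob_space) not_AE_tendsto_0_of_L2_bounded:
  fixes x :: "nat \<Rightarrow> 'a \<Rightarrow> real"
  assumes i: "\<And>n. integrable M (x n)" "\<And>n. integrable M (\<lambda>\<omega>. (x n \<omega>)\<^sup>2)" and x0: "\<And>n \<omega>. 0 \<le> x n \<omega>"
    and \<kappa>0: "0 < \<kappa>" and Ex: "\<And>n. N \<le> n \<Longrightarrow> \<kappa> \<le> expectation (x n)"
    and Q: "\<And>n. N \<le> n \<Longrightarrow> expectation (\<lambda>\<omega>. (x n \<omega>)\<^sup>2) \<le> Q"
  shows "\<not> (AE \<omega> in M. (\<lambda>n. x n \<omega>) \<longlonglongrightarrow> 0)"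
proof
  assume x_lim: "AE \<omega> in M. (\<lambda>n. x n \<omega>) \<longlonglongrightarrow> 0"
  have "0 \<le> expectation (\<lambda>\<omega>. (x N \<omega>)\<^sup>2)" by simp
  then have Q0: "0 \<le> Q" using Q[of N] by linarith
  \<comment> \<open>the part of the mean above this level is at most \<open>Q / K < \<kappa> / 2\<close>\<close>
  define K where "K = 2 * Q / \<kappa> + 1"
  have K: "0 < K" unfolding K_def using Q0 \<kappa>0 by (intro add_nonneg_pos) auto
  have QK: "Q / K < \<kappa> / 2"
  proof -
    have "2 * Q < \<kappa> * K" unfolding K_def using \<kappa>0 by (simp add: distrib_left)
    then show ?thesis using K by (simp add: pos_divide_less_eq mult.commute)
  qed
  have imin: "integrable M (\<lambda>\<omega>. min (x n \<omega>) K)" for n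
    using i(1) by (intro integrable_min) auto
  have "(\<lambda>n. expectation (\<lambda>\<omega>. min (x n \<omega>) K)) \<longlonglongrightarrow> expectation (\<lambda>_. 0)"
  proof (rule integral_dominated_convergence[where w = "\<lambda>_. K"])
    show "AE \<omega> in M. (\<lambda>n. min (x n \<omega>) K) \<longlonglongrightarrow> 0"
      using x_lim
    proof eventually_elim
      case (elim \<omega>)
      then show ?case using tendsto_min[OF elim tendsto_const[of K]] K by simp
    qed
    show "(\<lambda>\<omega>. min (x n \<omega>) K) \<in> borel_measurable M" for n
      by (rule borel_measurable_integrable[OF imin])
    show "AE \<omega> in M. norm (min (x n \<omega>) K) \<le> K" for n using x0 K by (auto simp: min_def)
  qed auto
  then have "\<forall>\<^sub>F n in sequentially. expectation (\<lambda>\<omega>. min (x n \<omega>) K) < \<kappa> / 2"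
    using \<kappa>0 by (intro order_tendstoD(2)) auto
  then have "\<forall>\<^sub>F n in sequentially. False"
    using eventually_ge_at_top[of N]
  proof eventually_elim
    case (elim n)
    have "x n \<omega> \<le> min (x n \<omega>) K + (x n \<omega>)\<^sup>2 / K" for \<omega>
    proof (cases "x n \<omega> \<le> K")
      case False
      then have "x n \<omega> * K \<le> (x n \<omega>)\<^sup>2" unfolding power2_eq_square using x0 by (intro mult_left_mono) auto
      then have "x n \<omega> \<le> (x n \<omega>)\<^sup>2 / K" using K by (simp add: pos_le_divide_eq)
      then show ?thesis using False K by simp
    qed (use K in simp)
    then have "expectation (x n) \<le> expectation (\<lambda>\<omega>. min (x n \<omega>) K + (x n \<omega>)\<^sup>2 / K)"
      by (intro integral_mono i Bochner_Integration.integrable_add imin integrable_divide) auto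
    also have "\<dots> = expectation (\<lambda>\<omega>. min (x n \<omega>) K) + expectation (\<lambda>\<omega>. (x n \<omega>)\<^sup>2) / K"
      using imin i(2) by simp
    also have "\<dots> \<le> expectation (\<lambda>\<omega>. min (x n \<omega>) K) + Q / K"
      using Q[of n] elim K by (intro add_left_mono divide_right_mono) auto
    finally show False using Ex[of n] elim QK by linarith
  qed
  then show False by simp
qed

context attachment_model
begin

text \<open>
  Weights that are almost eigenvectors, with an error of smaller growth rate, give normalised
  populations that are Cauchy in mean square. The second moments are almost nonincreasing, and the
  correlation with an earlier time is almost preserved: the loss is the accumulated error,
  proportional to the ratio of the two growth rates.
\<close>

lemma normalized_wpop_L2_Cauchy:
  assumes G: "\<And>i. 0 \<le> G i" "\<And>i. G i \<le> 1" "\<And>i. drift p k G i \<le> a * G i"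
    and H: "\<And>i. 0 \<le> H i" "\<And>i. drift p k H i \<le> b * H i"
    and low: "\<And>i. a * G i - b * H i \<le> drift p k G i" and ab: "0 < b" "b < a"
  shows "\<exists>C. \<forall>m n. max 1 k \<le> m \<longrightarrow> m \<le> n \<longrightarrow>
    expectation (\<lambda>\<omega>. (wpop G k n \<omega> / growth a n - wpop G k m \<omega> / growth a m)\<^sup>2) \<le> C * real m powr (- (a - b))"
proof -
  let ?N = "max 1 k"
  have a: "0 < a" using ab by simp
  define g where "g = growth a"
  define h where "h = growth b"
  have g: "0 < g n" and h: "0 < h n" for n unfolding g_def h_def using growth_pos a ab by auto
  define q where "q n = expectation (\<lambda>\<omega>. wpop G k n \<omega> * wpop G k n \<omega>)" for n
  define t where "t n = expectation (\<lambda>\<omega>. wpop G k n \<omega> * wpop H k n \<omega>)" for n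
  obtain D where D0: "0 \<le> D" and D1: "\<forall>m n. ?N \<le> m \<longrightarrow> m \<le> n \<longrightarrow>
      q n / (g n * g n) + D / g n \<le> q m / (g m * g m) + D / g m"
    using normalized_product_antimono[OF G a G(1,3) less_imp_le[OF a]] unfolding q_def g_def by blast
  note D = D0 D1[rule_format]
  obtain E where E0: "0 \<le> E" and E1: "\<forall>m n. ?N \<le> m \<longrightarrow> m \<le> n \<longrightarrow>
      t n / (g n * h n) + E / g n \<le> t m / (g m * h m) + E / g m"
    using normalized_product_antimono[OF G a H less_imp_le[OF ab(1)]] unfolding t_def g_def h_def by blast
  note E = E0 E1[rule_format]
  define T where "T = t ?N / (g ?N * h ?N) + E / g ?N"
  have tT: "t m / h m \<le> T * g m" if "?N \<le> m" for m
  proof -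
    have "t m / (g m * h m) + E / g m \<le> T" unfolding T_def by (rule E(2)) (use that in auto)
    moreover have "0 \<le> E / g m" using E(1) g[of m] by simp
    ultimately have "t m / (g m * h m) * g m \<le> T * g m" using g[of m] by (intro mult_right_mono) auto
    then show ?thesis using g[of m] by simp
  qed
  have T0: "0 \<le> T"
    unfolding T_def t_def using G H E(1) g h wpop_nonneg
    by (intro add_nonneg_nonneg divide_nonneg_pos Bochner_Integration.integral_nonneg mult_pos_pos) auto
  define c where "c = b / (a - b) * T"
  have c0: "0 \<le> c" unfolding c_def using T0 ab by simp
  have i: "integrable M (\<lambda>\<omega>. wpop F k m \<omega> * wpop F' k n \<omega>)" for F F' m n
    by (intro integrable_adapted[of "max m n"] adapted_map2[where f = "(*)"] adapted_wpop) auto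
  have corr: "q m / g m - c * g m * (h m / g m - h n / g n)
      \<le> expectation (\<lambda>\<omega>. wpop G k m \<omega> * wpop G k n \<omega>) / g n" if m: "?N \<le> m" and n: "m \<le> n" for m n
    using n
  proof (induction n rule: dec_induct)
    case base
    then show ?case by (simp add: q_def)
  next
    case (step n)
    define r where "r n = expectation (\<lambda>\<omega>. wpop G k m \<omega> * wpop G k n \<omega>)" for n
    define e where "e = expectation (\<lambda>\<omega>. wpop G k m \<omega> * wpop H k n \<omega>)"
    define S where "S = real (Suc n)"
    have S: "0 < S" unfolding S_def by simp
    have n': "1 \<le> n" "k \<le> n" using m step by auto
    have ad: "adapted n (wpop G k m)" using step by (intro adapted_wpop) auto
    have "e / h n \<le> t m / h m" unfolding e_def t_def h_def
      using ab step by (intro normalized_expectation_le adapted_wpop wpop_nonneg G H m) auto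
    then have "e / h n \<le> T * g m" using tT[OF m] by linarith
    then have e: "e \<le> T * g m * h n" using h[of n] by (simp add: pos_divide_le_eq)
    have "expectation (\<lambda>\<omega>. wpop G k m \<omega> * wpop (\<lambda>i. a * G i - b * H i) k n \<omega>) = a * r n - b * e"
    proof -
      have "(\<lambda>\<omega>. wpop G k m \<omega> * wpop (\<lambda>i. a * G i - b * H i) k n \<omega>)
          = (\<lambda>\<omega>. a * (wpop G k m \<omega> * wpop G k n \<omega>) - b * (wpop G k m \<omega> * wpop H k n \<omega>))"
        unfolding wpop_diff wpop_scale by (simp add: fun_eq_iff algebra_simps)
      then show ?thesis using i[of G m G n] i[of G m H n] by (simp add: r_def e_def)
    qed
    then have "r n + (a * r n - b * e) / S \<le> r (Suc n)"
      using expected_step_ge[OF ad wpop_nonneg[OF G(1)] n' low] unfolding r_def S_def by simp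
    moreover have "b * e / S \<le> b * (T * g m * h n) / S"
      using e ab S by (intro divide_right_mono mult_left_mono) auto
    moreover have "r n + (a * r n - b * e) / S = (1 + a / S) * r n - b * e / S"
      by (simp add: diff_divide_distrib algebra_simps)
    ultimately have "(1 + a / S) * r n - b * (T * g m * h n) / S \<le> r (Suc n)" by linarith
    then have "((1 + a / S) * r n - b * (T * g m * h n) / S) / g (Suc n) \<le> r (Suc n) / g (Suc n)"
      using g[of "Suc n"] by (intro divide_right_mono) auto
    moreover have "((1 + a / S) * r n - b * (T * g m * h n) / S) / g (Suc n)
        = r n / g n - b * (T * g m * h n) / S / g (Suc n)"
    proof -
      have "0 < 1 + a / S" using a S by (intro add_pos_nonneg) auto
      then have "(1 + a / S) * r n / g (Suc n) = r n / g n"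
        unfolding g_def growth_Suc S_def by simp
      then show ?thesis by (simp add: diff_divide_distrib)
    qed
    moreover have "b * (T * g m * h n) / S / g (Suc n) = c * g m * (h n / g n - h (Suc n) / g (Suc n))"
    proof -
      have *: "h n / g n - h (Suc n) / g (Suc n) = (a - b) / S * h n / g (Suc n)"
        unfolding h_def g_def S_def using a ab by (intro growth_ratio_telescope) auto
      have "b * (T * g m * h n) / S / g (Suc n) = (b * T) * (g m * h n / S / g (Suc n))" by simp
      also have "b * T = c * (a - b)" unfolding c_def using ab by simp
      also have "c * (a - b) * (g m * h n / S / g (Suc n)) = c * g m * ((a - b) / S * h n / g (Suc n))" by simp
      finally show ?thesis unfolding * .
    qed
    moreover have "c * g m * (h m / g m - h (Suc n) / g (Suc n))
        = c * g m * (h m / g m - h n / g n) + c * g m * (h n / g n - h (Suc n) / g (Suc n))"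
      by (simp add: algebra_simps)
    ultimately show ?case using step.IH unfolding r_def[symmetric] by linarith
  qed
  have L2: "expectation (\<lambda>\<omega>. (wpop G k n \<omega> / g n - wpop G k m \<omega> / g m)\<^sup>2) \<le> D / g m + 2 * c * (h m / g m)"
    if m: "?N \<le> m" and n: "m \<le> n" for m n
  proof -
    define r where "r = expectation (\<lambda>\<omega>. wpop G k m \<omega> * wpop G k n \<omega>)"
    have "expectation (\<lambda>\<omega>. (wpop G k n \<omega> / g n - wpop G k m \<omega> / g m)\<^sup>2)
        = expectation (\<lambda>\<omega>. 1 / (g n * g n) * (wpop G k n \<omega> * wpop G k n \<omega>)
            - 2 / (g n * g m) * (wpop G k m \<omega> * wpop G k n \<omega>)
            + 1 / (g m * g m) * (wpop G k m \<omega> * wpop G k m \<omega>))"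
      by (intro Bochner_Integration.integral_cong refl) (simp add: power2_eq_square algebra_simps)
    also have "\<dots> = 1 / (g n * g n) * q n - 2 / (g n * g m) * r + 1 / (g m * g m) * q m"
      using i[of G n G n] i[of G m G n] i[of G m G m] unfolding q_def r_def
      by (simp del: times_divide_eq_left mult_eq_0_iff)
    also have "\<dots> = q n / (g n * g n) - 2 * (r / g n / g m) + q m / (g m * g m)" by simp
    also have "\<dots> \<le> (q m / (g m * g m) + D / g m) - 2 * (q m / (g m * g m) - c * (h m / g m)) + q m / (g m * g m)"
    proof -
      have "q n / (g n * g n) \<le> q m / (g m * g m) + D / g m"
        using D(2)[OF m n] D(1) g[of n] divide_nonneg_pos[of D "g n"] by linarith
      moreover have "q m / (g m * g m) - c * (h m / g m) \<le> r / g n / g m"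
      proof -
        have "0 \<le> c * g m * (h n / g n)" using c0 g[of m] g[of n] h[of n] by simp
        moreover have "q m / g m - c * g m * (h m / g m - h n / g n) \<le> r / g n"
          unfolding r_def by (rule corr[OF m n])
        moreover have "c * g m * (h m / g m - h n / g n) = c * g m * (h m / g m) - c * g m * (h n / g n)"
          by (simp add: right_diff_distrib)
        ultimately have "q m / g m - c * g m * (h m / g m) \<le> r / g n" by linarith
        then have "(q m / g m - c * g m * (h m / g m)) / g m \<le> r / g n / g m"
          using g[of m] by (intro divide_right_mono) auto
        moreover have "(q m / g m - c * g m * (h m / g m)) / g m = q m / (g m * g m) - c * (h m / g m)"
          using g[of m] by (simp add: diff_divide_distrib)
        ultimately show ?thesis by simp
      qed
      ultimately show ?thesis by (intro add_right_mono diff_mono mult_left_mono) auto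
    qed
    finally show ?thesis by simp
  qed
  obtain \<beta> where \<beta>: "0 < \<beta>" "\<And>n. 1 \<le> n \<Longrightarrow> \<beta> * real n powr a \<le> g n"
    using growth_asymptotics[OF a] unfolding g_def by blast
  have hb: "h n \<le> (1 + b) * real n powr b" if "1 \<le> n" for n
    using growth_asymptotics[OF ab(1)] that unfolding h_def by blast
  show ?thesis
  proof (intro exI[of _ "D / \<beta> + 2 * c * ((1 + b) / \<beta>)"] allI impI, unfold g_def[symmetric])
    fix m n assume m: "?N \<le> m" and n: "m \<le> n"
    then have m1: "1 \<le> m" by simp
    have b0: "0 < \<beta> * real m powr a" using \<beta>(1) m1 by simp
    have "D / g m \<le> D / (\<beta> * real m powr a)"
      using \<beta>(2)[OF m1] b0 D(1) by (intro divide_left_mono) (auto intro: mult_pos_pos g)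
    also have "\<dots> = D / \<beta> * real m powr (- a)" by (simp add: powr_minus divide_inverse)
    also have "\<dots> \<le> D / \<beta> * real m powr (- (a - b))"
      using D(1) \<beta>(1) ab m1 by (intro mult_left_mono powr_mono) auto
    finally have 1: "D / g m \<le> D / \<beta> * real m powr (- (a - b))" .
    have "h m / g m \<le> ((1 + b) * real m powr b) / (\<beta> * real m powr a)"
      using hb[OF m1] \<beta>(2)[OF m1] b0 ab by (intro frac_le) auto
    also have "\<dots> = (1 + b) / \<beta> * real m powr (- (a - b))"
      using m1 by (simp add: powr_diff powr_minus field_simps)
    finally have "2 * c * (h m / g m) \<le> 2 * c * ((1 + b) / \<beta> * real m powr (- (a - b)))"
      using c0 by (intro mult_left_mono) auto
    with 1 L2[OF m n] show "expectation (\<lambda>\<omega>. (wpop G k n \<omega> / g n - wpop G k m \<omega> / g m)\<^sup>2)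
        \<le> (D / \<beta> + 2 * c * ((1 + b) / \<beta>)) * real m powr (- (a - b))"
      by (simp add: distrib_right mult.assoc)
  qed
qed

end

context branching_attachment
begin

text \<open>
  With \<open>s = 1 / c\<close> below \<open>s0\<close> the weights \<open>c ^ m\<close> grow faster than the error made at the boundary, whose rate
  is that of a larger \<open>t\<close> still below \<open>s0\<close>. This gives convergence. For the limit not to vanish, the
  difference of the two geometric weights bounds the normalised mean from below, and the second moments
  are bounded.
\<close>

lemma pagerank_limit:
  assumes c: "0 < c" "c < 1" "1 / s0 p < c"
  shows "\<exists>W\<in>borel_measurable M. (\<forall>\<omega>\<in>space M. 0 \<le> W \<omega>) \<and> 0 < \<P>(\<omega> in M. 0 < W \<omega>) \<and>
    (AE \<omega> in M. (\<lambda>n. pagerank c (random_tree Z V n \<omega>) k / real n powr (c * gen_fun p (1 / c))) \<longlonglongrightarrow> W \<omega>)"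
proof -
  define s where "s = 1 / c"
  \<comment> \<open>the error at the boundary is measured at a point strictly between \<open>s\<close> and \<open>s0 p\<close>\<close>
  define t where "t = (s + s0 p) / 2"
  define a where "a = gen_fun p s / s"
  define b where "b = gen_fun p t / t"
  have s: "1 < s" "s < s0 p" unfolding s_def using c s0_pos by (auto simp: field_simps)
  have t: "s < t" "t < s0 p" unfolding t_def using s by auto
  have sms: "gf_summable p s" by (rule gf_summable_mono[OF s0_gf_summable]) (use s in auto)
  have smt: "gf_summable p t" by (rule gf_summable_mono[OF s0_gf_summable]) (use s t in auto)
  have a_eq: "a = c * gen_fun p (1 / c)" unfolding a_def s_def by simp
  have ab: "0 < b" "b < a"
    unfolding a_def b_def using gen_fun_pos[OF smt] gen_fun_ratio_strict_antimono[of s t] s t by auto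
  then have a: "0 < a" by simp
  define G where "G m = (1 / s) ^ m" for m
  define H where "H m = (1 / t) ^ m" for m
  have Gc: "G = (\<lambda>m. c ^ m)" unfolding G_def s_def by simp
  have G: "0 \<le> G m" "G m \<le> 1" for m unfolding Gc using c by (auto intro: power_le_one)
  have H: "0 \<le> H m" for m unfolding H_def using s t by simp
  have HG: "H m \<le> G m" for m unfolding H_def G_def using s t by (intro power_mono frac_le) auto
  have dG: "drift p k G m \<le> a * G m" for m
    unfolding G_def a_def using s by (intro drift_geometric_le sms) auto
  have dH: "drift p k H m \<le> b * H m" for m
    unfolding H_def b_def using s t by (intro drift_geometric_le smt) auto
  have dGH: "a * G m - b * H m \<le> drift p k (\<lambda>m. G m - H m) m" for m
    unfolding G_def H_def a_def b_def using s t by (intro drift_geometric_diff_ge smt) auto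
  have low: "a * G m - b * H m \<le> drift p k G m" for m
    by (rule order_trans[OF dGH drift_mono]) (use H in auto)
  have dGH': "a * (G m - H m) \<le> drift p k (\<lambda>m. G m - H m) m" for m
  proof -
    have "b * H m \<le> a * H m" using ab H by (intro mult_right_mono) auto
    then show ?thesis using dGH[of m] by (simp add: right_diff_distrib)
  qed
  let ?N = "max 1 k"
  define x where "x n \<omega> = wpop G k n \<omega> / growth a n" for n \<omega>
  have g: "0 < growth a n" for n using growth_pos a by simp
  have x0: "0 \<le> x n \<omega>" for n \<omega> unfolding x_def using wpop_nonneg[of G] G g[of n] by simp
  have adx: "adapted (max m n) (\<lambda>\<omega>. F (x n \<omega>) (x m \<omega>))" for m n and F :: "real \<Rightarrow> real \<Rightarrow> real"
    unfolding x_def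
    using adapted_map2[OF adapted_wpop[of n "max m n" G k] adapted_wpop[of m "max m n" G k],
        of "\<lambda>u v. F (u / growth a n) (v / growth a m)"] by simp
  have ix: "integrable M (\<lambda>\<omega>. F (x n \<omega>))" for n and F :: "real \<Rightarrow> real"
    by (rule integrable_adapted[OF adx[of n n "\<lambda>u _. F u"]])
  obtain C where C: "\<And>m n. ?N \<le> m \<Longrightarrow> m \<le> n \<Longrightarrow>
      expectation (\<lambda>\<omega>. (x n \<omega> - x m \<omega>)\<^sup>2) \<le> C * real m powr (- (a - b))"
    using normalized_wpop_L2_Cauchy[OF G dG H dH low ab] unfolding x_def by blast
  have ix2: "integrable M (\<lambda>\<omega>. (x n \<omega> - x m \<omega>)\<^sup>2)" for m n
    by (rule integrable_adapted[OF adx[of m n "\<lambda>u v. (u - v)\<^sup>2"]])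
  have "0 < a - b" using ab by simp
  then obtain r where r: "1 \<le> r" and conv: "AE \<omega> in M. convergent (\<lambda>i. x (i ^ r) \<omega>)"
    using AE_convergent_along_powers[OF ix2 C] by blast
  obtain \<beta> where \<beta>: "0 < \<beta>" "(\<lambda>n. growth a n / real n powr a) \<longlonglongrightarrow> \<beta>"
    using growth_asymptotics[OF a] by blast
  define L where "L \<omega> = lim (\<lambda>n. wpop G k n \<omega> / real n powr a)" for \<omega>
  have AE_L: "AE \<omega> in M. (\<lambda>n. wpop G k n \<omega> / real n powr a) \<longlonglongrightarrow> L \<omega>"
    using conv
  proof eventually_elim
    case (elim \<omega>)
    then obtain l where l: "(\<lambda>i. x (i ^ r) \<omega>) \<longlonglongrightarrow> l" unfolding convergent_def by blast
    have sm: "strict_mono (\<lambda>i :: nat. i ^ r)" using r by (intro strict_monoI power_strict_mono) auto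
    have "(\<lambda>i. growth a (i ^ r) / real (i ^ r) powr a) \<longlonglongrightarrow> \<beta>"
      using LIMSEQ_subseq_LIMSEQ[OF \<beta>(2) sm] unfolding o_def .
    then have "(\<lambda>i. x (i ^ r) \<omega> * (growth a (i ^ r) / real (i ^ r) powr a)) \<longlonglongrightarrow> l * \<beta>"
      by (intro tendsto_mult l)
    moreover have "x (i ^ r) \<omega> * (growth a (i ^ r) / real (i ^ r) powr a)
        = wpop G k (i ^ r) \<omega> / real (i ^ r) powr a" for i
      unfolding x_def using g[of "i ^ r"] by simp
    ultimately have "(\<lambda>i. wpop G k (i ^ r) \<omega> / real (i ^ r) powr a) \<longlonglongrightarrow> l * \<beta>" by (simp only:)
    then have "(\<lambda>n. wpop G k n \<omega> / real n powr a) \<longlonglongrightarrow> l * \<beta>"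
      using a r G by (intro tendsto_between_powers wpop_incseq wpop_nonneg) auto
    then show ?case unfolding L_def by (simp add: limI)
  qed
  define W where "W \<omega> = (1 - c) * max 0 (L \<omega>)" for \<omega>
  have [measurable]: "wpop G k n \<in> borel_measurable M" for n using integrable_wpop by blast
  have [measurable]: "L \<in> borel_measurable M" unfolding L_def by (rule borel_measurable_lim_metric) measurable
  have [measurable]: "W \<in> borel_measurable M" unfolding W_def by measurable
  have AE_W: "AE \<omega> in M. (\<lambda>n. pagerank c (random_tree Z V n \<omega>) k / real n powr a) \<longlonglongrightarrow> W \<omega>"
    using AE_L AE_pagerank[of k c]
  proof eventually_elim
    case (elim \<omega>)
    have "0 \<le> L \<omega>"
      using wpop_nonneg[of G] G by (intro LIMSEQ_le_const[OF elim(1)]) auto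
    then have "max 0 (L \<omega>) = L \<omega>" by simp
    then have "(\<lambda>n. (1 - c) * (wpop G k n \<omega> / real n powr a)) \<longlonglongrightarrow> W \<omega>"
      unfolding W_def using tendsto_mult_left[OF elim(1), of "1 - c"] by (simp only:)
    moreover have "\<forall>\<^sub>F n in sequentially. (1 - c) * (wpop G k n \<omega> / real n powr a)
        = pagerank c (random_tree Z V n \<omega>) k / real n powr a"
      using eventually_ge_at_top[of k] by eventually_elim (use elim(2) in \<open>simp add: Gc\<close>)
    ultimately show ?case by (rule Lim_transform_eventually)
  qed
  have pos: "0 < \<P>(\<omega> in M. 0 < W \<omega>)"
  proof (rule ccontr)
    assume "\<not> ?thesis"
    then have z: "\<P>(\<omega> in M. 0 < W \<omega>) = 0" using measure_nonneg[of M] by (simp add: not_less antisym)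
    have ev: "{\<omega> \<in> space M. 0 < W \<omega>} \<in> events" by measurable
    have "AE \<omega> in M. \<omega> \<notin> {\<omega> \<in> space M. 0 < W \<omega>}" by (rule iffD1[OF prob_eq_0[OF ev] z])
    then have x_lim: "AE \<omega> in M. (\<lambda>n. x n \<omega>) \<longlonglongrightarrow> 0"
      using AE_L AE_space
    proof eventually_elim
      case (elim \<omega>)
      have "0 \<le> L \<omega>"
        using wpop_nonneg[of G] G by (intro LIMSEQ_le_const[OF elim(2)]) auto
      moreover have "\<not> 0 < W \<omega>" using elim by simp
      ultimately have "L \<omega> = 0" unfolding W_def using c by (simp add: zero_less_mult_iff)
      then have "(\<lambda>n. (wpop G k n \<omega> / real n powr a) / (growth a n / real n powr a)) \<longlonglongrightarrow> 0 / \<beta>"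
        using elim(2) \<beta> by (intro tendsto_divide) auto
      moreover have "\<forall>\<^sub>F n in sequentially.
          (wpop G k n \<omega> / real n powr a) / (growth a n / real n powr a) = x n \<omega>"
        using eventually_ge_at_top[of 1] by eventually_elim (simp add: x_def)
      ultimately show ?case by (simp add: Lim_transform_eventually)
    qed
    define \<kappa> where "\<kappa> = expectation (wpop (\<lambda>m. G m - H m) k (Suc ?N)) / growth a (Suc ?N)"
    have \<kappa>0: "0 < \<kappa>"
    proof -
      let ?F = "\<lambda>m. G m - H m"
      have F0: "0 \<le> ?F m" for m using HG by simp
      have "1 / t < 1 / s" using s t by (intro divide_strict_left_mono) auto
      then have F1: "0 < ?F 1" unfolding G_def H_def by simp
      have "0 < drift p k ?F 0"
        unfolding drift_eq_suminf
        by (rule suminf_pos2[OF drift_summable, where i = 0])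
          (use F0 F1 p0_pos in \<open>auto intro!: mult_nonneg_nonneg\<close>)
      moreover have "drift p k ?F 0 \<le> wpop (drift p k ?F) k ?N \<omega>" for \<omega>
        by (rule wpop_ge_self) (auto intro: drift_nonneg F0)
      then have "drift p k ?F 0 \<le> expectation (wpop (drift p k ?F) k ?N)"
        using integral_mono[OF _ integrable_wpop, of "\<lambda>_. drift p k ?F 0" "drift p k ?F" k ?N]
        by (simp add: prob_space)
      moreover have "0 \<le> expectation (wpop ?F k ?N)"
        by (intro Bochner_Integration.integral_nonneg wpop_nonneg F0)
      ultimately have "0 < expectation (wpop (drift p k ?F) k ?N)" "0 \<le> expectation (wpop ?F k ?N)"
        by linarith+
      moreover have "expectation (wpop ?F k (Suc ?N))
          = expectation (wpop ?F k ?N) + expectation (wpop (drift p k ?F) k ?N) / real (Suc ?N)"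
        using expected_step[of ?N "\<lambda>_. 1" k ?F] by simp
      ultimately have "0 < expectation (wpop ?F k (Suc ?N))" by (simp add: add_nonneg_pos)
      then show ?thesis unfolding \<kappa>_def using g by simp
    qed
    have Ex: "\<kappa> \<le> expectation (x n)" if "Suc ?N \<le> n" for n
    proof -
      have "\<kappa> \<le> expectation (wpop (\<lambda>m. G m - H m) k n) / growth a n"
        unfolding \<kappa>_def by (rule normalized_expectation_ge[OF dGH']) (use a that in auto)
      also have "\<dots> \<le> expectation (wpop G k n) / growth a n"
        using H less_imp_le[OF g[of n]]
        by (intro divide_right_mono integral_mono integrable_wpop wpop_mono_weight) auto
      also have "\<dots> = expectation (x n)" unfolding x_def by simp
      finally show ?thesis .
    qed
    obtain D where D0: "0 \<le> D" and D1: "\<forall>m n. ?N \<le> m \<longrightarrow> m \<le> n \<longrightarrow>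
      expectation (\<lambda>\<omega>. wpop G k n \<omega> * wpop G k n \<omega>) / (growth a n * growth a n) + D / growth a n
      \<le> expectation (\<lambda>\<omega>. wpop G k m \<omega> * wpop G k m \<omega>) / (growth a m * growth a m) + D / growth a m"
      using normalized_product_antimono[OF G dG a G(1) dG less_imp_le[OF a]] by blast
    note D = D0 D1[rule_format]
    define Q where "Q = expectation (\<lambda>\<omega>. wpop G k ?N \<omega> * wpop G k ?N \<omega>) / (growth a ?N * growth a ?N) + D / growth a ?N"
    have Q: "expectation (\<lambda>\<omega>. (x n \<omega>)\<^sup>2) \<le> Q" if "?N \<le> n" for n
    proof -
      have "expectation (\<lambda>\<omega>. (x n \<omega>)\<^sup>2)
          = expectation (\<lambda>\<omega>. wpop G k n \<omega> * wpop G k n \<omega>) / (growth a n * growth a n)"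
        unfolding x_def power2_eq_square by simp
      moreover have "0 \<le> D / growth a n" using D(1) g[of n] by simp
      ultimately show ?thesis using D(2)[OF order_refl that] unfolding Q_def by linarith
    qed
    have "\<not> (AE \<omega> in M. (\<lambda>n. x n \<omega>) \<longlonglongrightarrow> 0)"
      by (rule not_AE_tendsto_0_of_L2_bounded[OF ix[of "\<lambda>u. u"] ix[of "\<lambda>u. u\<^sup>2"] x0 \<kappa>0 Ex Q]) auto
    with x_lim show False by contradiction
  qed
  have W0: "\<forall>\<omega>\<in>space M. 0 \<le> W \<omega>" unfolding W_def using c by simp
  show ?thesis unfolding a_eq[symmetric]
    by (rule bexI[of _ W]) (use W0 pos AE_W in auto)
qed

end

theorem theorem3p14:
  fixes M :: "'a measure" and p :: "nat pmf" and Z V :: "nat \<Rightarrow> 'a \<Rightarrow> nat" and c :: real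
  assumes model: "attachment_model M p Z V"
    and finite_mean: "integrable (measure_pmf p) real"
    and p0: "0 < pmf p 0" "pmf p 0 < 1"
    and p01: "pmf p 0 + pmf p 1 < 1"
    and aperiodic: "Gcd {j. pmf p j > 0} = 1"
    and c: "0 < c" "c < 1"
  defines "PR \<equiv> \<lambda>k n \<omega>. pagerank c (random_tree Z V n \<omega>) k"
  shows
    "(measure_pmf.expectation p real > 1 \<longrightarrow>
       (\<forall>\<delta>>0. \<exists>\<epsilon>>0. \<epsilon> < c * (1 - c) * (1 - q_star p) \<and>
          liminf (\<lambda>n. ereal (\<P>(\<omega> in M. PR 0 n \<omega> / real n \<ge> c * (1 - c) * (1 - q_star p) - \<epsilon>)))
            \<ge> ereal (1 - \<delta>)) \<and>
       (\<forall>k\<ge>1. \<forall>\<delta>>0.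
          (AE \<omega> in M. filterlim (\<lambda>n. PR k n \<omega> / real n powr (1 / R_const p - \<delta>)) at_top sequentially) \<and>
          (AE \<omega> in M. (\<lambda>n. PR k n \<omega> / (real n powr (1 / R_const p) * ln (real n) powr (1 + \<delta>)))
             \<longlonglongrightarrow> 0)))
     \<and>
     (measure_pmf.expectation p real \<le> 1 \<longrightarrow>
       (c \<le> 1 / s0 p \<longrightarrow> (\<forall>k. \<forall>\<delta>>0.
          (AE \<omega> in M. filterlim (\<lambda>n. PR k n \<omega> / real n powr (1 / R_const p - \<delta>)) at_top sequentially) \<and>
          (AE \<omega> in M. (\<lambda>n. PR k n \<omega> / (real n powr (1 / R_const p) * ln (real n) powr (1 + \<delta>)))
             \<longlonglongrightarrow> 0))) \<and>
       (s0 p > 1 \<and> c > 1 / s0 p \<longrightarrow> (\<forall>k. \<exists>W \<in> borel_measurable M.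
          (\<forall>\<omega>\<in>space M. W \<omega> \<ge> 0) \<and> \<P>(\<omega> in M. W \<omega> > 0) > 0 \<and>
          (AE \<omega> in M. (\<lambda>n. PR k n \<omega> / real n powr (c * gen_fun p (1 / c))) \<longlonglongrightarrow> W \<omega>))))"
proof -
  interpret attachment_model M p Z V by (rule model)
  interpret branching_attachment M p Z V
    by unfold_locales (use p0 p01 in auto)
  have super: "(\<forall>\<delta>>0. \<exists>\<epsilon>>0. \<epsilon> < c * (1 - c) * (1 - q_star p) \<and>
          liminf (\<lambda>n. ereal (\<P>(\<omega> in M. PR 0 n \<omega> / real n \<ge> c * (1 - c) * (1 - q_star p) - \<epsilon>)))
            \<ge> ereal (1 - \<delta>))" if mean: "1 < measure_pmf.expectation p real"
  proof (intro allI impI)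
    fix \<delta> :: real assume \<delta>: "0 < \<delta>"
    obtain \<eta> where \<eta>: "0 < \<eta>"
      "\<And>n. 1 \<le> n \<Longrightarrow> 1 - \<delta> \<le> \<P>(\<omega> in M. \<eta> \<le> pagerank c (random_tree Z V n \<omega>) 0 / real n)"
      using root_pagerank_linear[OF finite_mean mean c \<delta>] by blast
    define A where "A = c * (1 - c) * (1 - q_star p)"
    have A: "0 < A" unfolding A_def using c q_star_less_1[OF finite_mean mean] by simp
    \<comment> \<open>the statement leaves \<open>\<epsilon>\<close> free below \<open>A\<close>; any lower bound for the score, cut at \<open>A / 2\<close>, yields one\<close>
    define \<epsilon> where "\<epsilon> = A - min \<eta> (A / 2)"
    have \<epsilon>: "0 < \<epsilon>" "\<epsilon> < A" "A - \<epsilon> \<le> \<eta>" unfolding \<epsilon>_def using A \<eta>(1) by auto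
    have "ereal (1 - \<delta>) \<le> liminf (\<lambda>n. ereal (\<P>(\<omega> in M. PR 0 n \<omega> / real n \<ge> A - \<epsilon>)))"
    proof (rule Liminf_bounded)
      show "\<forall>\<^sub>F n in sequentially. ereal (1 - \<delta>) \<le> ereal (\<P>(\<omega> in M. PR 0 n \<omega> / real n \<ge> A - \<epsilon>))"
        using eventually_ge_at_top[of 1]
      proof eventually_elim
        case (elim n)
        have [measurable]: "(\<lambda>\<omega>. pagerank c (random_tree Z V n \<omega>) 0) \<in> borel_measurable M"
          by (rule measurable_compose[OF measurable_random_tree]) simp
        have "1 - \<delta> \<le> \<P>(\<omega> in M. \<eta> \<le> pagerank c (random_tree Z V n \<omega>) 0 / real n)"
          by (rule \<eta>(2)[OF elim])
        also have "\<dots> \<le> \<P>(\<omega> in M. PR 0 n \<omega> / real n \<ge> A - \<epsilon>)"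
          unfolding PR_def
        proof (rule finite_measure_mono)
          show "{\<omega> \<in> space M. A - \<epsilon> \<le> pagerank c (random_tree Z V n \<omega>) 0 / real n} \<in> sets M"
            by measurable
        qed (use \<epsilon>(3) in auto)
        finally show ?case by simp
      qed
    qed
    then show "\<exists>\<epsilon>>0. \<epsilon> < c * (1 - c) * (1 - q_star p) \<and>
          liminf (\<lambda>n. ereal (\<P>(\<omega> in M. PR 0 n \<omega> / real n \<ge> c * (1 - c) * (1 - q_star p) - \<epsilon>)))
            \<ge> ereal (1 - \<delta>)"
      using \<epsilon> unfolding A_def by blast
  qed
  have lower: "AE \<omega> in M. filterlim (\<lambda>n. PR k n \<omega> / real n powr (1 / R_const p - \<delta>)) at_top sequentially"
    if "0 < \<delta>" for k \<delta>
    unfolding PR_def by (rule AE_pagerank_lower[OF c that])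
  have upper: "AE \<omega> in M. (\<lambda>n. PR k n \<omega> / (real n powr (1 / R_const p) * ln (real n) powr (1 + \<delta>))) \<longlonglongrightarrow> 0"
    if "c \<le> 1 / s0 p" "1 \<le> k \<or> 1 \<le> s0 p" "0 < \<delta>" for k \<delta>
    unfolding PR_def by (rule AE_pagerank_upper[OF c(1) that(1) c(2) that(2,3)])
  have c_super: "c \<le> 1 / s0 p" if "1 < measure_pmf.expectation p real"
  proof -
    have "1 \<le> 1 / s0 p" using s0_less_1[OF finite_mean that] s0_pos by simp
    then show ?thesis using c by linarith
  qed
  have s0_sub: "1 \<le> s0 p" if "measure_pmf.expectation p real \<le> 1"
    by (rule s0_ge_1[OF finite_mean that])
  have limit: "\<exists>W \<in> borel_measurable M.
          (\<forall>\<omega>\<in>space M. W \<omega> \<ge> 0) \<and> \<P>(\<omega> in M. W \<omega> > 0) > 0 \<and>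
          (AE \<omega> in M. (\<lambda>n. PR k n \<omega> / real n powr (c * gen_fun p (1 / c))) \<longlonglongrightarrow> W \<omega>)"
    if "1 / s0 p < c" for k
    unfolding PR_def by (rule pagerank_limit[OF c that])
  show ?thesis
    by (intro conjI impI allI super lower upper limit) (auto intro: c_super s0_sub)
qed

end
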